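(* Let $K$ be a compact Hausdorff space and let $f\in\mathcal{H}_b(C(K))$. Then $f$ is orthogonally additive if and only if there exist a finite positive regular Borel measure $\mu$ on $K$ and a power series function $h\in\mathcal{H}_b(C(K),L^1(\mu))$ such that $$f(x)=\int_K h(x)(t)\,d\mu(t)\quad\text{for all } x\in C(K).$$
   Context: $C(K)$ is the Banach algebra of complex-valued continuous functions on $K$ with the supremum norm. For complex Banach spaces $E,F$, $\mathcal{H}_b(E,F)$ denotes the space of holomorphic functions of bounded type, i.e. holomorphic functions $f\colon E\to F$ that are bounded on every bounded subset of $E$; $\mathcal{H}_b(E)=\mathcal{H}_b(E,\mathbb{C})$. A function $f\colon C(K)\to\mathbb{C}$ is orthogonally additive if $f(x+y)=f(x)+f(y)$ whenever $x,y\in C(K)$ satisfy $xy=0$ on $K$. For a measure $\mu$ on $K$, a function $h\colon C(K)\to L^1(\mu)$ is called a power series function if there are $g_k\in L^1(\mu)$, $k\ge 1$, such that $h(x)=\sum_{k=1}^\infty g_k x^k$ for all $x\in C(K)$ (convergence in $L^1(\mu)$), where $x^k$ is the pointwise power and $g_kx^k$ the pointwise product. *)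

theory Defs
  imports "HOL-Analysis.Analysis"
begin

text \<open>
  The space C(K) is the type of bounded continuous functions on K with the supremum norm; for
  compact K boundedness is automatic. This type carries only a real vector space structure in
  the library, hence the following multiplication by complex scalars.
\<close>

definition cscale ::
    "complex \<Rightarrow> ('k::topological_space \<Rightarrow>\<^sub>C complex) \<Rightarrow> ('k \<Rightarrow>\<^sub>C complex)"
  where "cscale c x = Bcontfun (\<lambda>t. c * apply_bcontfun x t)"

lemma apply_cscale [simp]: "apply_bcontfun (cscale c x) t = c * apply_bcontfun x t"
proof -
  have "bounded ((\<lambda>z. c * z) ` range (apply_bcontfun x))"
    by (rule bounded_linear_image[OF bounded_apply_bcontfun bounded_linear_mult_right])
  hence "(\<lambda>t. c * apply_bcontfun x t) \<in> bcontfun"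
    by (auto simp: bcontfun_def image_image intro!: continuous_intros)
  thus ?thesis
    by (simp add: cscale_def Bcontfun_inverse)
qed

text \<open>
  Holomorphy is Frechet differentiability over the complex numbers: at each point there is a
  bounded linear derivative that is complex-linear.
\<close>

definition holomorphic_CK :: "(('k::topological_space \<Rightarrow>\<^sub>C complex) \<Rightarrow> complex) \<Rightarrow> bool"
  where "holomorphic_CK f \<longleftrightarrow>
    (\<forall>x. \<exists>D. (f has_derivative D) (at x) \<and> (\<forall>c v. D (cscale c v) = c * D v))"

definition Hb :: "(('k::topological_space \<Rightarrow>\<^sub>C complex) \<Rightarrow> complex) set"
  where "Hb = {f. holomorphic_CK f \<and> (\<forall>S. bounded S \<longrightarrow> bounded (f ` S))}"

definition orthogonally_additive ::
    "(('k::topological_space \<Rightarrow>\<^sub>C complex) \<Rightarrow> complex) \<Rightarrow> bool"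
  where "orthogonally_additive f \<longleftrightarrow>
    (\<forall>x y. (\<forall>t. apply_bcontfun x t * apply_bcontfun y t = 0) \<longrightarrow> f (x + y) = f x + f y)"

definition regular_borel_measure :: "'k::topological_space measure \<Rightarrow> bool"
  where "regular_borel_measure \<mu> \<longleftrightarrow>
    sets \<mu> = sets borel \<and>
    (\<forall>A\<in>sets borel.
       emeasure \<mu> A = (INF U\<in>{U. open U \<and> A \<subseteq> U}. emeasure \<mu> U) \<and>
       emeasure \<mu> A = (SUP C\<in>{C. compact C \<and> C \<subseteq> A}. emeasure \<mu> C))"

text \<open>
  Elements of \<open>L\<^sup>1(\<mu>)\<close> are represented by integrable functions; identities between them
  are understood almost everywhere, and convergence is with respect to the seminorm below.
  None of the notions depends on the choice of representatives.
\<close>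

definition L1 :: "'k measure \<Rightarrow> ('k \<Rightarrow> complex) set"
  where "L1 \<mu> = {u. integrable \<mu> u}"

definition L1_norm :: "'k measure \<Rightarrow> ('k \<Rightarrow> complex) \<Rightarrow> real"
  where "L1_norm \<mu> u = (\<integral>t. norm (u t) \<partial>\<mu>)"

definition has_L1_derivative ::
    "'k measure \<Rightarrow> (('k::topological_space \<Rightarrow>\<^sub>C complex) \<Rightarrow> 'k \<Rightarrow> complex)
      \<Rightarrow> (('k \<Rightarrow>\<^sub>C complex) \<Rightarrow> 'k \<Rightarrow> complex) \<Rightarrow> ('k \<Rightarrow>\<^sub>C complex) \<Rightarrow> bool"
  where "has_L1_derivative \<mu> h D x \<longleftrightarrow>
    (\<forall>v. D v \<in> L1 \<mu>) \<and>
    (\<forall>v w. AE t in \<mu>. D (v + w) t = D v t + D w t) \<and>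
    (\<forall>c v. AE t in \<mu>. D (cscale c v) t = c * D v t) \<and>
    (\<exists>B. \<forall>v. L1_norm \<mu> (D v) \<le> B * norm v) \<and>
    ((\<lambda>y. L1_norm \<mu> (\<lambda>t. h y t - h x t - D (y - x) t) / norm (y - x)) \<longlongrightarrow> 0) (at x)"

definition Hb_L1 ::
    "'k measure \<Rightarrow> (('k::topological_space \<Rightarrow>\<^sub>C complex) \<Rightarrow> 'k \<Rightarrow> complex) set"
  where "Hb_L1 \<mu> = {h. (\<forall>x. h x \<in> L1 \<mu>) \<and>
    (\<forall>x. \<exists>D. has_L1_derivative \<mu> h D x) \<and>
    (\<forall>S. bounded S \<longrightarrow> (\<exists>B. \<forall>x\<in>S. L1_norm \<mu> (h x) \<le> B))}"

definition power_series_function ::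
    "'k measure \<Rightarrow> (('k::topological_space \<Rightarrow>\<^sub>C complex) \<Rightarrow> 'k \<Rightarrow> complex) \<Rightarrow> bool"
  where "power_series_function \<mu> h \<longleftrightarrow>
    (\<forall>x. h x \<in> L1 \<mu>) \<and>
    (\<exists>g :: nat \<Rightarrow> 'k \<Rightarrow> complex. (\<forall>k\<ge>1. g k \<in> L1 \<mu>) \<and>
      (\<forall>x. (\<lambda>n. L1_norm \<mu> (\<lambda>t. h x t - (\<Sum>k=1..n. g k t * apply_bcontfun x t ^ k)))
             \<longlonglongrightarrow> 0))"

end

theory Submission
  imports Defs "HOL-Complex_Analysis.Complex_Analysis"
begin

text \<open>
  Write \<open>f\<close> as its Taylor series at \<open>0\<close>: \<open>f x\<close> is the sum over \<open>k\<close> of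
  \<open>A\<^sub>k(x, ..., x) / k!\<close>, where \<open>A\<^sub>k(x\<^sub>1, ..., x\<^sub>k)\<close> is the iterated directional derivative of
  \<open>f\<close> at \<open>0\<close>, a symmetric \<open>k\<close>-linear form. The point of the direct implication is that
  \<open>A\<^sub>k\<close> depends only on the product of its arguments, so that
  \<open>A\<^sub>k(x, ..., x) = A\<^sub>k(x\<^sup>k, 1, ..., 1)\<close> is a bounded linear functional of \<open>x\<^sup>k\<close>, hence an
  integral against a complex measure.

  There are two steps to this. First, \<open>A\<^sub>k\<close> vanishes as soon as two of its arguments live on
  disjoint closed sets (\<open>deriv_form_separated\<close>). If each argument lives on one of two such sets
  and both sets occur, this is orthogonal additivity, differentiated; any further argument is
  split by a Urysohn function into a summand that joins the first group and one that joins the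
  second. Second, a bounded bilinear form \<open>B\<close> on \<open>C(K)\<close> that vanishes on separated pairs
  satisfies \<open>B(x, y) = B(1, x y)\<close> (\<open>zero_product_bilinear_form\<close>): cut a real \<open>x\<close> into
  pieces on which it is nearly constant. The error is a sum over the pieces, which can be
  regrouped into boundedly many values of \<open>B\<close> at bounded arguments, so it stays bounded when
  \<open>x\<close> is replaced by \<open>n x\<close>, and therefore it is zero. Applied to two arguments of \<open>A\<^sub>k\<close>
  at a time this gives \<open>deriv_form_power\<close>.

  The functional \<open>L\<^sub>k(v) = A\<^sub>k(v, 1, ..., 1) / k!\<close> inherits the Cauchy estimates: for
  \<open>0 \<le> v \<le> 1\<close> one has \<open>L\<^sub>k(v) = A\<^sub>k(x, ..., x) / k!\<close> with \<open>x\<close> the \<open>k\<close>-th root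
  of \<open>v\<close>, so \<open>L\<^sub>k\<close> decays faster than every geometric sequence (\<open>moment_bound\<close>). The
  positive and negative parts of the real and imaginary parts of all \<open>L\<^sub>k\<close> therefore add up to
  one positive functional. Its Riesz measure \<open>\<mu>\<close> dominates the Riesz measure of each of them, and the
  Radon-Nikodym derivatives combine to integrable \<open>g\<^sub>k\<close> that represent \<open>L\<^sub>k\<close> and whose norms
  decay in the same way (\<open>complex_Riesz_family\<close>). That decay is exactly what makes
  \<open>h(x) = \<Sum> g\<^sub>k x\<^sup>k\<close> holomorphic and bounded on bounded sets.

  Conversely, if \<open>x y = 0\<close> then \<open>(x + y)\<^sup>k = x\<^sup>k + y\<^sup>k\<close> pointwise for \<open>k \<ge> 1\<close>, so the
  integrals of the partial sums of \<open>h\<close> are orthogonally additive, and so is their limit.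
\<close>

section \<open>Bilinear forms on continuous functions vanishing on separated pairs\<close>

abbreviation cont :: "('k::topological_space \<Rightarrow> 'a::topological_space) \<Rightarrow> bool"
  where "cont u \<equiv> continuous_on UNIV u"

lemma Urysohn_compact_Hausdorff:
  fixes F G :: "'k::t2_space set"
  assumes K: "compact (UNIV :: 'k set)" and "closed F" "closed G" "F \<inter> G = {}"
  obtains u :: "'k \<Rightarrow> real" where "cont u" "\<And>t. 0 \<le> u t" "\<And>t. u t \<le> 1"
    "\<And>t. t \<in> F \<Longrightarrow> u t = 0" "\<And>t. t \<in> G \<Longrightarrow> u t = 1"
proof -
  have "normal_space (euclidean :: 'k topology)"
    using K by (intro compact_Hausdorff_or_regular_imp_normal_space)
      (auto simp: compact_space_def Hausdorff_space_def disjnt_def dest!: hausdorff)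
  then obtain u where u: "continuous_map euclidean (top_of_set {0..1::real}) u"
      "u ` F \<subseteq> {0}" "u ` G \<subseteq> {1}"
    using Urysohn_lemma[of "euclidean :: 'k topology" F G 0 1] assms
    by (auto simp: disjnt_def)
  then have c: "cont u" and r: "u t \<in> {0..1}" for t
    by (auto simp: continuous_map_in_subtopology)
  show thesis
    by (rule that[of u]) (use c r u(2,3) in auto)
qed

lemma cont_bounded:
  fixes a :: "'k::topological_space \<Rightarrow> 'a::real_normed_vector"
  assumes "compact (UNIV :: 'k set)" "cont a"
  obtains M where "M > 0" "\<And>t. norm (a t) \<le> M"
proof -
  have "bounded (range a)" using assms compact_continuous_image compact_imp_bounded by blast
  then show thesis using that by (auto simp: bounded_pos)
qed

lemma norm_sum_one_nonzero_le:
  fixes a :: "'i \<Rightarrow> complex"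
  assumes "finite I" "\<And>i j. i \<in> I \<Longrightarrow> j \<in> I \<Longrightarrow> i \<noteq> j \<Longrightarrow> a i = 0 \<or> a j = 0"
    and "\<And>i. i \<in> I \<Longrightarrow> norm (a i) \<le> c" "0 \<le> c"
  shows "norm (\<Sum>i\<in>I. a i) \<le> c"
proof (cases "\<exists>i\<in>I. a i \<noteq> 0")
  case True
  then obtain i where i: "i \<in> I" "a i \<noteq> 0" by blast
  then have "(\<Sum>j\<in>I. a j) = a i"
    using assms(1,2) by (subst sum.remove[of _ i]) (auto intro!: sum.neutral)
  then show ?thesis using assms(3) i by simp
next
  case False then show ?thesis using assms(4) by simp
qed

text \<open>
  At each point at most two neighbouring tents are positive, namely those centred at the floor of
  \<open>s\<close> and at its successor, and these two add up to one.
\<close>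
lemma sum_tents:
  fixes s :: real and I :: "int set"
  assumes "finite I" "\<lfloor>s\<rfloor> \<in> I" "\<lfloor>s\<rfloor> + 1 \<in> I"
  shows "(\<Sum>i\<in>I. max 0 (1 - \<bar>s - of_int i\<bar>)) = 1"
proof -
  have "(\<Sum>i\<in>I. max 0 (1 - \<bar>s - of_int i\<bar>)) = (\<Sum>i\<in>{\<lfloor>s\<rfloor>, \<lfloor>s\<rfloor> + 1}. max 0 (1 - \<bar>s - of_int i\<bar>))"
  proof (rule sum.mono_neutral_right)
    show "\<forall>i\<in>I - {\<lfloor>s\<rfloor>, \<lfloor>s\<rfloor> + 1}. max 0 (1 - \<bar>s - of_int i\<bar>) = 0"
    proof
      fix i assume "i \<in> I - {\<lfloor>s\<rfloor>, \<lfloor>s\<rfloor> + 1}"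
      then have "i \<le> \<lfloor>s\<rfloor> - 1 \<or> i \<ge> \<lfloor>s\<rfloor> + 2" by auto
      then have "of_int i \<le> s - 1 \<or> of_int i \<ge> s + 1" by linarith
      then show "max 0 (1 - \<bar>s - of_int i\<bar>) = 0" by auto
    qed
  qed (use assms in auto)
  also have "\<dots> = 1" by simp linarith
  finally show ?thesis .
qed

text \<open>
  For real \<open>u\<close>, let \<open>\<phi>\<^sub>i\<close> be the tent supported on \<open>[i - 1, i + 1]\<close>, evaluated at
  \<open>u\<close>, and \<open>\<psi>\<^sub>i\<close> a wider plateau that is one near the support of \<open>\<phi>\<^sub>i\<close>. As \<open>B\<close>
  vanishes on separated pairs, \<open>B(\<phi>\<^sub>i a, b) = B(\<phi>\<^sub>i a, \<psi>\<^sub>i b)\<close>. Hence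
  \<open>B(u, y) - B(1, u y)\<close> is the sum over \<open>i\<close> of
  \<open>B(\<phi>\<^sub>i (u - i), \<psi>\<^sub>i y) - B(\<phi>\<^sub>i, \<psi>\<^sub>i (u - i) y)\<close>, where all arguments are bounded
  independently of \<open>u\<close>. The indices in one residue class modulo \<open>7\<close> have pairwise disjoint
  plateaus, so the sum over such a class is a single value of \<open>B\<close> at bounded arguments. The
  resulting bound does not depend on \<open>u\<close>, and replacing \<open>u\<close> by \<open>n u\<close> forces the difference
  to vanish.
\<close>
lemma zero_product_bilinear_form:
  fixes B :: "('k::t2_space \<Rightarrow> complex) \<Rightarrow> ('k \<Rightarrow> complex) \<Rightarrow> complex"
  assumes K: "compact (UNIV :: 'k set)"
    and addl: "\<And>a a' b. cont a \<Longrightarrow> cont a' \<Longrightarrow> cont b \<Longrightarrow> B (\<lambda>t. a t + a' t) b = B a b + B a' b"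
    and addr: "\<And>a b b'. cont a \<Longrightarrow> cont b \<Longrightarrow> cont b' \<Longrightarrow> B a (\<lambda>t. b t + b' t) = B a b + B a b'"
    and scalel: "\<And>c a b. cont a \<Longrightarrow> cont b \<Longrightarrow> B (\<lambda>t. c * a t) b = c * B a b"
    and scaler: "\<And>c a b. cont a \<Longrightarrow> cont b \<Longrightarrow> B a (\<lambda>t. c * b t) = c * B a b"
    and bound: "\<And>a b. cont a \<Longrightarrow> cont b \<Longrightarrow> (\<And>t. norm (a t) \<le> 1) \<Longrightarrow> (\<And>t. norm (b t) \<le> 1) \<Longrightarrow>
      norm (B a b) \<le> C"
    and zero: "\<And>a b F G. cont a \<Longrightarrow> cont b \<Longrightarrow> closed F \<Longrightarrow> closed G \<Longrightarrow> F \<inter> G = {} \<Longrightarrow>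
      (\<And>t. t \<notin> F \<Longrightarrow> a t = 0) \<Longrightarrow> (\<And>t. t \<notin> G \<Longrightarrow> b t = 0) \<Longrightarrow> B a b = 0"
    and x: "cont x" and y: "cont y"
  shows "B x y = B (\<lambda>_. 1) (\<lambda>t. x t * y t)"
proof -
  have B0l: "B (\<lambda>_. 0) b = 0" if "cont b" for b
    using scalel[of "\<lambda>_. 0" b 0] that by simp
  have B0r: "B b (\<lambda>_. 0) = 0" if "cont b" for b
    using scaler[of b "\<lambda>_. 0" 0] that by simp
  have suml: "B (\<lambda>t. \<Sum>i\<in>I. a i t) b = (\<Sum>i\<in>I. B (a i) b)"
    if "finite I" "\<And>i. i \<in> I \<Longrightarrow> cont (a i)" "cont b" for I :: "int set" and a b
    using that by (induction I rule: finite_induct) (auto simp: B0l addl continuous_on_sum)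
  have sumr: "B b (\<lambda>t. \<Sum>i\<in>I. a i t) = (\<Sum>i\<in>I. B b (a i))"
    if "finite I" "\<And>i. i \<in> I \<Longrightarrow> cont (a i)" "cont b" for I :: "int set" and a b
    using that by (induction I rule: finite_induct) (auto simp: B0r addr continuous_on_sum)
  (* If the off-diagonal terms vanish and the families are pointwise disjoint, then the sum of the
     diagonal terms is one value of B at arguments that are still bounded by one. *)
  have diag: "norm (\<Sum>i\<in>I. B (a i) (b i)) \<le> C"
    if I: "finite I" and ca: "\<And>i. i \<in> I \<Longrightarrow> cont (a i)" and cb: "\<And>i. i \<in> I \<Longrightarrow> cont (b i)"
      and a1: "\<And>i t. i \<in> I \<Longrightarrow> norm (a i t) \<le> 1" and b1: "\<And>i t. i \<in> I \<Longrightarrow> norm (b i t) \<le> 1"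
      and aa: "\<And>i j t. i \<in> I \<Longrightarrow> j \<in> I \<Longrightarrow> i \<noteq> j \<Longrightarrow> a i t = 0 \<or> a j t = 0"
      and bb: "\<And>i j t. i \<in> I \<Longrightarrow> j \<in> I \<Longrightarrow> i \<noteq> j \<Longrightarrow> b i t = 0 \<or> b j t = 0"
      and ab: "\<And>i j. i \<in> I \<Longrightarrow> j \<in> I \<Longrightarrow> i \<noteq> j \<Longrightarrow> B (a i) (b j) = 0"
    for I :: "int set" and a b
  proof -
    have "B (\<lambda>t. \<Sum>i\<in>I. a i t) (\<lambda>t. \<Sum>j\<in>I. b j t) = (\<Sum>i\<in>I. \<Sum>j\<in>I. B (a i) (b j))"
      using I ca cb by (subst suml) (auto simp: continuous_on_sum intro!: sum.cong sumr)
    also have "\<dots> = (\<Sum>i\<in>I. B (a i) (b i))"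
    proof (rule sum.cong[OF refl])
      fix i assume "i \<in> I"
      then show "(\<Sum>j\<in>I. B (a i) (b j)) = B (a i) (b i)"
        using I ab by (subst sum.remove[of _ i]) (auto intro!: sum.neutral)
    qed
    finally have "(\<Sum>i\<in>I. B (a i) (b i)) = B (\<lambda>t. \<Sum>i\<in>I. a i t) (\<lambda>t. \<Sum>j\<in>I. b j t)" ..
    also have "norm \<dots> \<le> C"
      using I ca cb a1 b1 aa bb
      by (intro bound norm_sum_one_nonzero_le continuous_on_sum) auto
    finally show ?thesis .
  qed
  have real_unit: "norm (B (\<lambda>t. of_real (u t)) y - B (\<lambda>_. 1) (\<lambda>t. of_real (u t) * y t)) \<le> 28 * C"
    if u: "cont u" and y: "cont y" "\<And>t. norm (y t) \<le> 1" for u :: "'k \<Rightarrow> real" and y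
  proof -
    obtain M where M: "\<And>t. norm (u t) \<le> M" using cont_bounded[OF K u] by blast
    (* the index set must contain the floor of every value of u and its successor *)
    define m where "m = \<lceil>M\<rceil> + 2"
    define I where "I = {- m..m}"
    have I: "finite I" by (simp add: I_def)
    have inI: "\<lfloor>u t\<rfloor> \<in> I" "\<lfloor>u t\<rfloor> + 1 \<in> I" for t
      using M[of t] unfolding I_def m_def by (simp_all add: abs_le_iff) linarith+
    define \<phi> where "\<phi> i t = complex_of_real (max 0 (1 - \<bar>u t - of_int i\<bar>))" for i :: int and t
    define \<psi> where "\<psi> i t = complex_of_real (min 1 (max 0 (3 - \<bar>u t - of_int i\<bar>)))" for i :: int and t
    define d where "d i t = complex_of_real (u t - of_int i)" for i :: int and t
    have c[continuous_intros]: "cont (\<phi> i)" "cont (\<psi> i)" "cont (d i)" for i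
      unfolding \<phi>_def \<psi>_def d_def by (intro continuous_intros u)+
    have cu: "cont (\<lambda>t. complex_of_real (u t))" by (intro continuous_intros u)
    note ci = c cu u y continuous_intros
    have \<phi>_sum: "(\<Sum>i\<in>I. \<phi> i t) = 1" for t
      using sum_tents[OF I inI] unfolding \<phi>_def by (metis of_real_1 of_real_sum)
    have cut: "B (\<lambda>t. \<phi> i t * a t) b = B (\<lambda>t. \<phi> i t * a t) (\<lambda>t. \<psi> i t * b t)"
      if "cont a" "cont b" for i a b
    proof -
      have "B (\<lambda>t. \<phi> i t * a t) (\<lambda>t. (1 - \<psi> i t) * b t) = 0"
      proof (rule zero[where F = "{t. \<bar>u t - of_int i\<bar> \<le> 1}" and G = "{t. \<bar>u t - of_int i\<bar> \<ge> 2}"])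
        show "closed {t. \<bar>u t - of_int i\<bar> \<le> 1}" "closed {t. \<bar>u t - of_int i\<bar> \<ge> 2}"
          by (intro closed_Collect_le continuous_intros u)+
      qed (auto simp: \<phi>_def \<psi>_def intro!: ci that)
      moreover have "b = (\<lambda>t. \<psi> i t * b t + (1 - \<psi> i t) * b t)" by (auto simp: algebra_simps)
      then have "B (\<lambda>t. \<phi> i t * a t) b = B (\<lambda>t. \<phi> i t * a t) (\<lambda>t. \<psi> i t * b t)
          + B (\<lambda>t. \<phi> i t * a t) (\<lambda>t. (1 - \<psi> i t) * b t)"
        by (subst (1) \<open>b = _\<close>, subst addr) (auto intro!: ci that)
      ultimately show ?thesis by simp
    qed
    define R where "R i = B (\<lambda>t. \<phi> i t * d i t) (\<lambda>t. \<psi> i t * y t)" for i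
    (* the factor 3 bounds u - i on the plateau; dividing by it makes the argument of B at most 1 *)
    define S where "S i = B (\<phi> i) (\<lambda>t. \<psi> i t * d i t * y t / 3)" for i
    have "B (\<lambda>t. of_real (u t)) y = B (\<lambda>t. \<Sum>i\<in>I. \<phi> i t * of_real (u t)) y"
      by (simp add: \<phi>_sum flip: sum_distrib_right)
    also have "\<dots> = (\<Sum>i\<in>I. B (\<lambda>t. \<phi> i t * of_real (u t)) y)"
      by (rule suml) (auto intro!: ci I)
    also have "\<dots> = (\<Sum>i\<in>I. R i + of_int i * B (\<phi> i) (\<lambda>t. \<psi> i t * y t))"
    proof (rule sum.cong[OF refl])
      fix i
      have "(\<lambda>t. \<phi> i t * of_real (u t)) = (\<lambda>t. \<phi> i t * d i t + of_int i * \<phi> i t)"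
        by (auto simp: d_def algebra_simps)
      then have "B (\<lambda>t. \<phi> i t * of_real (u t)) (\<lambda>t. \<psi> i t * y t)
          = R i + of_int i * B (\<phi> i) (\<lambda>t. \<psi> i t * y t)"
        unfolding R_def by (simp, subst addl) (auto intro!: ci scalel)
      then show "B (\<lambda>t. \<phi> i t * of_real (u t)) y = R i + of_int i * B (\<phi> i) (\<lambda>t. \<psi> i t * y t)"
        by (subst cut) (auto intro!: ci)
    qed
    finally have 1: "B (\<lambda>t. of_real (u t)) y = (\<Sum>i\<in>I. R i + of_int i * B (\<phi> i) (\<lambda>t. \<psi> i t * y t))" .
    have "B (\<lambda>_. 1) (\<lambda>t. of_real (u t) * y t) = B (\<lambda>t. \<Sum>i\<in>I. \<phi> i t) (\<lambda>t. of_real (u t) * y t)"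
      by (simp add: \<phi>_sum)
    also have "\<dots> = (\<Sum>i\<in>I. B (\<phi> i) (\<lambda>t. of_real (u t) * y t))"
      by (rule suml) (auto intro!: ci I)
    also have "\<dots> = (\<Sum>i\<in>I. 3 * S i + of_int i * B (\<phi> i) (\<lambda>t. \<psi> i t * y t))"
    proof (rule sum.cong[OF refl])
      fix i
      have "(\<lambda>t. \<psi> i t * (of_real (u t) * y t))
          = (\<lambda>t. 3 * (\<psi> i t * d i t * y t / 3) + of_int i * (\<psi> i t * y t))"
        by (rule ext) (simp add: d_def field_simps)
      then have "B (\<phi> i) (\<lambda>t. \<psi> i t * (of_real (u t) * y t))
          = B (\<phi> i) (\<lambda>t. 3 * (\<psi> i t * d i t * y t / 3)) + B (\<phi> i) (\<lambda>t. of_int i * (\<psi> i t * y t))"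
        by (simp only:) (rule addr; intro ci; simp)
      also have "B (\<phi> i) (\<lambda>t. 3 * (\<psi> i t * d i t * y t / 3)) = 3 * S i"
        unfolding S_def by (rule scaler; intro ci; simp)
      also have "B (\<phi> i) (\<lambda>t. of_int i * (\<psi> i t * y t)) = of_int i * B (\<phi> i) (\<lambda>t. \<psi> i t * y t)"
        by (rule scaler; intro ci)
      finally have "B (\<phi> i) (\<lambda>t. \<psi> i t * (of_real (u t) * y t))
          = 3 * S i + of_int i * B (\<phi> i) (\<lambda>t. \<psi> i t * y t)" .
      then show "B (\<phi> i) (\<lambda>t. of_real (u t) * y t) = 3 * S i + of_int i * B (\<phi> i) (\<lambda>t. \<psi> i t * y t)"
        using cut[of "\<lambda>_. 1" "\<lambda>t. of_real (u t) * y t" i, OF continuous_on_const continuous_on_mult[OF cu y(1)]]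
        by simp
    qed
    finally have 2: "B (\<lambda>_. 1) (\<lambda>t. of_real (u t) * y t)
      = (\<Sum>i\<in>I. 3 * S i + of_int i * B (\<phi> i) (\<lambda>t. \<psi> i t * y t))" .
    have diff: "B (\<lambda>t. of_real (u t)) y - B (\<lambda>_. 1) (\<lambda>t. of_real (u t) * y t)
      = (\<Sum>i\<in>I. R i) - 3 * (\<Sum>i\<in>I. S i)"
      unfolding 1 2 by (simp add: sum.distrib sum_distrib_left)
    (* plateaus have half-width 3, so the supports of different indices in one class are disjoint *)
    have split: "(\<Sum>i\<in>I. X i) = (\<Sum>r\<in>{0..<7}. \<Sum>i\<in>{i\<in>I. i mod 7 = r}. X i)" for X :: "int \<Rightarrow> complex"
      by (rule sum.group[symmetric]) (auto intro!: I)
    have far: "\<bar>i - j\<bar> \<ge> 7" if "i mod 7 = r" "j mod 7 = r" "i \<noteq> j" for i j r :: int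
      using that dvd_imp_le_int[of "i - j" 7] mod_eq_dvd_iff[of i 7 j] by auto
    have bd: "norm (\<phi> i t) \<le> 1" "norm (\<phi> i t * d i t) \<le> 1" "norm (\<psi> i t * y t) \<le> 1"
      "norm (\<psi> i t * d i t * y t / 3) \<le> 1" for i t
    proof -
      have p: "norm (\<phi> i t) \<le> 1" "norm (\<psi> i t) \<le> 1" by (auto simp: \<phi>_def \<psi>_def)
      then show "norm (\<phi> i t) \<le> 1" "norm (\<psi> i t * y t) \<le> 1"
        using y(2)[of t] by (auto simp: norm_mult intro: mult_le_one)
      have dn: "norm (d i t) = \<bar>u t - of_int i\<bar>" unfolding d_def by (simp only: norm_of_real real_norm_def)
      show "norm (\<phi> i t * d i t) \<le> 1"
      proof (cases "\<phi> i t = 0")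
        case False
        then have "norm (d i t) \<le> 1" by (auto simp: \<phi>_def dn split: if_splits)
        then show ?thesis using p by (auto simp: norm_mult intro: mult_le_one)
      qed auto
      show "norm (\<psi> i t * d i t * y t / 3) \<le> 1"
      proof (cases "\<psi> i t = 0")
        case False
        then have "norm (d i t) \<le> 3" by (auto simp: \<psi>_def dn split: if_splits)
        then have "norm (\<psi> i t) * norm (d i t) * norm (y t) \<le> 1 * 3 * 1"
          using p y(2) by (intro mult_mono) auto
        then show ?thesis by (simp add: norm_mult norm_divide)
      qed auto
    qed
    have sep0: "\<phi> i t = 0 \<or> \<phi> j t = 0" "\<psi> i t = 0 \<or> \<psi> j t = 0"
      if "\<bar>i - j\<bar> \<ge> 7" for i j t
    proof -
      have "\<bar>real_of_int i - real_of_int j\<bar> \<ge> 7" using that by linarith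
      then have "\<bar>u t - of_int i\<bar> \<ge> 3 \<or> \<bar>u t - of_int j\<bar> \<ge> 3" by linarith
      then show "\<phi> i t = 0 \<or> \<phi> j t = 0" "\<psi> i t = 0 \<or> \<psi> j t = 0"
        by (auto simp: \<phi>_def \<psi>_def)
    qed
    have sepB: "B (\<lambda>t. \<phi> i t * a t) (\<lambda>t. \<psi> j t * b t) = 0"
      if "\<bar>i - j\<bar> \<ge> 7" "cont a" "cont b" for i j a b
    proof (rule zero[where F = "{t. \<bar>u t - of_int i\<bar> \<le> 1}" and G = "{t. \<bar>u t - of_int j\<bar> \<le> 3}"])
      show "closed {t. \<bar>u t - of_int i\<bar> \<le> 1}" "closed {t. \<bar>u t - of_int j\<bar> \<le> 3}"
        by (intro closed_Collect_le continuous_intros u)+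
      have "\<bar>real_of_int i - real_of_int j\<bar> \<ge> 7" using that by linarith
      then show "{t. \<bar>u t - of_int i\<bar> \<le> 1} \<inter> {t. \<bar>u t - of_int j\<bar> \<le> 3} = {}" by auto
    qed (auto simp: \<phi>_def \<psi>_def intro!: ci that)
    define J where "J r = {i \<in> I. i mod 7 = r}" for r
    have J: "finite (J r)" for r using I by (simp add: J_def)
    have JJ: "\<bar>i - j\<bar> \<ge> 7" if "i \<in> J r" "j \<in> J r" "i \<noteq> j" for i j r
      using that far by (simp add: J_def)
    have "norm (\<Sum>i\<in>J r. R i) \<le> C" for r
      unfolding R_def
    proof (rule diag[OF J])
      fix i j t assume "i \<in> J r" "j \<in> J r" "i \<noteq> j"
      note far_ij = JJ[OF this]
      show "\<phi> i t * d i t = 0 \<or> \<phi> j t * d j t = 0" using sep0(1)[OF far_ij, of t] by auto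
      show "\<psi> i t * y t = 0 \<or> \<psi> j t * y t = 0" using sep0(2)[OF far_ij, of t] by auto
      show "B (\<lambda>t. \<phi> i t * d i t) (\<lambda>t. \<psi> j t * y t) = 0" by (rule sepB[OF far_ij]) (intro ci)+
    qed (rule bd | intro ci)+
    then have "norm (\<Sum>i\<in>I. R i) \<le> (\<Sum>r\<in>{0..<7::int}. C)"
      unfolding split by (intro sum_norm_le) (simp add: J_def)
    moreover have "norm (\<Sum>i\<in>J r. S i) \<le> C" for r
      unfolding S_def
    proof (rule diag[OF J])
      fix i j t assume "i \<in> J r" "j \<in> J r" "i \<noteq> j"
      note far_ij = JJ[OF this]
      show "\<phi> i t = 0 \<or> \<phi> j t = 0" by (rule sep0(1)[OF far_ij])
      show "\<psi> i t * d i t * y t / 3 = 0 \<or> \<psi> j t * d j t * y t / 3 = 0"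
        using sep0(2)[OF far_ij, of t] by auto
      have "B (\<lambda>t. \<phi> i t * 1) (\<lambda>t. \<psi> j t * (d j t * y t / 3)) = 0"
        by (rule sepB[OF far_ij]; intro ci; simp)
      then show "B (\<phi> i) (\<lambda>t. \<psi> j t * d j t * y t / 3) = 0" by (simp add: mult.assoc)
    qed (rule bd | (intro ci; simp))+
    then have "norm (\<Sum>i\<in>I. S i) \<le> (\<Sum>r\<in>{0..<7::int}. C)"
      unfolding split by (intro sum_norm_le) (simp add: J_def)
    ultimately show ?thesis
      unfolding diff using norm_triangle_ineq4[of "sum R I" "3 * sum S I"] by (simp add: norm_mult)
  qed
  have real_case: "B (\<lambda>t. of_real (u t)) y = B (\<lambda>_. 1) (\<lambda>t. of_real (u t) * y t)"
    if u: "cont u" for u :: "'k \<Rightarrow> real"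
  proof -
    obtain M where M: "M > 0" "\<And>t. norm (y t) \<le> M" using cont_bounded[OF K y] by blast
    define D where "D = B (\<lambda>t. of_real (u t)) y - B (\<lambda>_. 1) (\<lambda>t. of_real (u t) * y t)"
    have "real n * (norm D / M) \<le> 28 * C" for n
    proof -
      have "norm (B (\<lambda>t. of_real (real n * u t)) (\<lambda>t. of_real (1 / M) * y t)
          - B (\<lambda>_. 1) (\<lambda>t. of_real (real n * u t) * (of_real (1 / M) * y t))) \<le> 28 * C"
        using M by (intro real_unit) (auto intro!: continuous_intros u y simp: norm_mult field_simps norm_divide)
      moreover have "(\<lambda>t. of_real (real n * u t) * (of_real (1 / M) * y t))
          = (\<lambda>t. of_real (real n / M) * (of_real (u t) * y t))"
        by (auto simp: field_simps)
      moreover have "B (\<lambda>_. 1) (\<lambda>t. of_real (real n / M) * (of_real (u t) * y t))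
          = of_real (real n / M) * B (\<lambda>_. 1) (\<lambda>t. of_real (u t) * y t)"
        by (rule scaler) (auto intro!: continuous_intros u y)
      moreover have "B (\<lambda>t. of_real (real n * u t)) (\<lambda>t. of_real (1 / M) * y t)
          = of_real (real n / M) * B (\<lambda>t. of_real (u t)) y"
      proof -
        have "B (\<lambda>t. of_real (real n * u t)) (\<lambda>t. of_real (1 / M) * y t)
            = of_real (1 / M) * B (\<lambda>t. of_real (real n) * of_real (u t)) y"
          unfolding of_real_mult by (rule scaler) (intro continuous_intros u y)+
        also have "B (\<lambda>t. of_real (real n) * of_real (u t)) y = of_real (real n) * B (\<lambda>t. of_real (u t)) y"
          by (rule scalel) (intro continuous_intros u y)+
        finally show ?thesis by simp
      qed
      ultimately have "norm (of_real (real n / M) * D) \<le> 28 * C"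
        unfolding D_def by (simp only: right_diff_distrib)
      then show ?thesis using M by (simp add: norm_mult norm_divide)
    qed
    then have "norm D / M \<le> 0"
      using reals_Archimedean3[of "norm D / M"] by (meson linorder_not_le)
    then have "D = 0" using M by (simp add: field_simps)
    then show ?thesis by (simp add: D_def)
  qed
  have ri: "cont (\<lambda>t. Re (x t))" "cont (\<lambda>t. Im (x t))" by (intro continuous_intros x)+
  have "B x y = B (\<lambda>t. of_real (Re (x t)) + \<i> * of_real (Im (x t))) y"
    by (simp only: complex_eq[symmetric])
  also have "\<dots> = B (\<lambda>t. of_real (Re (x t))) y + \<i> * B (\<lambda>t. of_real (Im (x t))) y"
  proof -
    have "B (\<lambda>t. \<i> * of_real (Im (x t))) y = \<i> * B (\<lambda>t. of_real (Im (x t))) y"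
      by (rule scalel) (intro continuous_intros ri y)+
    moreover have "B (\<lambda>t. of_real (Re (x t)) + \<i> * of_real (Im (x t))) y
        = B (\<lambda>t. of_real (Re (x t))) y + B (\<lambda>t. \<i> * of_real (Im (x t))) y"
      by (rule addl) (intro continuous_intros ri y)+
    ultimately show ?thesis by simp
  qed
  also have "\<dots> = B (\<lambda>_. 1) (\<lambda>t. of_real (Re (x t)) * y t) + \<i> * B (\<lambda>_. 1) (\<lambda>t. of_real (Im (x t)) * y t)"
    by (simp add: real_case ri)
  also have "\<dots> = B (\<lambda>_. 1) (\<lambda>t. of_real (Re (x t)) * y t + \<i> * (of_real (Im (x t)) * y t))"
  proof -
    have "B (\<lambda>_. 1) (\<lambda>t. \<i> * (of_real (Im (x t)) * y t)) = \<i> * B (\<lambda>_. 1) (\<lambda>t. of_real (Im (x t)) * y t)"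
      by (rule scaler) (intro continuous_intros ri y)+
    moreover have "B (\<lambda>_. 1) (\<lambda>t. of_real (Re (x t)) * y t + \<i> * (of_real (Im (x t)) * y t))
        = B (\<lambda>_. 1) (\<lambda>t. of_real (Re (x t)) * y t) + B (\<lambda>_. 1) (\<lambda>t. \<i> * (of_real (Im (x t)) * y t))"
      by (rule addr) (intro continuous_intros ri y)+
    ultimately show ?thesis by simp
  qed
  also have "(\<lambda>t. of_real (Re (x t)) * y t + \<i> * (of_real (Im (x t)) * y t)) = (\<lambda>t. x t * y t)"
    by (simp add: complex_eq_iff fun_eq_iff)
  finally show ?thesis .
qed

section \<open>Directional derivatives of entire functions of bounded type\<close>

lemma cscale_simps [simp]:
  "cscale 0 v = 0" "cscale 1 v = v" "cscale c 0 = 0"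
  by (auto intro!: bcontfun_eqI)

lemma cscale_add_left: "cscale (a + b) v = cscale a v + cscale b v"
  by (auto intro!: bcontfun_eqI simp: algebra_simps)

lemma norm_bcontfun_le:
  fixes x :: "'k::topological_space \<Rightarrow>\<^sub>C complex"
  assumes "\<And>t. norm (apply_bcontfun x t) \<le> b"
  shows "norm x \<le> b"
  using assms by (rule norm_bound)

lemma norm_cscale_le: "norm (cscale c v) \<le> norm c * norm v"
  by (rule norm_bcontfun_le) (auto simp: norm_mult intro!: mult_left_mono norm_bounded)

text \<open>
  Holomorphy along complex lines and boundedness on balls are a pair of properties that passes to
  directional derivatives, so that a function with both can be differentiated repeatedly.
\<close>
definition gateaux_entire :: "(('k::topological_space \<Rightarrow>\<^sub>C complex) \<Rightarrow> complex) \<Rightarrow> bool"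
  where "gateaux_entire g \<longleftrightarrow> (\<forall>z v. (\<lambda>c. g (z + cscale c v)) holomorphic_on UNIV) \<and>
    (\<forall>r. \<exists>M. \<forall>z. norm z \<le> r \<longrightarrow> norm (g z) \<le> M)"

definition dir_deriv :: "('k::topological_space \<Rightarrow>\<^sub>C complex) \<Rightarrow> (('k \<Rightarrow>\<^sub>C complex) \<Rightarrow> complex) \<Rightarrow>
    ('k \<Rightarrow>\<^sub>C complex) \<Rightarrow> complex"
  where "dir_deriv v g z = deriv (\<lambda>c. g (z + cscale c v)) 0"

lemma gateaux_entireD:
  assumes "gateaux_entire g"
  shows "(\<lambda>c. g (z + cscale c v)) holomorphic_on A"
  using assms holomorphic_on_subset unfolding gateaux_entire_def by blast

lemma gateaux_entire_bounded:
  assumes "gateaux_entire g"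
  obtains M where "\<And>z. norm z \<le> r \<Longrightarrow> norm (g z) \<le> M"
  using assms unfolding gateaux_entire_def by blast

lemma deriv_along_line:
  fixes g :: "('k::topological_space \<Rightarrow>\<^sub>C complex) \<Rightarrow> complex"
  shows "deriv (\<lambda>c. g (z + cscale c v)) a = dir_deriv v g (z + cscale a v)"
proof -
  have "deriv (\<lambda>c. g (z + cscale c v)) a = deriv (\<lambda>c. g (z + cscale (a + c) v)) 0"
    using deriv_shift_0'[where f = "\<lambda>c. g (z + cscale c v)" and z = a] by (simp add: comp_def)
  then show ?thesis by (simp add: dir_deriv_def cscale_add_left add.assoc)
qed

lemma norm_deriv_le_entire:
  fixes h :: "complex \<Rightarrow> complex"
  assumes "h holomorphic_on UNIV" "\<And>c. norm (c - a) \<le> 1 \<Longrightarrow> norm (h c) \<le> M"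
  shows "norm ((deriv ^^ n) h a) \<le> fact n * M"
proof -
  have "norm ((deriv ^^ n) h a) \<le> fact n * M / 1 ^ n"
    by (rule Cauchy_inequality)
      (use assms holomorphic_on_imp_continuous_on holomorphic_on_subset in
        \<open>auto simp: norm_minus_commute\<close>)
  then show ?thesis by simp
qed

text \<open>
  Cauchy estimate on the unit circle of the line through \<open>z\<close> in direction \<open>v\<close>.
\<close>
lemma norm_dir_deriv_le:
  assumes g: "gateaux_entire g" and M: "\<And>y. norm y \<le> norm z + norm v \<Longrightarrow> norm (g y) \<le> M"
  shows "norm (dir_deriv v g z) \<le> M"
proof -
  have "norm ((deriv ^^ 1) (\<lambda>c. g (z + cscale c v)) 0) \<le> fact 1 * M"
  proof (rule norm_deriv_le_entire)
    fix c :: complex assume "norm (c - 0) \<le> 1"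
    then have "norm (cscale c v) \<le> norm v"
      using norm_cscale_le[of c v] by (simp add: mult_left_le_one_le order_trans)
    then show "norm (g (z + cscale c v)) \<le> M" by (intro M) (meson norm_triangle_le add_left_mono)
  qed (rule gateaux_entireD[OF g])
  then show ?thesis by (simp add: dir_deriv_def)
qed

text \<open>
  Quantitative convergence of the difference quotients: the second derivative on the unit disc is
  controlled by the bound on the disc of radius two. The uniformity in \<open>h\<close> is what allows
  interchanging two directional derivatives.
\<close>
lemma difference_quotient_entire:
  fixes h :: "complex \<Rightarrow> complex"
  assumes h: "h holomorphic_on UNIV" and M: "\<And>c. norm c \<le> 2 \<Longrightarrow> norm (h c) \<le> M"
    and e: "norm e \<le> 1" "e \<noteq> 0"
  shows "norm ((h e - h 0) / e - deriv h 0) \<le> 2 * M * norm e"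
proof -
  have B: "norm ((deriv ^^ 2) h c) \<le> 2 * M" if "norm c \<le> 1" for c
  proof -
    have "norm ((deriv ^^ 2) h c) \<le> fact 2 * M"
    proof (rule norm_deriv_le_entire[OF h])
      fix d assume "norm (d - c) \<le> 1"
      then show "norm (h d) \<le> M" using that norm_triangle_sub[of d c] by (intro M) linarith
    qed
    then show ?thesis by simp
  qed
  have "norm ((deriv ^^ 0) h e - (\<Sum>i\<le>1. (deriv ^^ i) h 0 * (e - 0) ^ i / fact i))
      \<le> 2 * M * norm (e - 0) ^ Suc 1 / fact 1"
  proof (rule complex_Taylor[where S = "cball 0 1"])
    fix i x assume "x \<in> cball (0::complex) 1" "i \<le> (1::nat)"
    have "(deriv ^^ i) h holomorphic_on UNIV" by (rule holomorphic_higher_deriv[OF h]) auto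
    then have "((deriv ^^ i) h has_field_derivative deriv ((deriv ^^ i) h) x) (at x)"
      using holomorphic_derivI[of "(deriv ^^ i) h" UNIV x UNIV] by simp
    then show "((deriv ^^ i) h has_field_derivative (deriv ^^ Suc i) h x) (at x within cball 0 1)"
      by (simp add: has_field_derivative_at_within)
  next
    fix x assume "x \<in> cball (0::complex) 1"
    then show "norm ((deriv ^^ Suc 1) h x) \<le> 2 * M" using B[of x] by (simp add: numeral_2_eq_2)
  qed (use e in auto)
  then have "norm (h e - h 0 - deriv h 0 * e) \<le> 2 * M * norm e * norm e"
    by (simp add: algebra_simps power2_eq_square)
  moreover have "(h e - h 0) / e - deriv h 0 = (h e - h 0 - deriv h 0 * e) / e"
    using e by (simp add: field_simps)
  ultimately show ?thesis using e by (simp add: norm_divide field_simps)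
qed

text \<open>
  Along a line in direction \<open>w\<close>, the difference quotients of \<open>g\<close> in direction \<open>v\<close> converge
  locally uniformly to the derivative in direction \<open>v\<close>. By Weierstrass the limit is holomorphic
  along the line, which gives the first claim, and the derivatives in direction \<open>w\<close> of the
  quotients converge to the derivative of the limit. As the former are difference quotients in
  direction \<open>v\<close> of the derivative in direction \<open>w\<close>, this gives the second claim.
\<close>
lemma
  assumes g: "gateaux_entire g"
  shows gateaux_entire_dir_deriv: "gateaux_entire (dir_deriv v g)"
    and dir_deriv_commute: "dir_deriv v (dir_deriv w g) = dir_deriv w (dir_deriv v g)"
proof -
  define q where "q v z w n b = (g (z + cscale b w + cscale (1 / of_nat (Suc n)) v) - g (z + cscale b w)) * of_nat (Suc n)"
    for v z w n b
  have q_alt: "q v z w n b = (g ((z + cscale (1 / of_nat (Suc n)) v) + cscale b w) - g (z + cscale b w)) * of_nat (Suc n)"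
    for v z w n b by (simp add: q_def add_ac)
  have q_hol: "q v z w n holomorphic_on A" for v z w n A
    unfolding q_alt by (intro holomorphic_intros gateaux_entireD[OF g])
  have q_lim: "uniform_limit (ball 0 R) (q v z w) (\<lambda>b. dir_deriv v g (z + cscale b w)) sequentially"
    if R: "R > 0" for R v z w
  proof -
    obtain M where M: "\<And>y. norm y \<le> norm z + R * norm w + 2 * norm v \<Longrightarrow> norm (g y) \<le> M"
      using gateaux_entire_bounded[OF g] by blast
    have bound: "dist (q v z w n b) (dir_deriv v g (z + cscale b w)) \<le> 2 * M * (1 / real (Suc n))"
      if b: "b \<in> ball 0 R" for n b
    proof -
      let ?h = "\<lambda>c. g (z + cscale b w + cscale c v)"
      have "norm ((?h (1 / of_nat (Suc n)) - ?h 0) / (1 / of_nat (Suc n)) - deriv ?h 0) \<le> 2 * M * norm (1 / of_nat (Suc n) :: complex)"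
      proof (rule difference_quotient_entire)
        fix c :: complex assume c: "norm c \<le> 2"
        have "norm (cscale b w) \<le> R * norm w"
          using b by (intro order_trans[OF norm_cscale_le] mult_right_mono) auto
        moreover have "norm (cscale c v) \<le> 2 * norm v"
          using c by (intro order_trans[OF norm_cscale_le] mult_right_mono) auto
        ultimately show "norm (?h c) \<le> M"
          by (intro M) (meson norm_triangle_le add_mono order_refl)
      next
        show "norm (1 / of_nat (Suc n) :: complex) \<le> 1" by (simp add: norm_divide del: of_nat_Suc)
      qed (auto intro: gateaux_entireD[OF g] simp del: of_nat_Suc)
      then show ?thesis
        by (simp add: q_def dir_deriv_def dist_norm norm_divide del: of_nat_Suc)
    qed
    have "(\<lambda>n. 2 * M * (1 / real (Suc n))) \<longlonglongrightarrow> 2 * M * 0"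
      by (intro tendsto_intros) (use LIMSEQ_inverse_real_of_nat in \<open>simp add: inverse_eq_divide\<close>)
    then have "\<forall>\<^sub>F n in sequentially. 2 * M * (1 / real (Suc n)) < e" if "e > 0" for e
      using that order_tendstoD(2) by fastforce
    then show ?thesis
      unfolding uniform_limit_iff using bound by (fast elim: eventually_mono le_less_trans)
  qed
  have hol: "(\<lambda>b. dir_deriv v g (z + cscale b w)) holomorphic_on UNIV" for v z w
  proof -
    have "(\<lambda>b. dir_deriv v g (z + cscale b w)) holomorphic_on ball 0 R" if R: "R > 0" for R
    proof (rule holomorphic_uniform_sequence[OF open_ball, where f = "q v z w"])
      fix b assume "b \<in> ball (0::complex) R"
      then obtain d where "d > 0" "cball b d \<subseteq> ball 0 R" by (meson open_ball open_contains_cball)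
      then show "\<exists>d>0. cball b d \<subseteq> ball 0 R \<and>
          uniform_limit (cball b d) (q v z w) (\<lambda>b. dir_deriv v g (z + cscale b w)) sequentially"
        using uniform_limit_on_subset[OF q_lim[OF R]] by blast
    qed (rule q_hol)
    then have "(\<lambda>b. dir_deriv v g (z + cscale b w)) field_differentiable at b" for b
      by (rule holomorphic_on_imp_differentiable_at[where s = "ball 0 (norm b + 1)"]) (auto simp: add_nonneg_pos)
    then show ?thesis
      by (simp add: holomorphic_on_def)
  qed
  have lim: "(\<lambda>n. deriv (q v z w n) 0) \<longlonglongrightarrow> dir_deriv w (dir_deriv v g) z" for v z w
    using higher_deriv_complex_uniform_limit[OF q_lim[OF zero_less_one] _ _ open_ball, where m = 1 and z = 0] q_hol
    by (simp add: dir_deriv_def)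
  have bdd: "\<exists>M. \<forall>z. norm z \<le> r \<longrightarrow> norm (dir_deriv v g z) \<le> M" for r v
  proof -
    obtain M where "\<And>y. norm y \<le> r + norm v \<Longrightarrow> norm (g y) \<le> M"
      using gateaux_entire_bounded[OF g] by blast
    then have "\<forall>z. norm z \<le> r \<longrightarrow> norm (dir_deriv v g z) \<le> M"
      by (intro allI impI norm_dir_deriv_le[OF g]) auto
    then show ?thesis ..
  qed
  show ge: "gateaux_entire (dir_deriv v g)" for v
    unfolding gateaux_entire_def using hol bdd by blast
  show "dir_deriv v (dir_deriv w g) = dir_deriv w (dir_deriv v g)"
  proof
    fix z
    have fd: "(\<lambda>b. g (y + cscale b w)) field_differentiable at 0" for y
      using gateaux_entireD[OF g, of y w UNIV] holomorphic_on_imp_differentiable_at[OF _ open_UNIV] by blast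
    have "deriv (q v z w n) 0 = (dir_deriv w g (z + cscale (1 / of_nat (Suc n)) v) - dir_deriv w g z) * of_nat (Suc n)" for n
      unfolding q_alt using fd by (simp add: dir_deriv_def field_differentiable_diff)
    moreover have "(\<lambda>n. (dir_deriv w g (z + cscale (1 / of_nat (Suc n)) v) - dir_deriv w g z) * of_nat (Suc n))
        \<longlonglongrightarrow> dir_deriv v (dir_deriv w g) z"
    proof -
      let ?h = "\<lambda>c. dir_deriv w g (z + cscale c v)"
      have "(?h has_field_derivative deriv ?h 0) (at 0)"
        using hol[of w z v] by (intro holomorphic_derivI) auto
      then have "((\<lambda>c. (?h c - ?h 0) / c) \<longlongrightarrow> deriv ?h 0) (at 0)"
        by (simp add: has_field_derivative_iff)
      moreover have "filterlim (\<lambda>n. 1 / of_nat (Suc n) :: complex) (at 0) sequentially"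
      proof -
        have "(\<lambda>n. 1 / of_nat (Suc n) :: complex) \<longlonglongrightarrow> 0"
          using tendsto_of_real[OF LIMSEQ_inverse_real_of_nat, where 'a = complex]
          by (simp add: inverse_eq_divide del: of_nat_Suc)
        then show ?thesis by (simp add: filterlim_at del: of_nat_Suc)
      qed
      ultimately have "(\<lambda>n. (?h (1 / of_nat (Suc n)) - ?h 0) / (1 / of_nat (Suc n))) \<longlonglongrightarrow> deriv ?h 0"
        by (rule filterlim_compose)
      then show ?thesis by (simp add: dir_deriv_def del: of_nat_Suc)
    qed
    ultimately have "(\<lambda>n. deriv (q v z w n) 0) \<longlonglongrightarrow> dir_deriv v (dir_deriv w g) z" by simp
    then show "dir_deriv v (dir_deriv w g) z = dir_deriv w (dir_deriv v g) z"
      using lim LIMSEQ_unique by blast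
  qed
qed

section \<open>Orthogonal additivity and the moment functionals\<close>

text \<open>
  Linearity in the direction is the trace of Frechet differentiability that is kept: by the
  symmetry of mixed derivatives it is inherited by directional derivatives.
\<close>
definition entire_bounded_type :: "(('k::topological_space \<Rightarrow>\<^sub>C complex) \<Rightarrow> complex) \<Rightarrow> bool"
  where "entire_bounded_type g \<longleftrightarrow> gateaux_entire g \<and>
    (\<forall>v w. dir_deriv (v + w) g = (\<lambda>z. dir_deriv v g z + dir_deriv w g z)) \<and>
    (\<forall>c v. dir_deriv (cscale c v) g = (\<lambda>z. c * dir_deriv v g z))"

lemma entire_bounded_type_imp_gateaux: "entire_bounded_type g \<Longrightarrow> gateaux_entire g"
  by (simp add: entire_bounded_type_def)

lemma bounded_linear_cscale_left: "bounded_linear (\<lambda>c. cscale c v)"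
proof (rule bounded_linear_intro)
  show "cscale (r *\<^sub>R c) v = r *\<^sub>R cscale c v" for r c
    by (rule bcontfun_eqI) (simp add: scaleR_conv_of_real)
  show "norm (cscale c v) \<le> norm c * norm v" for c by (rule norm_cscale_le)
qed (rule cscale_add_left)

lemma Hb_imp_entire_bounded_type:
  assumes "f \<in> Hb"
  shows "entire_bounded_type f"
proof -
  have hol: "holomorphic_CK f" and bdd: "\<And>S. bounded S \<Longrightarrow> bounded (f ` S)"
    using assms by (auto simp: Hb_def)
  have "\<exists>D. linear D \<and> (\<forall>c v. D (cscale c v) = c * D v) \<and>
      (\<forall>v. (\<forall>a y. y + cscale a v = z \<longrightarrow> ((\<lambda>c. f (y + cscale c v)) has_field_derivative D v) (at a)))" for z
  proof -
    obtain D where D: "(f has_derivative D) (at z)" and Dc: "\<And>c v. D (cscale c v) = c * D v"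
      using hol unfolding holomorphic_CK_def by blast
    have "((\<lambda>c. f (y + cscale c v)) has_field_derivative D v) (at a)" if z: "y + cscale a v = z" for v a y
    proof -
      have "((\<lambda>c. y + cscale c v) has_derivative (\<lambda>c. 0 + cscale c v)) (at a)"
        by (intro derivative_intros bounded_linear_imp_has_derivative bounded_linear_cscale_left)
      then have "((\<lambda>c. f (y + cscale c v)) has_derivative (\<lambda>c. D (0 + cscale c v))) (at a)"
        using D z by (intro has_derivative_compose[of _ _ a UNIV f D]) auto
      then show ?thesis by (simp add: has_field_derivative_def Dc mult_commute_abs)
    qed
    then show ?thesis using has_derivative_linear[OF D] Dc by blast
  qed
  then obtain D where D: "\<And>z. linear (D z)" "\<And>z c v. D z (cscale c v) = c * D z v"
    "\<And>y v a. ((\<lambda>c. f (y + cscale c v)) has_field_derivative D (y + cscale a v) v) (at a)"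
    by metis
  have dd: "dir_deriv v f z = D z v" for v z
    using D(3)[of z v 0] by (auto simp: dir_deriv_def intro: DERIV_imp_deriv)
  have "gateaux_entire f"
    unfolding gateaux_entire_def
  proof (intro conjI allI)
    show "(\<lambda>c. f (z + cscale c v)) holomorphic_on UNIV" for z v
      using D(3) by (auto simp: holomorphic_on_def field_differentiable_def)
    fix r :: real
    have "bounded (f ` cball 0 r)" by (rule bdd) simp
    then obtain M where "\<forall>z\<in>cball 0 r. norm (f z) \<le> M" by (auto simp: bounded_iff)
    then show "\<exists>M. \<forall>z. norm z \<le> r \<longrightarrow> norm (f z) \<le> M"
      by (intro exI[of _ M]) simp
  qed
  then show ?thesis
    unfolding entire_bounded_type_def using D(1,2) by (simp add: dd linear_add fun_eq_iff)
qed

lemma line_differentiable: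
  assumes "gateaux_entire g"
  shows "(\<lambda>c. g (z + cscale c v)) field_differentiable at a"
  using gateaux_entireD[OF assms, of z v UNIV] by (rule holomorphic_on_imp_differentiable_at) auto

text \<open>
  The new derivative is moved inside by symmetry, where it is linear in its direction.
\<close>
lemma entire_bounded_type_dir_deriv:
  assumes g: "entire_bounded_type g"
  shows "entire_bounded_type (dir_deriv u g)"
proof -
  have ge: "gateaux_entire g"
    and a: "\<And>v w. dir_deriv (v + w) g = (\<lambda>z. dir_deriv v g z + dir_deriv w g z)"
    and m: "\<And>c v. dir_deriv (cscale c v) g = (\<lambda>z. c * dir_deriv v g z)"
    using g by (auto simp: entire_bounded_type_def)
  note ld = line_differentiable[OF gateaux_entire_dir_deriv[OF ge]]
  have "dir_deriv (v + w) (dir_deriv u g) z = dir_deriv v (dir_deriv u g) z + dir_deriv w (dir_deriv u g) z" for v w z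
    unfolding dir_deriv_commute[OF ge, of _ u] a unfolding dir_deriv_def[of u]
    by (rule deriv_add) (rule ld)+
  moreover have "dir_deriv (cscale c v) (dir_deriv u g) z = c * dir_deriv v (dir_deriv u g) z" for c v z
    unfolding dir_deriv_commute[OF ge, of _ u] m unfolding dir_deriv_def[of u]
    by (rule deriv_cmult) (rule ld)
  ultimately show ?thesis
    using gateaux_entire_dir_deriv[OF ge] by (auto simp: entire_bounded_type_def)
qed

lemma entire_bounded_type_fold: "entire_bounded_type g \<Longrightarrow> entire_bounded_type (fold dir_deriv xs g)"
  by (induction xs arbitrary: g) (auto intro: entire_bounded_type_dir_deriv)

text \<open>
  The values of the iterated derivative at \<open>0\<close> form a symmetric multilinear form; taking lists
  as arguments covers all degrees at once.
\<close>
definition deriv_form :: "(('k::topological_space \<Rightarrow>\<^sub>C complex) \<Rightarrow> complex) \<Rightarrow> ('k \<Rightarrow>\<^sub>C complex) list \<Rightarrow> complex"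
  where "deriv_form f xs = fold dir_deriv xs f 0"

lemma deriv_form_cong_mset:
  assumes "entire_bounded_type f" "mset xs = mset ys"
  shows "deriv_form f xs = deriv_form f ys"
proof -
  have "fold dir_deriv xs f = fold dir_deriv ys f"
    by (rule fold_permuted_eq[where P = entire_bounded_type])
      (use assms in \<open>auto intro: entire_bounded_type_dir_deriv dir_deriv_commute entire_bounded_type_imp_gateaux\<close>)
  then show ?thesis by (simp add: deriv_form_def)
qed

lemma
  assumes "entire_bounded_type f"
  shows deriv_form_add: "deriv_form f ((v + w) # xs) = deriv_form f (v # xs) + deriv_form f (w # xs)"
    and deriv_form_cscale: "deriv_form f (cscale c v # xs) = c * deriv_form f (v # xs)"
proof -
  have *: "deriv_form f (u # xs) = dir_deriv u (fold dir_deriv xs f) 0" for u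
    using deriv_form_cong_mset[OF assms, of "u # xs" "xs @ [u]"] by (simp add: deriv_form_def)
  show "deriv_form f ((v + w) # xs) = deriv_form f (v # xs) + deriv_form f (w # xs)"
    "deriv_form f (cscale c v # xs) = c * deriv_form f (v # xs)"
    using entire_bounded_type_fold[OF assms, of xs] by (simp_all add: * entire_bounded_type_def)
qed

abbreviation vanishes_off :: "('k::topological_space \<Rightarrow>\<^sub>C complex) \<Rightarrow> 'k set \<Rightarrow> bool"
  where "vanishes_off x F \<equiv> \<forall>t. t \<notin> F \<longrightarrow> apply_bcontfun x t = 0"

text \<open>
  On sums of a function living on \<open>F\<close> and one living on \<open>G\<close>, \<open>f\<close> splits into a part for
  \<open>F\<close> and a part for \<open>G\<close>. One derivative in a \<open>G\<close>-direction removes the dependence on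
  the \<open>F\<close>-component, and then one derivative in an \<open>F\<close>-direction gives zero. Both
  properties survive all further derivatives in these directions.
\<close>
lemma deriv_form_two_groups:
  assumes f: "entire_bounded_type f" and oa: "orthogonally_additive f" and FG: "F \<inter> G = {}"
    and xs: "xs \<noteq> []" "\<forall>x\<in>set xs. vanishes_off x F" and ys: "ys \<noteq> []" "\<forall>y\<in>set ys. vanishes_off y G"
  shows "deriv_form f (xs @ ys) = 0"
proof -
  have "\<forall>X Y. vanishes_off X F \<longrightarrow> vanishes_off Y G \<longrightarrow>
      fold dir_deriv ys f (X + Y) = fold dir_deriv ys f Y"
    using ys
  proof (induction ys rule: rev_nonempty_induct)
    case (single y)
    show ?case
    proof (intro allI impI)
      fix X Y assume XY: "vanishes_off X F" "vanishes_off Y G"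
      have "f (X + Y + cscale c y) = f X + f (Y + cscale c y)" for c
      proof -
        have "t \<notin> F \<or> t \<notin> G" for t using FG by blast
        then have "apply_bcontfun X t * apply_bcontfun (Y + cscale c y) t = 0" for t
          using XY single by (metis add.right_neutral apply_cscale list.set_intros(1) mult_zero_left mult_zero_right plus_bcontfun.rep_eq)
        then have "f (X + (Y + cscale c y)) = f X + f (Y + cscale c y)"
          using oa unfolding orthogonally_additive_def by blast
        then show ?thesis by (simp add: add.assoc)
      qed
      then have "dir_deriv y f (X + Y) = deriv (\<lambda>c. f X + f (Y + cscale c y)) 0"
        by (simp add: dir_deriv_def)
      also have "\<dots> = dir_deriv y f Y"
        using line_differentiable[of f Y y 0] f by (simp add: entire_bounded_type_def dir_deriv_def)
      finally show "fold dir_deriv [y] f (X + Y) = fold dir_deriv [y] f Y" by simp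
    qed
  next
    case (snoc y ys)
    show ?case
    proof (intro allI impI)
      fix X Y assume XY: "vanishes_off X F" "vanishes_off Y G"
      have "fold dir_deriv ys f (X + Y + cscale c y) = fold dir_deriv ys f (Y + cscale c y)" for c
      proof -
        have "vanishes_off (Y + cscale c y) G" using XY snoc.prems by auto
        then show ?thesis using snoc XY by (simp add: add.assoc)
      qed
      then show "fold dir_deriv (ys @ [y]) f (X + Y) = fold dir_deriv (ys @ [y]) f Y"
        by (simp add: dir_deriv_def)
    qed
  qed
  then have 1: "fold dir_deriv ys f (X + Y) = fold dir_deriv ys f Y"
    if "vanishes_off X F" "vanishes_off Y G" for X Y using that by blast
  have "\<forall>X Y. vanishes_off X F \<longrightarrow> vanishes_off Y G \<longrightarrow>
      fold dir_deriv xs (fold dir_deriv ys f) (X + Y) = 0"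
    using xs
  proof (induction xs rule: rev_nonempty_induct)
    case (single x)
    show ?case
    proof (intro allI impI)
      fix X Y assume XY: "vanishes_off X F" "vanishes_off Y G"
      have "fold dir_deriv ys f (X + Y + cscale c x) = fold dir_deriv ys f Y" for c
        using 1[of "X + cscale c x" Y] XY single by (simp add: add_ac)
      then show "fold dir_deriv [x] (fold dir_deriv ys f) (X + Y) = 0"
        by (simp add: dir_deriv_def)
    qed
  next
    case (snoc x xs)
    show ?case
    proof (intro allI impI)
      fix X Y assume XY: "vanishes_off X F" "vanishes_off Y G"
      have "fold dir_deriv xs (fold dir_deriv ys f) (X + Y + cscale c x) = 0" for c
      proof -
        have "vanishes_off (X + cscale c x) F" using XY snoc.prems by auto
        moreover have "X + Y + cscale c x = (X + cscale c x) + Y" by (simp add: add_ac)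
        ultimately show ?thesis using snoc XY by (metis UnCI set_append)
      qed
      then show "fold dir_deriv (xs @ [x]) (fold dir_deriv ys f) (X + Y) = 0"
        by (simp add: dir_deriv_def)
    qed
  qed
  then have "fold dir_deriv xs (fold dir_deriv ys f) (0 + 0) = 0" by (metis zero_bcontfun.rep_eq)
  then have "deriv_form f (ys @ xs) = 0" by (simp add: deriv_form_def)
  then show ?thesis using deriv_form_cong_mset[OF f, of "xs @ ys" "ys @ xs"] by simp
qed

lemma apply_Bcontfun:
  fixes a :: "'k::topological_space \<Rightarrow> complex"
  assumes "compact (UNIV :: 'k set)" "cont a"
  shows "apply_bcontfun (Bcontfun a) = a"
  using assms compact_imp_bounded compact_continuous_image
  by (intro Bcontfun_inverse) (auto simp: bcontfun_def)

text \<open>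
  An argument \<open>z\<close> without any support condition is split as \<open>\<phi> z + (1 - \<phi>) z\<close> where
  \<open>\<phi>\<close> is one near \<open>F\<close> and zero near \<open>G\<close>. The first summand can be added to the group
  living on \<open>F\<close> and the second one to the group living on \<open>G\<close>, at the price of enlarging one
  of the two closed sets while keeping them disjoint.
\<close>
lemma deriv_form_separated:
  fixes f :: "('k::t2_space \<Rightarrow>\<^sub>C complex) \<Rightarrow> complex"
  assumes K: "compact (UNIV :: 'k set)" and f: "entire_bounded_type f" and oa: "orthogonally_additive f"
    and "closed F" "closed G" "F \<inter> G = {}"
    and "xs \<noteq> []" "\<forall>x\<in>set xs. vanishes_off x F" "ys \<noteq> []" "\<forall>y\<in>set ys. vanishes_off y G"
  shows "deriv_form f (zs @ xs @ ys) = 0"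
  using assms(4-)
proof (induction zs arbitrary: F G xs ys)
  case Nil
  then show ?case using deriv_form_two_groups[OF f oa] by simp
next
  case (Cons z zs)
  obtain u :: "'k \<Rightarrow> real" where u: "cont u" "\<And>t. 0 \<le> u t" "\<And>t. u t \<le> 1"
    "\<And>t. t \<in> F \<Longrightarrow> u t = 0" "\<And>t. t \<in> G \<Longrightarrow> u t = 1"
    using Urysohn_compact_Hausdorff[OF K Cons.prems(1,2,3)] by blast
  (* 1 where u \<le> 1/3 and 0 where u \<ge> 2/3 *)
  define \<phi> where "\<phi> t = complex_of_real (min 1 (max 0 (2 - 3 * u t)))" for t
  define a where "a = Bcontfun (\<lambda>t. \<phi> t * apply_bcontfun z t)"
  define b where "b = Bcontfun (\<lambda>t. (1 - \<phi> t) * apply_bcontfun z t)"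
  have \<phi>: "cont \<phi>" unfolding \<phi>_def by (intro continuous_intros u)
  have "cont (\<lambda>t. \<phi> t * apply_bcontfun z t)" "cont (\<lambda>t. (1 - \<phi> t) * apply_bcontfun z t)"
    by (intro continuous_intros \<phi> continuous_on_apply_bcontfun)+
  then have ap: "apply_bcontfun a t = \<phi> t * apply_bcontfun z t"
      "apply_bcontfun b t = (1 - \<phi> t) * apply_bcontfun z t" for t
    by (simp_all add: a_def b_def apply_Bcontfun[OF K])
  have z: "z = a + b" by (rule bcontfun_eqI) (simp add: ap algebra_simps)
  have "deriv_form f (zs @ (a # xs) @ ys) = 0"
  proof (rule Cons.IH[where F = "{t. u t \<le> 2/3}" and G = G])
    show "closed {t. u t \<le> 2/3}" by (intro closed_Collect_le continuous_intros u)
    show "{t. u t \<le> 2/3} \<inter> G = {}" using u(5) by force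
    show "\<forall>x\<in>set (a # xs). vanishes_off x {t. u t \<le> 2/3}"
    proof (intro ballI allI impI)
      fix x t assume x: "x \<in> set (a # xs)" and t: "t \<notin> {t. u t \<le> 2/3}"
      then have "t \<notin> F" "\<phi> t = 0" using u(4)[of t] by (auto simp: \<phi>_def)
      then show "apply_bcontfun x t = 0" using x Cons.prems(5) ap by auto
    qed
  qed (use Cons.prems in auto)
  moreover have "deriv_form f (zs @ xs @ (b # ys)) = 0"
  proof (rule Cons.IH[where F = F and G = "{t. u t \<ge> 1/3}"])
    show "closed {t. u t \<ge> 1/3}" by (intro closed_Collect_le continuous_intros u)
    show "F \<inter> {t. u t \<ge> 1/3} = {}" using u(4) by force
    show "\<forall>x\<in>set (b # ys). vanishes_off x {t. u t \<ge> 1/3}"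
    proof (intro ballI allI impI)
      fix x t assume x: "x \<in> set (b # ys)" and t: "t \<notin> {t. u t \<ge> 1/3}"
      then have "t \<notin> G" "\<phi> t = 1" using u(5)[of t] by (auto simp: \<phi>_def min_def)
      then show "apply_bcontfun x t = 0" using x Cons.prems(7) ap by auto
    qed
  qed (use Cons.prems in auto)
  moreover have "deriv_form f ((z # zs) @ xs @ ys) = deriv_form f (a # zs @ xs @ ys) + deriv_form f (b # zs @ xs @ ys)"
    unfolding z by (simp add: deriv_form_add[OF f])
  moreover have "deriv_form f (a # zs @ xs @ ys) = deriv_form f (zs @ (a # xs) @ ys)"
    "deriv_form f (b # zs @ xs @ ys) = deriv_form f (zs @ xs @ (b # ys))"
    by (rule deriv_form_cong_mset[OF f]; simp)+
  ultimately show ?case by simp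
qed

lemma
  fixes a b :: "'k::topological_space \<Rightarrow> complex"
  assumes K: "compact (UNIV :: 'k set)" and a: "cont a"
  shows Bcontfun_add: "cont b \<Longrightarrow> Bcontfun (\<lambda>t. a t + b t) = Bcontfun a + Bcontfun b"
    and Bcontfun_cscale: "Bcontfun (\<lambda>t. c * a t) = cscale c (Bcontfun a)"
    and norm_Bcontfun_le: "(\<And>t. norm (a t) \<le> r) \<Longrightarrow> norm (Bcontfun a) \<le> r"
proof -
  have "cont (\<lambda>t. a t + b t)" if "cont b" by (intro continuous_intros a that)
  then show "Bcontfun (\<lambda>t. a t + b t) = Bcontfun a + Bcontfun b" if "cont b"
    using that by (intro bcontfun_eqI) (simp add: apply_Bcontfun[OF K] a)
  have "cont (\<lambda>t. c * a t)" by (intro continuous_intros a)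
  then show "Bcontfun (\<lambda>t. c * a t) = cscale c (Bcontfun a)"
    by (intro bcontfun_eqI) (simp add: apply_Bcontfun[OF K] a)
  show "norm (Bcontfun a) \<le> r" if "\<And>t. norm (a t) \<le> r"
    using that by (intro norm_bcontfun_le) (simp add: apply_Bcontfun[OF K a])
qed

text \<open>
  With the other arguments fixed this is a bilinear form. It is bounded by two Cauchy estimates and
  vanishes on separated pairs, so \<open>zero_product_bilinear_form\<close> applies.
\<close>
lemma deriv_form_product:
  fixes f :: "('k::t2_space \<Rightarrow>\<^sub>C complex) \<Rightarrow> complex"
  assumes K: "compact (UNIV :: 'k set)" and f: "entire_bounded_type f" and oa: "orthogonally_additive f"
    and x: "cont x" and y: "cont y"
  shows "deriv_form f (Bcontfun x # Bcontfun y # zs)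
    = deriv_form f (Bcontfun (\<lambda>_. 1) # Bcontfun (\<lambda>t. x t * y t) # zs)"
proof -
  define g where "g = fold dir_deriv zs f"
  have g: "gateaux_entire g" using entire_bounded_type_fold[OF f, of zs] by (simp add: g_def entire_bounded_type_def)
  obtain C where C: "\<And>z. norm z \<le> 2 \<Longrightarrow> norm (g z) \<le> C" using gateaux_entire_bounded[OF g] by blast
  have swap: "deriv_form f (v # w # zs) = deriv_form f (w # v # zs)" for v w
    by (rule deriv_form_cong_mset[OF f]) simp
  note Bc = Bcontfun_add[OF K] Bcontfun_cscale[OF K]
  note lin = deriv_form_add[OF f] deriv_form_cscale[OF f]
  show ?thesis
  proof (rule zero_product_bilinear_form[OF K, where C = C and B = "\<lambda>a b. deriv_form f (Bcontfun a # Bcontfun b # zs)"])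
    fix a b a' :: "'k \<Rightarrow> complex" and c
    assume c: "cont a" "cont a'" "cont b"
    show "deriv_form f (Bcontfun (\<lambda>t. a t + a' t) # Bcontfun b # zs)
        = deriv_form f (Bcontfun a # Bcontfun b # zs) + deriv_form f (Bcontfun a' # Bcontfun b # zs)"
      by (simp add: Bc c lin)
    show "deriv_form f (Bcontfun b # Bcontfun (\<lambda>t. a t + a' t) # zs)
        = deriv_form f (Bcontfun b # Bcontfun a # zs) + deriv_form f (Bcontfun b # Bcontfun a' # zs)"
      by (simp add: Bc c lin swap[of "Bcontfun b"])
    show "deriv_form f (Bcontfun (\<lambda>t. e * a t) # Bcontfun b # zs) = e * deriv_form f (Bcontfun a # Bcontfun b # zs)" for e
      by (simp add: Bc c lin)
    show "deriv_form f (Bcontfun b # Bcontfun (\<lambda>t. e * a t) # zs) = e * deriv_form f (Bcontfun b # Bcontfun a # zs)" for e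
      by (simp add: Bc c lin swap[of "Bcontfun b"])
  next
    fix a b :: "'k \<Rightarrow> complex"
    assume c: "cont a" "cont b" and n: "\<And>t. norm (a t) \<le> 1" "\<And>t. norm (b t) \<le> 1"
    have "deriv_form f (Bcontfun a # Bcontfun b # zs) = deriv_form f (zs @ [Bcontfun b, Bcontfun a])"
      by (rule deriv_form_cong_mset[OF f]) simp
    also have "\<dots> = dir_deriv (Bcontfun a) (dir_deriv (Bcontfun b) g) 0"
      by (simp add: deriv_form_def g_def)
    also have "norm \<dots> \<le> C"
    proof (intro norm_dir_deriv_le[OF gateaux_entire_dir_deriv[OF g]] norm_dir_deriv_le[OF g] C)
      fix y z :: "'k \<Rightarrow>\<^sub>C complex"
      assume "norm y \<le> norm (0 :: 'k \<Rightarrow>\<^sub>C complex) + norm (Bcontfun a)" "norm z \<le> norm y + norm (Bcontfun b)"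
      then show "norm z \<le> 2"
        using norm_Bcontfun_le[OF K c(1) n(1)] norm_Bcontfun_le[OF K c(2) n(2)] by simp
    qed
    finally show "norm (deriv_form f (Bcontfun a # Bcontfun b # zs)) \<le> C" .
  next
    fix a b :: "'k \<Rightarrow> complex" and F G
    assume c: "cont a" "cont b" and FG: "closed F" "closed G" "F \<inter> G = {}"
      and v: "\<And>t. t \<notin> F \<Longrightarrow> a t = 0" "\<And>t. t \<notin> G \<Longrightarrow> b t = 0"
    have "deriv_form f (Bcontfun a # Bcontfun b # zs) = deriv_form f (zs @ [Bcontfun a] @ [Bcontfun b])"
      by (rule deriv_form_cong_mset[OF f]) simp
    also have "\<dots> = 0"
      by (rule deriv_form_separated[OF K f oa FG]) (use v c in \<open>auto simp: apply_Bcontfun[OF K]\<close>)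
    finally show "deriv_form f (Bcontfun a # Bcontfun b # zs) = 0" .
  qed (rule x y)+
qed

text \<open>
  The factors \<open>x\<close> are multiplied into the first argument one by one, each leaving a \<open>1\<close>
  in its place.
\<close>
lemma deriv_form_power:
  fixes f :: "('k::t2_space \<Rightarrow>\<^sub>C complex) \<Rightarrow> complex"
  assumes K: "compact (UNIV :: 'k set)" and f: "entire_bounded_type f" and oa: "orthogonally_additive f"
    and x: "cont x"
  shows "deriv_form f (replicate (Suc m) (Bcontfun x))
    = deriv_form f (Bcontfun (\<lambda>t. x t ^ Suc m) # replicate m (Bcontfun (\<lambda>_. 1)))"
proof -
  have "deriv_form f (replicate (Suc m) (Bcontfun x))
      = deriv_form f (Bcontfun (\<lambda>t. x t ^ Suc j) # replicate j (Bcontfun (\<lambda>_. 1)) @ replicate (m - j) (Bcontfun x))"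
    if "j \<le> m" for j
    using that
  proof (induction j)
    case 0
    show ?case by simp
  next
    case (Suc j)
    then obtain i where i: "m - j = Suc i" "m - Suc j = i" by (metis Suc_diff_Suc Suc_le_lessD)
    let ?zs = "replicate j (Bcontfun (\<lambda>_. 1)) @ replicate i (Bcontfun x)"
    have "deriv_form f (replicate (Suc m) (Bcontfun x)) = deriv_form f (Bcontfun x # Bcontfun (\<lambda>t. x t ^ Suc j) # ?zs)"
      using Suc i by (simp, intro deriv_form_cong_mset[OF f]) simp
    also have "\<dots> = deriv_form f (Bcontfun (\<lambda>_. 1) # Bcontfun (\<lambda>t. x t * x t ^ Suc j) # ?zs)"
      by (intro deriv_form_product[OF K f oa] continuous_intros x)
    also have "\<dots> = deriv_form f (Bcontfun (\<lambda>t. x t ^ Suc (Suc j)) # replicate (Suc j) (Bcontfun (\<lambda>_. 1)) @ replicate (m - Suc j) (Bcontfun x))"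
      using i by (intro deriv_form_cong_mset[OF f]) simp
    finally show ?case .
  qed
  from this[of m] show ?thesis by simp
qed

lemma higher_deriv_along_line:
  "(deriv ^^ n) (\<lambda>c. f (cscale c x)) a = fold dir_deriv (replicate n x) f (cscale a x)"
proof (induction n arbitrary: a)
  case (Suc n)
  have "(deriv ^^ Suc n) (\<lambda>c. f (cscale c x)) a = deriv (\<lambda>c. fold dir_deriv (replicate n x) f (0 + cscale c x)) a"
  proof -
    have "(deriv ^^ n) (\<lambda>c. f (cscale c x)) = (\<lambda>c. fold dir_deriv (replicate n x) f (0 + cscale c x))"
      by (rule ext) (simp only: Suc add_0)
    then show ?thesis by (simp only: funpow.simps o_apply)
  qed
  also have "\<dots> = dir_deriv x (fold dir_deriv (replicate n x) f) (cscale a x)"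
    unfolding deriv_along_line by simp
  also have "dir_deriv x (fold dir_deriv (replicate n x) f) = fold dir_deriv (replicate n x @ [x]) f" by simp
  also have "replicate n x @ [x] = replicate (Suc n) x" by (simp add: replicate_append_same)
  finally show ?case .
qed simp

text \<open>
  The index is shifted by one: \<open>moment f k\<close> belongs to the homogeneous part of degree \<open>k + 1\<close>
  of \<open>f\<close>. The part of degree zero vanishes when \<open>f\<close> is orthogonally additive.
\<close>
definition moment :: "(('k::topological_space \<Rightarrow>\<^sub>C complex) \<Rightarrow> complex) \<Rightarrow> nat \<Rightarrow> ('k \<Rightarrow> complex) \<Rightarrow> complex"
  where "moment f k a = deriv_form f (Bcontfun a # replicate k (Bcontfun (\<lambda>_. 1))) / fact (Suc k)"

lemma
  fixes f :: "('k::t2_space \<Rightarrow>\<^sub>C complex) \<Rightarrow> complex"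
  assumes K: "compact (UNIV :: 'k set)" and f: "entire_bounded_type f" and a: "cont a"
  shows moment_add: "cont b \<Longrightarrow> moment f k (\<lambda>t. a t + b t) = moment f k a + moment f k b"
    and moment_cmult: "moment f k (\<lambda>t. c * a t) = c * moment f k a"
  using a by (simp_all add: moment_def Bcontfun_add[OF K] Bcontfun_cscale[OF K] deriv_form_add[OF f]
      deriv_form_cscale[OF f] add_divide_distrib)

text \<open>
  A function with values in \<open>[0, 1]\<close> is the power \<open>x\<^sup>k\<^sup>+\<^sup>1\<close> of its root, so its moment is a
  Taylor coefficient of \<open>f\<close> along the line through \<open>x\<close>, and the Cauchy inequality on the
  circle of radius \<open>R\<close> applies.
\<close>
lemma moment_bound:
  fixes f :: "('k::t2_space \<Rightarrow>\<^sub>C complex) \<Rightarrow> complex"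
  assumes K: "compact (UNIV :: 'k set)" and f: "entire_bounded_type f" and oa: "orthogonally_additive f"
    and R: "R > 0" and M: "\<And>z. norm z \<le> R \<Longrightarrow> norm (f z) \<le> M"
    and v: "cont v" "\<And>t. 0 \<le> v t" "\<And>t. v t \<le> 1"
  shows "norm (moment f k (\<lambda>t. complex_of_real (v t))) \<le> M / R ^ Suc k"
proof -
  define x where "x t = complex_of_real (root (Suc k) (v t))" for t
  have x: "cont x" unfolding x_def by (intro continuous_intros v)
  have xk: "x t ^ Suc k = complex_of_real (v t)" for t
    unfolding x_def using v by (simp only: of_real_power[symmetric]) (simp add: real_root_pow_pos2 del: power_Suc)
  have "norm (x t) \<le> 1" for t using v by (simp add: x_def)
  then have nx: "norm (Bcontfun x) \<le> 1" by (rule norm_Bcontfun_le[OF K x])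
  let ?h = "\<lambda>c. f (cscale c (Bcontfun x))"
  have hol: "?h holomorphic_on A" for A
    using gateaux_entireD[of f 0 "Bcontfun x" A] f by (simp add: entire_bounded_type_def)
  have "norm ((deriv ^^ Suc k) ?h 0) \<le> fact (Suc k) * M / R ^ Suc k"
  proof (rule Cauchy_inequality[OF hol _ R])
    show "continuous_on (cball 0 R) ?h" by (rule holomorphic_on_imp_continuous_on[OF hol])
    fix c :: complex assume "norm (0 - c) = R"
    then show "norm (?h c) \<le> M"
      using norm_cscale_le[of c "Bcontfun x"] nx R by (intro M) (simp add: mult_left_le order_trans)
  qed
  then have "norm (deriv_form f (replicate (Suc k) (Bcontfun x))) \<le> fact (Suc k) * M / R ^ Suc k"
    unfolding higher_deriv_along_line by (simp add: deriv_form_def)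
  then have "norm (moment f k (\<lambda>t. x t ^ Suc k)) \<le> fact (Suc k) * M / R ^ Suc k / fact (Suc k)"
    unfolding deriv_form_power[OF K f oa x] moment_def norm_divide norm_fact by (rule divide_right_mono) simp
  then show ?thesis by (simp add: xk del: fact_Suc power_Suc)
qed

lemma moment_expansion:
  fixes f :: "('k::t2_space \<Rightarrow>\<^sub>C complex) \<Rightarrow> complex"
  assumes K: "compact (UNIV :: 'k set)" and f: "entire_bounded_type f" and oa: "orthogonally_additive f"
  shows "(\<lambda>k. moment f k (\<lambda>t. apply_bcontfun x t ^ Suc k)) sums f x"
proof -
  let ?h = "\<lambda>c. f (cscale c x)"
  have hol: "?h holomorphic_on A" for A
    using gateaux_entireD[of f 0 x A] f by (simp add: entire_bounded_type_def)
  have "(\<lambda>n. (deriv ^^ n) ?h 0 / fact n * (1 - 0) ^ n) sums ?h 1"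
    by (rule holomorphic_power_series[of _ 0 2]) (rule hol, simp)
  then have "(\<lambda>n. deriv_form f (replicate n x) / fact n) sums f x"
    unfolding higher_deriv_along_line by (simp add: deriv_form_def)
  moreover have "deriv_form f (replicate 0 x) / fact 0 = 0"
  proof -
    have "f (0 + 0) = f 0 + f 0"
      using oa unfolding orthogonally_additive_def by (metis mult_zero_left zero_bcontfun.rep_eq)
    then show ?thesis by (simp add: deriv_form_def)
  qed
  ultimately have "(\<lambda>n. deriv_form f (replicate (Suc n) x) / fact (Suc n)) sums f x"
    by (subst sums_Suc_iff) simp
  moreover have "deriv_form f (replicate (Suc n) x) / fact (Suc n) = moment f n (\<lambda>t. apply_bcontfun x t ^ Suc n)" for n
    using deriv_form_power[OF K f oa, of "apply_bcontfun x" n] by (simp add: moment_def apply_bcontfun_inverse del: fact_Suc)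
  ultimately show ?thesis by simp
qed

section \<open>The Riesz representation theorem for positive functionals\<close>

definition positive_functional :: "(('k::topological_space \<Rightarrow> real) \<Rightarrow> real) \<Rightarrow> bool"
  where "positive_functional p \<longleftrightarrow>
    (\<forall>v. cont v \<longrightarrow> (\<forall>t. 0 \<le> v t) \<longrightarrow> 0 \<le> p v) \<and>
    (\<forall>v w. cont v \<longrightarrow> cont w \<longrightarrow> (\<forall>t. 0 \<le> v t) \<longrightarrow> (\<forall>t. 0 \<le> w t) \<longrightarrow> p (\<lambda>t. v t + w t) = p v + p w) \<and>
    (\<forall>c v. 0 \<le> c \<longrightarrow> cont v \<longrightarrow> (\<forall>t. 0 \<le> v t) \<longrightarrow> p (\<lambda>t. c * v t) = c * p v)"

lemma
  assumes "positive_functional p" "cont v" "\<And>t. 0 \<le> v t"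
  shows positive_functional_nonneg: "0 \<le> p v"
    and positive_functional_add: "cont w \<Longrightarrow> (\<And>t. 0 \<le> w t) \<Longrightarrow> p (\<lambda>t. v t + w t) = p v + p w"
    and positive_functional_scale: "0 \<le> c \<Longrightarrow> p (\<lambda>t. c * v t) = c * p v"
proof -
  note d = assms(1)[unfolded positive_functional_def]
  show "0 \<le> p v" using d assms by blast
  show "p (\<lambda>t. v t + w t) = p v + p w" if "cont w" "\<And>t. 0 \<le> w t" using d assms that by blast
  show "p (\<lambda>t. c * v t) = c * p v" if "0 \<le> c" using d assms that by blast
qed

lemma positive_functional_const:
  assumes "positive_functional p" "0 \<le> c"
  shows "p (\<lambda>_. c) = c * p (\<lambda>_. 1)"
  using positive_functional_scale[OF assms(1) continuous_on_const[of _ 1] _ assms(2)] by simp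

lemma positive_functional_mono:
  assumes p: "positive_functional p" and "cont v" "cont w" "\<And>t. 0 \<le> v t" "\<And>t. v t \<le> w t"
  shows "p v \<le> p w"
proof -
  have c: "cont (\<lambda>t. w t - v t)" by (intro continuous_intros assms)
  have "p (\<lambda>t. v t + (w t - v t)) = p v + p (\<lambda>t. w t - v t)"
    using assms c by (intro positive_functional_add[OF p]) auto
  moreover have "0 \<le> p (\<lambda>t. w t - v t)"
    using assms c by (intro positive_functional_nonneg[OF p]) auto
  ultimately show ?thesis by simp
qed

lemma positive_functional_sum:
  assumes p: "positive_functional p" and I: "finite I"
    and "\<And>i. i \<in> I \<Longrightarrow> cont (v i)" "\<And>i t. i \<in> I \<Longrightarrow> 0 \<le> v i t"
  shows "p (\<lambda>t. \<Sum>i\<in>I. v i t) = (\<Sum>i\<in>I. p (v i))"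
  using I assms(3,4)
proof (induction I rule: finite_induct)
  case empty
  show ?case using positive_functional_const[OF p, of 0] by simp
next
  case (insert i I)
  then show ?case
    using positive_functional_add[OF p, of "v i" "\<lambda>t. \<Sum>i\<in>I. v i t"]
    by (auto simp: continuous_on_sum sum_nonneg)
qed

text \<open>
  Cutting off at height \<open>e\<close> costs little, while the truncated function is supported in the
  closed set where \<open>v \<ge> e\<close>. This replaces test functions with support inside an open set.
\<close>
lemma positive_functional_le_shrunk:
  assumes p: "positive_functional p" and v: "cont v" "\<And>t. 0 \<le> v t" and e: "0 \<le> e"
  shows "p v \<le> p (\<lambda>t. max 0 (v t - e)) + e * p (\<lambda>_. 1)"
proof -
  have "p v \<le> p (\<lambda>t. max 0 (v t - e) + e)"
    using v e by (intro positive_functional_mono[OF p]) (auto intro!: continuous_intros)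
  also have "\<dots> = p (\<lambda>t. max 0 (v t - e)) + p (\<lambda>t. e)"
    using v e by (intro positive_functional_add[OF p]) (auto intro!: continuous_intros)
  also have "p (\<lambda>t. e) = e * p (\<lambda>_. 1)"
    by (rule positive_functional_const[OF p e])
  finally show ?thesis .
qed

text \<open>
  The measure is built from outside: the content of an open set is the supremum of the functional
  over the functions dominated by its indicator, and the outer measure of an arbitrary set is the
  infimum over its open neighbourhoods. Starting from all open sets, rather than from countable
  covers by functions, makes the measure regular also when \<open>K\<close> is not metrizable.
\<close>
definition test_functions :: "'k::topological_space set \<Rightarrow> ('k \<Rightarrow> real) set"
  where "test_functions U = {v. cont v \<and> (\<forall>t. 0 \<le> v t \<and> v t \<le> indicator U t)}"

definition open_content :: "(('k::topological_space \<Rightarrow> real) \<Rightarrow> real) \<Rightarrow> 'k set \<Rightarrow> ennreal"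
  where "open_content p U = (SUP v\<in>test_functions U. ennreal (p v))"

definition riesz_outer :: "(('k::topological_space \<Rightarrow> real) \<Rightarrow> real) \<Rightarrow> 'k set \<Rightarrow> ennreal"
  where "riesz_outer p A = (INF U\<in>{U. open U \<and> A \<subseteq> U}. open_content p U)"

lemma test_functionsD:
  assumes "v \<in> test_functions U"
  shows "cont v" "0 \<le> v t" "v t \<le> 1" "t \<notin> U \<Longrightarrow> v t = 0"
proof -
  have *: "0 \<le> v t" "v t \<le> indicator U t" using assms by (auto simp: test_functions_def)
  then show "0 \<le> v t" "v t \<le> 1" "t \<notin> U \<Longrightarrow> v t = 0"
    using order_trans[OF *(2) indicator_le_1] by auto
qed (use assms in \<open>auto simp: test_functions_def\<close>)

lemma test_functionsI:
  assumes "cont v" "\<And>t. 0 \<le> v t" "\<And>t. v t \<le> 1" "\<And>t. t \<notin> U \<Longrightarrow> v t = 0"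
  shows "v \<in> test_functions U"
  using assms by (auto simp: test_functions_def indicator_def)

lemma open_content_upper: "v \<in> test_functions U \<Longrightarrow> ennreal (p v) \<le> open_content p U"
  unfolding open_content_def by (rule SUP_upper)

lemma open_content_mono: "U \<subseteq> V \<Longrightarrow> open_content p U \<le> open_content p V"
  unfolding open_content_def
  by (rule SUP_subset_mono) (auto simp: test_functions_def indicator_def split: if_splits, force)

lemma open_content_le_total:
  assumes p: "positive_functional p"
  shows "open_content p U \<le> ennreal (p (\<lambda>_. 1))"
  unfolding open_content_def
  by (intro SUP_least ennreal_leI positive_functional_mono[OF p]) (auto dest: test_functionsD)

lemma open_content_UNIV:
  assumes p: "positive_functional p"
  shows "open_content p UNIV = ennreal (p (\<lambda>_. 1))"
  by (intro antisym open_content_le_total[OF p] open_content_upper test_functionsI) auto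

text \<open>
  Induction on the number of open sets: a Urysohn function that is one on \<open>C - U m\<close> and zero off
  the union of the previous sets splits \<open>w\<close> into a part dominated by \<open>U m\<close> and a part that
  is supported in a closed subset of that union.
\<close>
lemma open_content_finite_cover:
  fixes U :: "nat \<Rightarrow> 'k::t2_space set"
  assumes K: "compact (UNIV :: 'k set)" and p: "positive_functional p" and U: "\<And>n. open (U n)"
    and "closed C" "C \<subseteq> (\<Union>n<m. U n)" "w \<in> test_functions C"
  shows "ennreal (p w) \<le> (\<Sum>n<m. open_content p (U n))"
  using assms(4-)
proof (induction m arbitrary: C w)
  case 0
  then have "w = (\<lambda>_. 0)" by (auto dest: test_functionsD)
  moreover have "p (\<lambda>_. 0) = 0"
    using positive_functional_const[OF p, of 0] by simp
  ultimately show ?case by simp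
next
  case (Suc m)
  note w = test_functionsD[OF Suc.prems(3)]
  obtain u :: "'k \<Rightarrow> real" where u: "cont u" "\<And>t. 0 \<le> u t" "\<And>t. u t \<le> 1"
    "\<And>t. t \<in> C - U m \<Longrightarrow> u t = 0" "\<And>t. t \<in> - (\<Union>n<m. U n) \<Longrightarrow> u t = 1"
  proof (rule Urysohn_compact_Hausdorff[OF K, of "C - U m" "- (\<Union>n<m. U n)"])
    show "closed (C - U m)" "closed (- (\<Union>n<m. U n))"
      using U Suc.prems(1) by (auto simp: closed_Diff)
    show "(C - U m) \<inter> - (\<Union>n<m. U n) = {}"
      using Suc.prems(2) by (auto simp: lessThan_Suc)
  qed blast
  define \<phi> where "\<phi> t = max 0 (1 - 2 * u t)" for t
  have \<phi>: "cont \<phi>" "\<And>t. 0 \<le> \<phi> t" "\<And>t. \<phi> t \<le> 1"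
    unfolding \<phi>_def using u(2) by (auto intro!: continuous_intros u)
  have wp: "0 \<le> w t * \<phi> t" "w t * \<phi> t \<le> 1" "0 \<le> w t * (1 - \<phi> t)" "w t * (1 - \<phi> t) \<le> 1" for t
    using w(2,3)[of t] \<phi>(2,3)[of t] by (auto intro!: mult_le_one)
  have cw: "cont (\<lambda>t. w t * \<phi> t)" "cont (\<lambda>t. w t * (1 - \<phi> t))"
    by (intro continuous_intros w(1) \<phi>(1))+
  have "p (\<lambda>t. w t * \<phi> t + w t * (1 - \<phi> t)) = p (\<lambda>t. w t * \<phi> t) + p (\<lambda>t. w t * (1 - \<phi> t))"
    by (rule positive_functional_add[OF p]; intro cw wp)
  then have "p w = p (\<lambda>t. w t * \<phi> t) + p (\<lambda>t. w t * (1 - \<phi> t))"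
    by (simp add: algebra_simps)
  moreover have "ennreal (p (\<lambda>t. w t * \<phi> t)) \<le> (\<Sum>n<m. open_content p (U n))"
  proof (rule Suc.IH)
    show "closed (C \<inter> {t. u t \<le> 1/2})"
      by (intro closed_Int Suc.prems closed_Collect_le continuous_intros u)
    show "C \<inter> {t. u t \<le> 1/2} \<subseteq> (\<Union>n<m. U n)"
    proof
      fix t assume t: "t \<in> C \<inter> {t. u t \<le> 1/2}"
      show "t \<in> (\<Union>n<m. U n)"
        using u(5)[of t] t by (cases "t \<in> (\<Union>n<m. U n)") auto
    qed
    show "(\<lambda>t. w t * \<phi> t) \<in> test_functions (C \<inter> {t. u t \<le> 1 / 2})"
      using wp w(4) by (intro test_functionsI cw) (auto simp: \<phi>_def)
  qed
  moreover have "ennreal (p (\<lambda>t. w t * (1 - \<phi> t))) \<le> open_content p (U m)"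
  proof (intro open_content_upper test_functionsI cw wp)
    fix t assume "t \<notin> U m"
    then have "w t = 0 \<or> u t = 0" using w(4)[of t] u(4)[of t] by blast
    then show "w t * (1 - \<phi> t) = 0" by (auto simp: \<phi>_def)
  qed
  ultimately show ?case
    using positive_functional_nonneg[OF p cw(1) wp(1)] positive_functional_nonneg[OF p cw(2) wp(3)]
    by (simp add: ennreal_plus add_mono)
qed

lemma shrunk_test_function:
  assumes v: "v \<in> test_functions U" and e: "0 < e"
  shows "(\<lambda>t. max 0 (v t - e)) \<in> test_functions {t. v t \<ge> e}"
    "closed {t. v t \<ge> e}" "{t. v t \<ge> e} \<subseteq> U"
proof -
  note v = test_functionsD[OF v]
  show "(\<lambda>t. max 0 (v t - e)) \<in> test_functions {t. v t \<ge> e}"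
  proof (rule test_functionsI)
    show "max 0 (v t - e) \<le> 1" for t using v(3)[of t] e by simp
  qed (auto intro!: continuous_intros v)
  show "closed {t. v t \<ge> e}" by (intro closed_Collect_le continuous_intros v)
  show "{t. v t \<ge> e} \<subseteq> U" using v(4) e by fastforce
qed

lemma open_content_countable_union:
  fixes U :: "nat \<Rightarrow> 'k::t2_space set"
  assumes K: "compact (UNIV :: 'k set)" and p: "positive_functional p" and U: "\<And>n. open (U n)"
  shows "open_content p (\<Union>n. U n) \<le> (\<Sum>n. open_content p (U n))"
proof -
  have "ennreal (p v) \<le> (\<Sum>n. open_content p (U n))" if v: "v \<in> test_functions (\<Union>n. U n)" for v
  proof (rule ennreal_le_epsilon)
    fix e :: real assume e: "0 < e"
    have p1: "0 \<le> p (\<lambda>_. 1)" by (rule positive_functional_nonneg[OF p]) auto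
    define \<delta> where "\<delta> = e / (p (\<lambda>_. 1) + 1)"
    have \<delta>: "0 < \<delta>" "\<delta> * p (\<lambda>_. 1) \<le> e"
      using e p1 by (auto simp: \<delta>_def field_simps)
    note s = shrunk_test_function[OF v \<delta>(1)]
    have "compact {t. v t \<ge> \<delta>}" using K s(2) by (metis Int_UNIV_left compact_Int_closed)
    then obtain N where N: "finite N" "{t. v t \<ge> \<delta>} \<subseteq> (\<Union>n\<in>N. U n)"
      using s(3) U by (auto elim: compactE_image[where C=UNIV and f=U])
    obtain m where "N \<subseteq> {..<m}" using N(1) finite_nat_iff_bounded by blast
    then have "{t. v t \<ge> \<delta>} \<subseteq> (\<Union>n<m. U n)" using N(2) by blast
    then have "ennreal (p (\<lambda>t. max 0 (v t - \<delta>))) \<le> (\<Sum>n<m. open_content p (U n))"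
      by (rule open_content_finite_cover[OF K p U s(2) _ s(1)])
    also have "\<dots> \<le> (\<Sum>n. open_content p (U n))" by (rule sum_le_suminf) auto
    finally have 1: "ennreal (p (\<lambda>t. max 0 (v t - \<delta>))) \<le> (\<Sum>n. open_content p (U n))" .
    have "p v \<le> p (\<lambda>t. max 0 (v t - \<delta>)) + e"
      using positive_functional_le_shrunk[OF p, of v \<delta>] test_functionsD[OF v] \<delta> by force
    then have "ennreal (p v) \<le> ennreal (p (\<lambda>t. max 0 (v t - \<delta>)) + e)" by (rule ennreal_leI)
    also have "\<dots> = ennreal (p (\<lambda>t. max 0 (v t - \<delta>))) + ennreal e"
      using e positive_functional_nonneg[OF p] test_functionsD[OF s(1)] by (simp add: ennreal_plus)
    also have "\<dots> \<le> (\<Sum>n. open_content p (U n)) + ennreal e" by (intro add_mono 1) auto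
    finally show "ennreal (p v) \<le> (\<Sum>n. open_content p (U n)) + ennreal e" .
  qed
  then show ?thesis unfolding open_content_def[of p "\<Union>n. U n"] by (rule SUP_least)
qed

lemma riesz_outer_le: "open U \<Longrightarrow> A \<subseteq> U \<Longrightarrow> riesz_outer p A \<le> open_content p U"
  unfolding riesz_outer_def by (rule INF_lower) auto

lemma riesz_outer_open: "open U \<Longrightarrow> riesz_outer p U = open_content p U"
  unfolding riesz_outer_def
  by (intro antisym INF_greatest INF_lower2[of U]) (auto intro: open_content_mono)

lemma riesz_outer_close:
  assumes p: "positive_functional p" and e: "0 < e"
  obtains U where "open U" "A \<subseteq> U" "open_content p U \<le> riesz_outer p A + ennreal e"
proof -
  have "riesz_outer p A \<le> ennreal (p (\<lambda>_. 1))"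
    using riesz_outer_le[of UNIV A p] open_content_UNIV[OF p] by simp
  then have "riesz_outer p A < top" by (simp add: le_less_trans)
  then have "riesz_outer p A < riesz_outer p A + ennreal e" using e by simp
  then obtain U where "open U" "A \<subseteq> U" "open_content p U < riesz_outer p A + ennreal e"
    unfolding riesz_outer_def INF_less_iff by auto
  with that show thesis by simp
qed

lemma outer_measure_space_riesz_outer:
  assumes K: "compact (UNIV :: 'k::t2_space set)" and p: "positive_functional p"
  shows "outer_measure_space (Pow (UNIV :: 'k set)) (riesz_outer p)"
  unfolding outer_measure_space_def
proof (intro conjI)
  have "open_content p {} = 0"
  proof -
    have "open_content p {} \<le> 0"
      using open_content_finite_cover[OF K p, of "\<lambda>_. {}" "{}" 0]
      unfolding open_content_def[of p "{}"] by (intro SUP_least) auto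
    then show ?thesis by simp
  qed
  then show "positive (Pow UNIV) (riesz_outer p)"
    by (simp add: positive_def riesz_outer_open)
  show "increasing (Pow UNIV) (riesz_outer p)"
    unfolding increasing_def riesz_outer_def by (auto intro!: INF_superset_mono)
  show "countably_subadditive (Pow UNIV) (riesz_outer p)"
    unfolding countably_subadditive_def
  proof (intro allI impI)
    fix A :: "nat \<Rightarrow> 'k set"
    show "riesz_outer p (\<Union> (range A)) \<le> (\<Sum>n. riesz_outer p (A n))"
    proof (rule ennreal_le_epsilon)
      fix e :: real assume e: "0 < e"
      have "\<exists>U. open U \<and> A n \<subseteq> U \<and> open_content p U \<le> riesz_outer p (A n) + ennreal (e * (1/2) ^ Suc n)" for n
      proof -
        have "0 < e * (1/2) ^ Suc n" using e by simp
        from riesz_outer_close[OF p this, of "A n"] show ?thesis by metis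
      qed
      then obtain U where U: "\<And>n. open (U n)" "\<And>n. A n \<subseteq> U n"
        "\<And>n. open_content p (U n) \<le> riesz_outer p (A n) + ennreal (e * (1/2) ^ Suc n)" by metis
      have "riesz_outer p (\<Union> (range A)) \<le> open_content p (\<Union>n. U n)"
        using U by (intro riesz_outer_le) auto
      also have "\<dots> \<le> (\<Sum>n. open_content p (U n))" by (rule open_content_countable_union[OF K p U(1)])
      also have "\<dots> \<le> (\<Sum>n. riesz_outer p (A n) + ennreal (e * (1/2) ^ Suc n))"
        by (intro suminf_le U) auto
      also have "\<dots> = (\<Sum>n. riesz_outer p (A n)) + (\<Sum>n. ennreal e * ennreal ((1/2) ^ Suc n))"
        using e by (subst suminf_add[symmetric])
          (auto simp del: ennreal_suminf_cmult simp add: ennreal_mult[symmetric])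
      also have "\<dots> = (\<Sum>n. riesz_outer p (A n)) + e"
        unfolding ennreal_suminf_cmult
        by (subst suminf_ennreal_eq[OF zero_le_power power_half_series]) auto
      finally show "riesz_outer p (\<Union> (range A)) \<le> (\<Sum>n. riesz_outer p (A n)) + ennreal e" .
    qed
  qed
qed

text \<open>
  Given an open neighbourhood \<open>V\<close> of \<open>A\<close>, choose a test function \<open>v\<close> that nearly
  exhausts \<open>U \<inter> V\<close>. The set \<open>W\<close> where \<open>v\<close> is small is, inside \<open>V\<close>, an open
  neighbourhood of \<open>A - U\<close>; a test function of \<open>W\<close> and the truncation of \<open>v\<close> are
  disjoint, and their sum is a test function of \<open>V\<close>.
\<close>
lemma open_in_lambda_system:
  assumes K: "compact (UNIV :: 'k::t2_space set)" and p: "positive_functional p" and U: "open (U :: 'k set)"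
  shows "U \<in> lambda_system UNIV (Pow UNIV) (riesz_outer p)"
proof -
  note oms = outer_measure_space_riesz_outer[OF K p]
  have "riesz_outer p (U \<inter> A) + riesz_outer p ((UNIV - U) \<inter> A) = riesz_outer p A" for A
  proof (rule antisym)
    have "subadditive (Pow UNIV) (riesz_outer p)"
      using oms unfolding outer_measure_space_def
      by (intro ring_of_sets.countably_subadditive_subadditive[OF algebra.axioms(1)[OF algebra_Pow]]) auto
    then have "riesz_outer p ((U \<inter> A) \<union> ((UNIV - U) \<inter> A)) \<le> riesz_outer p (U \<inter> A) + riesz_outer p ((UNIV - U) \<inter> A)"
      by (rule subadditiveD) auto
    moreover have "(U \<inter> A) \<union> ((UNIV - U) \<inter> A) = A" by auto
    ultimately show "riesz_outer p A \<le> riesz_outer p (U \<inter> A) + riesz_outer p ((UNIV - U) \<inter> A)" by simp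
  next
    show "riesz_outer p (U \<inter> A) + riesz_outer p ((UNIV - U) \<inter> A) \<le> riesz_outer p A"
    proof (rule ennreal_le_epsilon)
      fix e :: real assume e: "0 < e"
      obtain V where V: "open V" "A \<subseteq> V" "open_content p V \<le> riesz_outer p A + ennreal (e/2)"
        using riesz_outer_close[OF p half_gt_zero[OF e], of A] by metis
      have p1: "0 \<le> p (\<lambda>_. 1)" by (rule positive_functional_nonneg[OF p]) auto
      define \<delta> where "\<delta> = (e/2) / (p (\<lambda>_. 1) + 1)"
      have \<delta>: "0 < \<delta>" "\<delta> * p (\<lambda>_. 1) \<le> e/2"
        using e p1 by (auto simp: \<delta>_def field_simps)
      have key: "ennreal (p v) + riesz_outer p ((UNIV - U) \<inter> A) \<le> open_content p V + ennreal (e/2)"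
        if v: "v \<in> test_functions (U \<inter> V)" for v
      proof -
        note s = shrunk_test_function[OF v \<delta>(1)]
        define W where "W = V - {t. v t \<ge> \<delta>}"
        have "open W" using V s(2) by (auto simp: W_def)
        have "riesz_outer p ((UNIV - U) \<inter> A) \<le> open_content p W"
          by (rule riesz_outer_le[OF \<open>open W\<close>]) (use s(3) V in \<open>auto simp: W_def\<close>)
        moreover have "ennreal (p v) + open_content p W \<le> open_content p V + ennreal (e/2)"
        proof -
          have "ennreal (p v) + ennreal (p w) \<le> open_content p V + ennreal (e/2)"
            if w: "w \<in> test_functions W" for w
          proof -
            have "(\<lambda>t. max 0 (v t - \<delta>) + w t) \<in> test_functions V"
            proof (rule test_functionsI)
              fix t
              show "max 0 (v t - \<delta>) + w t \<le> 1"
                using test_functionsD(2-4)[OF v, of t] test_functionsD(2-4)[OF w, of t] \<delta>(1)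
                by (cases "v t \<ge> \<delta>") (auto simp: W_def)
              show "0 \<le> max 0 (v t - \<delta>) + w t" using test_functionsD(2)[OF w, of t] by simp
              show "max 0 (v t - \<delta>) + w t = 0" if "t \<notin> V"
                using test_functionsD(4)[OF v, of t] test_functionsD(4)[OF w, of t] that \<delta>(1) by (auto simp: W_def)
            qed (intro continuous_intros test_functionsD(1)[OF v] test_functionsD(1)[OF w])
            then have "ennreal (p (\<lambda>t. max 0 (v t - \<delta>) + w t)) \<le> open_content p V"
              by (rule open_content_upper)
            moreover have "p (\<lambda>t. max 0 (v t - \<delta>) + w t) = p (\<lambda>t. max 0 (v t - \<delta>)) + p w"
              using test_functionsD[OF s(1)] test_functionsD[OF w]
              by (intro positive_functional_add[OF p]) auto
            moreover have "p v \<le> p (\<lambda>t. max 0 (v t - \<delta>)) + e/2"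
              using positive_functional_le_shrunk[OF p, of v \<delta>] test_functionsD[OF v] \<delta> by force
            ultimately have "ennreal (p (\<lambda>t. max 0 (v t - \<delta>)) + p w) \<le> open_content p V"
              "p v + p w \<le> (p (\<lambda>t. max 0 (v t - \<delta>)) + p w) + e/2" by auto
            moreover have nn: "0 \<le> p v" "0 \<le> p w" "0 \<le> p (\<lambda>t. max 0 (v t - \<delta>))"
              using test_functionsD[OF v] test_functionsD[OF w] test_functionsD[OF s(1)]
              by (auto intro: positive_functional_nonneg[OF p])
            ultimately have "ennreal (p v + p w) \<le> ennreal ((p (\<lambda>t. max 0 (v t - \<delta>)) + p w) + e/2)"
              by (intro ennreal_leI)
            also have "\<dots> = ennreal (p (\<lambda>t. max 0 (v t - \<delta>)) + p w) + ennreal (e/2)"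
              using e nn by (intro ennreal_plus) auto
            also have "\<dots> \<le> open_content p V + ennreal (e/2)"
              by (intro add_mono order_refl) fact
            finally show ?thesis using nn by (simp add: ennreal_plus)
          qed
          moreover have "test_functions W \<noteq> {}"
            using test_functionsI[of "\<lambda>_. 0" W] by auto
          ultimately have "(SUP w\<in>test_functions W. ennreal (p v) + ennreal (p w)) \<le> open_content p V + ennreal (e/2)"
            by (intro SUP_least)
          then show ?thesis
            unfolding open_content_def[of p W] by (subst ennreal_SUP_add_right[OF \<open>test_functions W \<noteq> {}\<close>])
        qed
        ultimately show ?thesis by (meson add_left_mono order_trans)
      qed
      have ne: "test_functions (U \<inter> V) \<noteq> {}"
        using test_functionsI[of "\<lambda>_. 0" "U \<inter> V"] by auto
      have "riesz_outer p (U \<inter> A) \<le> open_content p (U \<inter> V)"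
        using U V by (intro riesz_outer_le) auto
      then have "riesz_outer p (U \<inter> A) + riesz_outer p ((UNIV - U) \<inter> A)
          \<le> open_content p (U \<inter> V) + riesz_outer p ((UNIV - U) \<inter> A)" by (rule add_right_mono)
      also have "\<dots> = (SUP v\<in>test_functions (U \<inter> V). ennreal (p v) + riesz_outer p ((UNIV - U) \<inter> A))"
        unfolding open_content_def by (rule ennreal_SUP_add_left[OF ne, symmetric])
      also have "\<dots> \<le> open_content p V + ennreal (e/2)" by (rule SUP_least) (rule key)
      also have "\<dots> \<le> riesz_outer p A + ennreal (e/2) + ennreal (e/2)" by (rule add_right_mono) (rule V)
      also have "\<dots> = riesz_outer p A + ennreal e"
        using e by (simp add: add.assoc flip: ennreal_plus)
      finally show "riesz_outer p (U \<inter> A) + riesz_outer p ((UNIV - U) \<inter> A) \<le> riesz_outer p A + ennreal e" .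
    qed
  qed
  then show ?thesis by (simp add: lambda_system_def)
qed

definition riesz_measure :: "(('k::topological_space \<Rightarrow> real) \<Rightarrow> real) \<Rightarrow> 'k measure"
  where "riesz_measure p = measure_of UNIV (sets borel) (riesz_outer p)"

lemma sets_riesz_measure [simp]: "sets (riesz_measure p) = sets borel"
  unfolding riesz_measure_def
  using sets.sigma_sets_eq[of borel] by simp

lemma emeasure_riesz_measure:
  assumes K: "compact (UNIV :: 'k::t2_space set)" and p: "positive_functional p" and A: "A \<in> sets borel"
  shows "emeasure (riesz_measure p) (A :: 'k set) = riesz_outer p A"
  unfolding riesz_measure_def
proof (rule emeasure_measure_of_sigma[OF _ _ _ A])
  let ?L = "lambda_system UNIV (Pow (UNIV :: 'k set)) (riesz_outer p)"
  note oms = outer_measure_space_riesz_outer[OF K p]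
  have ms: "measure_space UNIV ?L (riesz_outer p)"
    using sigma_algebra.caratheodory_lemma[OF sigma_algebra_Pow oms] .
  have sub: "sets borel \<subseteq> ?L"
  proof -
    have "sigma_algebra UNIV ?L" using ms by (simp add: measure_space_def)
    then have "sigma_sets UNIV {S. open S} \<subseteq> ?L"
      by (rule sigma_algebra.sigma_sets_subset) (use open_in_lambda_system[OF K p] in blast)
    then show ?thesis by (simp add: borel_def)
  qed
  show "sigma_algebra UNIV (sets (borel :: 'k measure))"
    using sets.sigma_algebra_axioms[of "borel :: 'k measure"] by simp
  show "positive (sets (borel :: 'k measure)) (riesz_outer p)"
    using oms by (simp add: outer_measure_space_def positive_def)
  have ca: "countably_additive ?L (riesz_outer p)" using ms by (simp add: measure_space_def)
  show "countably_additive (sets (borel :: 'k measure)) (riesz_outer p)"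
    unfolding countably_additive_def
  proof (intro allI impI)
    fix B :: "nat \<Rightarrow> 'k set"
    assume B: "range B \<subseteq> sets borel" "disjoint_family B" "\<Union> (range B) \<in> sets borel"
    show "(\<Sum>i. riesz_outer p (B i)) = riesz_outer p (\<Union> (range B))"
      using ca[unfolded countably_additive_def, rule_format, OF order_trans[OF B(1) sub] B(2) subsetD[OF sub B(3)]] .
  qed
qed

lemma finite_measure_riesz:
  assumes K: "compact (UNIV :: 'k::t2_space set)" and p: "positive_functional p"
  shows "finite_measure (riesz_measure p :: 'k measure)"
    and "measure (riesz_measure p) (UNIV :: 'k set) = p (\<lambda>_. 1)"
proof -
  have s: "space (riesz_measure p) = UNIV" using sets_eq_imp_space_eq[OF sets_riesz_measure[of p]] by simp
  have e: "emeasure (riesz_measure p) (UNIV :: 'k set) = ennreal (p (\<lambda>_. 1))"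
    by (simp add: emeasure_riesz_measure[OF K p] riesz_outer_open open_content_UNIV[OF p])
  then show "finite_measure (riesz_measure p :: 'k measure)" by (intro finite_measureI) (simp add: s)
  show "measure (riesz_measure p) (UNIV :: 'k set) = p (\<lambda>_. 1)"
    using e positive_functional_nonneg[OF p] by (simp add: measure_def)
qed

text \<open>
  Outer regularity is built into the construction. Passing to complements, which is possible as
  the measure is finite, turns it into inner regularity, since closed sets are compact.
\<close>
lemma regular_borel_measure_riesz:
  assumes K: "compact (UNIV :: 'k::t2_space set)" and p: "positive_functional p"
  shows "regular_borel_measure (riesz_measure p :: 'k measure)"
proof -
  let ?M = "riesz_measure p :: 'k measure"
  interpret finite_measure ?M by (rule finite_measure_riesz[OF K p])
  have s: "space ?M = UNIV" using sets_eq_imp_space_eq[OF sets_riesz_measure[of p]] by simp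
  have outer: "emeasure ?M A = (INF U\<in>{U. open U \<and> A \<subseteq> U}. emeasure ?M U)" if "A \<in> sets borel" for A
    unfolding emeasure_riesz_measure[OF K p that] riesz_outer_def
    by (rule INF_cong) (auto simp: emeasure_riesz_measure[OF K p] riesz_outer_open)
  have "emeasure ?M A = (SUP C\<in>{C. compact C \<and> C \<subseteq> A}. emeasure ?M C)" if A: "A \<in> sets borel" for A
  proof (rule antisym)
    show "(SUP C\<in>{C. compact C \<and> C \<subseteq> A}. emeasure ?M C) \<le> emeasure ?M A"
      using A by (auto intro!: SUP_least emeasure_mono)
    show "emeasure ?M A \<le> (SUP C\<in>{C. compact C \<and> C \<subseteq> A}. emeasure ?M C)"
    proof (rule ennreal_le_epsilon)
      fix e :: real assume e: "0 < e"
      obtain V where V: "open V" "- A \<subseteq> V" "open_content p V \<le> riesz_outer p (- A) + ennreal e"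
        using riesz_outer_close[OF p e] .
      have nA: "- A \<in> sets borel" using A by auto
      have bV: "V \<in> sets borel" "- V \<in> sets borel" using V by auto
      have "emeasure ?M V \<le> emeasure ?M (- A) + ennreal e"
        using V nA by (simp add: emeasure_riesz_measure[OF K p] riesz_outer_open)
      then have 1: "measure ?M V \<le> measure ?M (- A) + e"
        using e by (simp add: emeasure_eq_measure flip: ennreal_plus)
      have 2: "measure ?M A = measure ?M UNIV - measure ?M (- A)"
        "measure ?M (- V) = measure ?M UNIV - measure ?M V"
        using finite_measure_compl[of "- A"] finite_measure_compl[of V] nA bV
        by (simp_all add: s Compl_eq_Diff_UNIV[symmetric])
      have "compact (- V)" using K V by (metis Int_UNIV_left closed_Compl compact_Int_closed)
      then have "emeasure ?M (- V) \<le> (SUP C\<in>{C. compact C \<and> C \<subseteq> A}. emeasure ?M C)"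
        using V(2) by (intro SUP_upper) auto
      moreover have "emeasure ?M A \<le> emeasure ?M (- V) + ennreal e"
      proof -
        have "measure ?M A \<le> measure ?M (- V) + e" using 1 2 by simp
        then show ?thesis
          unfolding emeasure_eq_measure using e
          by (metis ennreal_leI ennreal_plus measure_nonneg less_imp_le)
      qed
      ultimately show "emeasure ?M A \<le> (SUP C\<in>{C. compact C \<and> C \<subseteq> A}. emeasure ?M C) + ennreal e"
        by (meson add_right_mono order_trans)
    qed
  qed
  then show ?thesis
    unfolding regular_borel_measure_def by (intro conjI ballI outer sets_riesz_measure)
qed

lemma borel_measurable_cont:
  fixes v :: "'k::topological_space \<Rightarrow> 'b::topological_space"
  assumes "sets M = sets borel" "cont v"
  shows "v \<in> borel_measurable M"
  using assms borel_measurable_continuous_onI measurable_cong_sets by blast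

lemma integrable_cont:
  fixes v :: "'k::topological_space \<Rightarrow> 'b::{banach, second_countable_topology}"
  assumes K: "compact (UNIV :: 'k set)" and M: "finite_measure M" "sets M = sets borel" and v: "cont v"
  shows "integrable M v"
proof -
  obtain B where "\<And>t. norm (v t) \<le> B" using cont_bounded[OF K v] by blast
  then show ?thesis
    using finite_measure.integrable_const_bound[OF M(1), of v B] borel_measurable_cont[OF M(2) v] by auto
qed

text \<open>
  Cut \<open>v\<close> into horizontal layers of height \<open>1/n\<close>. The layer between \<open>i/n\<close> and
  \<open>(i + 1)/n\<close> is \<open>1/n\<close> times a test function of \<open>{v > i/n}\<close>, so \<open>p v\<close> is at most
  \<open>1/n\<close> times the sum of the measures of these sets, which is an integral exceeding that of
  \<open>v\<close> by at most \<open>1/n\<close> times the total mass.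
\<close>
lemma riesz_measure_ge:
  assumes K: "compact (UNIV :: 'k::t2_space set)" and p: "positive_functional p"
    and v: "cont v" "\<And>t :: 'k. 0 \<le> v t"
  shows "p v \<le> (\<integral>t. v t \<partial>riesz_measure p)"
proof -
  let ?M = "riesz_measure p :: 'k measure"
  interpret finite_measure ?M by (rule finite_measure_riesz[OF K p])
  have s: "space ?M = UNIV" using sets_eq_imp_space_eq[OF sets_riesz_measure[of p]] by simp
  have int: "integrable ?M w" if "cont w" for w :: "'k \<Rightarrow> real"
    by (rule integrable_cont[OF K finite_measure_axioms sets_riesz_measure that])
  obtain B where B: "\<And>t. norm (v t) \<le> B" using cont_bounded[OF K v(1)] by blast
  obtain N :: nat where N: "B \<le> real N" using real_arch_simple by blast
  have vN: "v t \<le> real N" for t using B[of t] N by simp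
  have bound: "p v \<le> measure ?M UNIV / real n + (\<integral>t. v t \<partial>?M)" if n: "n > 0" for n :: nat
  proof -
    define U where "U i = {t. v t > real i / real n}" for i :: nat
    define w where "w i t = min (v t) (real (Suc i) / real n) - min (v t) (real i / real n)" for i t
    have U: "open (U i)" for i unfolding U_def by (intro open_Collect_less continuous_intros v)
    have w: "cont (w i)" "0 \<le> w i t" for i t
    proof -
      show "cont (w i)" unfolding w_def by (intro continuous_intros v)
      have "real i / real n \<le> real (Suc i) / real n" by (intro divide_right_mono) auto
      then show "0 \<le> w i t" unfolding w_def by linarith
    qed
    have wU: "real n * w i t \<le> 1" "t \<notin> U i \<Longrightarrow> w i t = 0" for i t
      unfolding w_def U_def using n by (auto simp: min_def field_simps)
    have pw: "p (w i) \<le> measure ?M (U i) / real n" for i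
    proof -
      have "(\<lambda>t. real n * w i t) \<in> test_functions (U i)"
        using w wU n by (intro test_functionsI) (auto intro!: continuous_intros)
      then have "ennreal (p (\<lambda>t. real n * w i t)) \<le> emeasure ?M (U i)"
        using U by (simp add: emeasure_riesz_measure[OF K p] riesz_outer_open open_content_upper)
      then have "real n * p (w i) \<le> measure ?M (U i)"
        using w by (simp add: positive_functional_scale[OF p] emeasure_eq_measure)
      then show ?thesis using n by (simp add: field_simps)
    qed
    have tel: "(\<Sum>i<m. w i t) = min (v t) (real m / real n)" for m t
      unfolding w_def by (subst sum_lessThan_telescope) (use v(2)[of t] in \<open>simp add: min_def\<close>)
    have ind: "(\<Sum>i<Suc m. indicator (U i) t / real n) \<le> 1 / real n + min (v t) (real m / real n)" for m t
    proof (induction m)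
      case 0
      show ?case using n v(2)[of t] by (simp add: indicator_def min_def)
    next
      case (Suc m)
      have "indicator (U (Suc m)) t / real n + min (v t) (real m / real n) \<le> min (v t) (real (Suc m) / real n)"
        using n by (auto simp: indicator_def U_def min_def field_simps)
      then have "(\<Sum>i<Suc m. indicator (U i) t / real n) + indicator (U (Suc m)) t / real n
          \<le> 1 / real n + min (v t) (real (Suc m) / real n)"
        using Suc by linarith
      then show ?case by (simp only: sum.lessThan_Suc[of _ "Suc m"])
    qed
    have "p v = p (\<lambda>t. \<Sum>i<n * N. w i t)"
      unfolding tel using vN n by (simp add: min_absorb1)
    also have "\<dots> = (\<Sum>i<n * N. p (w i))"
      by (rule positive_functional_sum[OF p]) (auto simp: w)
    also have "\<dots> \<le> (\<Sum>i<Suc (n * N). measure ?M (U i) / real n)"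
      by (rule order_trans[OF sum_mono[OF pw]]) simp
    also have "\<dots> = (\<integral>t. (\<Sum>i<Suc (n * N). indicator (U i) t / real n) \<partial>?M)"
      using U by (subst Bochner_Integration.integral_sum) (auto simp: s emeasure_eq_measure)
    also have "\<dots> \<le> (\<integral>t. 1 / real n + v t \<partial>?M)"
    proof (rule integral_mono)
      show "(\<Sum>i<Suc (n * N). indicator (U i) t / real n) \<le> 1 / real n + v t" for t
        using ind[where m = "n * N" and t = t] by linarith
      show "integrable ?M (\<lambda>t. \<Sum>i<Suc (n * N). indicator (U i) t / real n)"
        using U by (intro Bochner_Integration.integrable_sum) (auto simp: s emeasure_eq_measure)
      show "integrable ?M (\<lambda>t. 1 / real n + v t)" by (intro int continuous_intros v)
    qed
    also have "\<dots> = measure ?M UNIV / real n + (\<integral>t. v t \<partial>?M)"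
      using int[OF v(1)] by (simp add: s)
    finally show ?thesis .
  qed
  have "(\<lambda>n. measure ?M UNIV / real n + (\<integral>t. v t \<partial>?M)) \<longlonglongrightarrow> 0 + (\<integral>t. v t \<partial>?M)"
    by (intro tendsto_intros lim_const_over_n)
  then have "p v \<le> 0 + (\<integral>t. v t \<partial>?M)"
    by (rule tendsto_lowerbound) (auto intro!: eventually_mono[OF eventually_gt_at_top[of 0]] bound)
  then show ?thesis by simp
qed

text \<open>
  The inequality \<open>riesz_measure_ge\<close> for \<open>v\<close> and for \<open>B - v\<close> gives equality, because both
  sides agree on the constant \<open>B\<close>.
\<close>
theorem Riesz_representation:
  assumes K: "compact (UNIV :: 'k::t2_space set)" and p: "positive_functional p"
    and v: "cont v" "\<And>t :: 'k. 0 \<le> v t"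
  shows "(\<integral>t. v t \<partial>riesz_measure p) = p v"
proof (rule antisym)
  let ?M = "riesz_measure p :: 'k measure"
  interpret finite_measure ?M by (rule finite_measure_riesz[OF K p])
  have s: "space ?M = UNIV" using sets_eq_imp_space_eq[OF sets_riesz_measure[of p]] by simp
  obtain B where B: "B > 0" "\<And>t. norm (v t) \<le> B" using cont_bounded[OF K v(1)] by blast
  have c: "cont (\<lambda>t. B - v t)" and nn: "0 \<le> B - v t" for t
    using B(2)[of t] by (auto intro!: continuous_intros v)
  have "p (\<lambda>t. v t + (B - v t)) = p v + p (\<lambda>t. B - v t)"
    by (rule positive_functional_add[OF p v c nn])
  moreover have "p (\<lambda>_. B) = B * p (\<lambda>_. 1)"
    using positive_functional_const[OF p, of B] B(1) by simp
  moreover have "p (\<lambda>t. B - v t) \<le> (\<integral>t. B - v t \<partial>?M)"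
    by (rule riesz_measure_ge[OF K p c nn])
  moreover have "(\<integral>t. B - v t \<partial>?M) = B * p (\<lambda>_. 1) - (\<integral>t. v t \<partial>?M)"
    using integrable_cont[OF K finite_measure_axioms sets_riesz_measure v(1)] finite_measure_riesz(2)[OF K p]
    by (simp add: s)
  ultimately show "(\<integral>t. v t \<partial>?M) \<le> p v" by simp
qed (rule riesz_measure_ge[OF K p v])

text \<open>
  Contents and outer measures are monotone in the functional; this is the source of the absolute
  continuity in \<open>riesz_density\<close>.
\<close>
lemma emeasure_riesz_measure_mono:
  assumes K: "compact (UNIV :: 'k::t2_space set)" and p: "positive_functional p" and q: "positive_functional q"
    and le: "\<And>v :: 'k \<Rightarrow> real. cont v \<Longrightarrow> (\<And>t. 0 \<le> v t) \<Longrightarrow> p v \<le> q v" and A: "A \<in> sets borel"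
  shows "emeasure (riesz_measure p) A \<le> emeasure (riesz_measure q) A"
  unfolding emeasure_riesz_measure[OF K p A] emeasure_riesz_measure[OF K q A] riesz_outer_def open_content_def
proof (intro INF_superset_mono[OF order_refl] SUP_subset_mono[OF order_refl] ennreal_leI)
  fix U :: "'k set" and v assume "v \<in> test_functions U"
  from test_functionsD[OF this] show "p v \<le> q v" by (intro le) auto
qed

lemma integrable_mult_cont:
  fixes h a :: "'k::topological_space \<Rightarrow> complex"
  assumes M: "sets M = sets borel" and h: "integrable M h" and a: "cont a"
    and r: "\<And>t. norm (a t) \<le> r"
  shows "integrable M (\<lambda>t. h t * a t)" "L1_norm M (\<lambda>t. h t * a t) \<le> L1_norm M h * r"
proof -
  have le: "norm (h t * a t) \<le> norm (h t) * r" for t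
    unfolding norm_mult by (intro mult_left_mono r) simp
  show int: "integrable M (\<lambda>t. h t * a t)"
  proof (rule Bochner_Integration.integrable_bound[of _ "\<lambda>t. norm (h t) * r"])
    show "integrable M (\<lambda>t. norm (h t) * r)" using h by simp
    show "(\<lambda>t. h t * a t) \<in> borel_measurable M"
      using h borel_measurable_cont[OF M a] by auto
    show "AE t in M. norm (h t * a t) \<le> norm (norm (h t) * r)"
      using order_trans[OF le abs_ge_self] by simp
  qed
  have "L1_norm M (\<lambda>t. h t * a t) \<le> (\<integral>t. norm (h t) * r \<partial>M)"
    unfolding L1_norm_def using h int by (intro integral_mono le) auto
  then show "L1_norm M (\<lambda>t. h t * a t) \<le> L1_norm M h * r" by (simp add: L1_norm_def)
qed

section \<open>Densities representing a summable family of complex functionals\<close>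

definition below :: "('k::topological_space \<Rightarrow> real) \<Rightarrow> ('k \<Rightarrow> real) set"
  where "below v = {w. cont w \<and> (\<forall>t. 0 \<le> w t \<and> w t \<le> v t)}"

text \<open>
  On nonnegative functions this is the positive part of \<open>q\<close> in the dual Banach lattice of the
  real continuous functions.
\<close>
definition positive_part :: "(('k::topological_space \<Rightarrow> real) \<Rightarrow> real) \<Rightarrow> ('k \<Rightarrow> real) \<Rightarrow> real"
  where "positive_part q v = (SUP w\<in>below v. q w)"

definition bounded_functional :: "real \<Rightarrow> (('k::topological_space \<Rightarrow> real) \<Rightarrow> real) \<Rightarrow> bool"
  where "bounded_functional c q \<longleftrightarrow>
    (\<forall>v w. cont v \<longrightarrow> cont w \<longrightarrow> q (\<lambda>t. v t + w t) = q v + q w) \<and>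
    (\<forall>a v. cont v \<longrightarrow> q (\<lambda>t. a * v t) = a * q v) \<and>
    (\<forall>v\<in>below (\<lambda>_. 1). \<bar>q v\<bar> \<le> c)"

lemma zero_in_below: "(\<And>t. 0 \<le> v t) \<Longrightarrow> (\<lambda>_. 0) \<in> below v"
  by (simp add: below_def)

context
  fixes q :: "('k::t2_space \<Rightarrow> real) \<Rightarrow> real" and c :: real
  assumes K: "compact (UNIV :: 'k set)" and q: "bounded_functional c q"
begin

lemma bounded_functional_add: "cont v \<Longrightarrow> cont w \<Longrightarrow> q (\<lambda>t. v t + w t) = q v + q w"
  and bounded_functional_scale: "cont v \<Longrightarrow> q (\<lambda>t. a * v t) = a * q v"
  and bounded_functional_bound: "v \<in> below (\<lambda>_. 1) \<Longrightarrow> \<bar>q v\<bar> \<le> c"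
  using q by (auto simp: bounded_functional_def)

lemma bounded_functional_zero: "q (\<lambda>_. 0) = 0"
  using bounded_functional_scale[of "\<lambda>_. 0" 0] by simp

lemma bdd_above_below:
  assumes v: "cont v" "\<And>t. 0 \<le> v t"
  shows "bdd_above (q ` below v)"
proof -
  obtain B where B: "B > 0" "\<And>t. norm (v t) \<le> B" using cont_bounded[OF K v(1)] by blast
  have "q w \<le> B * c" if w: "w \<in> below v" for w
  proof -
    have cw: "cont w" and le: "0 \<le> w t" "w t \<le> B" for t
      using w B(2)[of t] by (auto simp: below_def dest: spec[of _ t])
    have "(\<lambda>t. 1 / B * w t) \<in> below (\<lambda>_. 1)"
      unfolding below_def using cw le B(1) by (auto intro!: continuous_intros)
    then have "q (\<lambda>t. 1 / B * w t) \<le> c" by (rule abs_le_D1[OF bounded_functional_bound])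
    then have "1 / B * q w \<le> c" by (simp only: bounded_functional_scale[OF cw])
    then show ?thesis using B(1) by (simp add: field_simps)
  qed
  then show ?thesis by (auto intro!: bdd_aboveI2)
qed

lemma positive_part_upper:
  assumes "cont v" "\<And>t. 0 \<le> v t" "w \<in> below v"
  shows "q w \<le> positive_part q v"
  unfolding positive_part_def using assms by (intro cSUP_upper bdd_above_below)

lemma positive_part_least:
  assumes "\<And>t. 0 \<le> v t" "\<And>w. w \<in> below v \<Longrightarrow> q w \<le> b"
  shows "positive_part q v \<le> b"
  unfolding positive_part_def using assms zero_in_below[of v] by (intro cSUP_least) auto

text \<open>
  Additivity is the Riesz decomposition property: \<open>w \<le> v + v'\<close> is the sum of
  \<open>min w v \<le> v\<close> and \<open>w - min w v \<le> v'\<close>.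
\<close>
lemma positive_functional_positive_part: "positive_functional (positive_part q)"
  unfolding positive_functional_def
proof (intro conjI allI impI)
  fix v :: "'k \<Rightarrow> real" assume v: "cont v" "\<forall>t. 0 \<le> v t"
  show "0 \<le> positive_part q v"
    using positive_part_upper[OF v(1) _ zero_in_below[of v]] v bounded_functional_zero by simp
next
  fix v v' :: "'k \<Rightarrow> real"
  assume v: "cont v" "cont v'" "\<forall>t. 0 \<le> v t" "\<forall>t. 0 \<le> v' t"
  have cs: "cont (\<lambda>t. v t + v' t)" and ns: "0 \<le> v t + v' t" for t
    using v by (auto intro!: continuous_intros)
  show "positive_part q (\<lambda>t. v t + v' t) = positive_part q v + positive_part q v'"
  proof (rule antisym)
    show "positive_part q (\<lambda>t. v t + v' t) \<le> positive_part q v + positive_part q v'"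
    proof (rule positive_part_least[OF ns])
      fix w assume w: "w \<in> below (\<lambda>t. v t + v' t)"
      then have cw: "cont w" by (simp add: below_def)
      have w1: "(\<lambda>t. min (w t) (v t)) \<in> below v"
        using w v by (auto simp: below_def intro!: continuous_intros)
      have w2: "(\<lambda>t. w t - min (w t) (v t)) \<in> below v'"
      proof -
        have "cont (\<lambda>t. w t - min (w t) (v t))" by (intro continuous_intros cw v)
        moreover have "0 \<le> w t - min (w t) (v t)" "w t - min (w t) (v t) \<le> v' t" for t
        proof -
          have "w t \<le> v t + v' t" "0 \<le> v' t" using w v by (auto simp: below_def)
          then show "0 \<le> w t - min (w t) (v t)" "w t - min (w t) (v t) \<le> v' t" by linarith+
        qed
        ultimately show ?thesis by (simp add: below_def)
      qed
      have "q (\<lambda>t. min (w t) (v t) + (w t - min (w t) (v t))) = q (\<lambda>t. min (w t) (v t)) + q (\<lambda>t. w t - min (w t) (v t))"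
        by (intro bounded_functional_add continuous_intros cw v)
      then have "q w = q (\<lambda>t. min (w t) (v t)) + q (\<lambda>t. w t - min (w t) (v t))" by simp
      also have "\<dots> \<le> positive_part q v + positive_part q v'"
        using v by (intro add_mono positive_part_upper w1 w2) auto
      finally show "q w \<le> positive_part q v + positive_part q v'" .
    qed
    have "q w + q w' \<le> positive_part q (\<lambda>t. v t + v' t)" if w: "w \<in> below v" "w' \<in> below v'" for w w'
    proof -
      have "q w + q w' = q (\<lambda>t. w t + w' t)" using w by (simp add: bounded_functional_add below_def)
      also have "\<dots> \<le> positive_part q (\<lambda>t. v t + v' t)"
        using w by (intro positive_part_upper cs ns) (auto simp: below_def add_mono intro!: continuous_intros)
      finally show ?thesis .
    qed
    then have "positive_part q v \<le> positive_part q (\<lambda>t. v t + v' t) - q w'" if "w' \<in> below v'" for w'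
      using that v by (intro positive_part_least) (auto simp: le_diff_eq)
    then have "positive_part q v' \<le> positive_part q (\<lambda>t. v t + v' t) - positive_part q v"
      using v by (intro positive_part_least) (auto simp: le_diff_eq add.commute)
    then show "positive_part q v + positive_part q v' \<le> positive_part q (\<lambda>t. v t + v' t)" by simp
  qed
next
  fix a :: real and v :: "'k \<Rightarrow> real" assume a: "0 \<le> a" and v: "cont v" "\<forall>t. 0 \<le> v t"
  have le: "positive_part q (\<lambda>t. a * v t) \<le> a * positive_part q v"
    if a: "0 < a" and v: "cont v" "\<And>t. 0 \<le> v t" for a v
  proof (rule positive_part_least)
    fix w assume w: "w \<in> below (\<lambda>t. a * v t)"
    have "(\<lambda>t. 1 / a * w t) \<in> below v"
      using w a by (auto simp: below_def field_simps intro!: continuous_intros)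
    then have "q (\<lambda>t. 1 / a * w t) \<le> positive_part q v" by (rule positive_part_upper[OF v])
    moreover have "q (\<lambda>t. 1 / a * w t) = 1 / a * q w" using w by (intro bounded_functional_scale) (simp add: below_def)
    ultimately have "1 / a * q w \<le> positive_part q v" by (simp only:)
    then show "q w \<le> a * positive_part q v" using a by (simp add: field_simps)
  qed (use a v in auto)
  show "positive_part q (\<lambda>t. a * v t) = a * positive_part q v"
  proof (cases "a = 0")
    case True
    have "below (\<lambda>_::'k. 0::real) = {\<lambda>_. 0}" by (auto simp: below_def fun_eq_iff antisym)
    then show ?thesis using True bounded_functional_zero by (simp add: positive_part_def)
  next
    case False
    then have a: "0 < a" using a by simp
    have "positive_part q (\<lambda>t. 1 / a * (a * v t)) \<le> 1 / a * positive_part q (\<lambda>t. a * v t)"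
      using a v by (intro le) (auto intro!: continuous_intros)
    then have "a * positive_part q v \<le> positive_part q (\<lambda>t. a * v t)"
      using a by (simp add: field_simps)
    then show ?thesis using le[OF a v(1)] v(2) by (intro antisym) auto
  qed
qed

lemma positive_part_one_le: "positive_part q (\<lambda>_. 1) \<le> c"
  using bounded_functional_bound by (intro positive_part_least) (auto simp: abs_le_iff)

text \<open>
  The map \<open>w \<mapsto> v - w\<close> preserves \<open>below v\<close>, and \<open>q w = q v - q (v - w)\<close>.
\<close>
lemma positive_part_le_negative:
  assumes v: "cont v" "\<And>t. 0 \<le> v t"
    and q': "\<And>w. w \<in> below v \<Longrightarrow> - q w \<le> b"
  shows "positive_part q v \<le> q v + b"
proof (rule positive_part_least[OF v(2)])
  fix w assume w: "w \<in> below v"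
  then have cw: "cont w" by (simp add: below_def)
  have "q (\<lambda>t. w t + (v t - w t)) = q w + q (\<lambda>t. v t - w t)"
    by (intro bounded_functional_add continuous_intros cw v)
  moreover have "- q (\<lambda>t. v t - w t) \<le> b"
    using w v by (intro q') (auto simp: below_def intro!: continuous_intros)
  ultimately show "q w \<le> q v + b" by simp
qed

end

lemma Jordan_decomposition_functional:
  fixes q :: "('k::t2_space \<Rightarrow> real) \<Rightarrow> real"
  assumes K: "compact (UNIV :: 'k set)" and q: "bounded_functional c q" and v: "cont v" "\<And>t. 0 \<le> v t"
  shows "q v = positive_part q v - positive_part (\<lambda>w. - q w) v"
proof (rule antisym)
  have q': "bounded_functional c (\<lambda>w. - q w)" using q by (auto simp: bounded_functional_def)
  have "positive_part q v \<le> q v + positive_part (\<lambda>w. - q w) v"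
    using positive_part_upper[OF K q' v] by (intro positive_part_le_negative[OF K q v])
  then show "positive_part q v - positive_part (\<lambda>w. - q w) v \<le> q v" by simp
  have "positive_part (\<lambda>w. - q w) v \<le> - q v + positive_part q v"
    using positive_part_upper[OF K q v] by (intro positive_part_le_negative[OF K q' v]) simp
  then show "q v \<le> positive_part q v - positive_part (\<lambda>w. - q w) v" by simp
qed

text \<open>
  The Riesz measure of \<open>p\<close> is dominated by that of \<open>q\<close>, so \<open>D\<close> is its Radon-Nikodym
  derivative.
\<close>
lemma riesz_density:
  assumes K: "compact (UNIV :: 'k::t2_space set)" and p: "positive_functional p" and q: "positive_functional q"
    and le: "\<And>v :: 'k \<Rightarrow> real. cont v \<Longrightarrow> (\<And>t. 0 \<le> v t) \<Longrightarrow> p v \<le> q v"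
  obtains D :: "'k::t2_space \<Rightarrow> real" where "\<And>t. 0 \<le> D t" "integrable (riesz_measure q) D"
    "\<And>v. cont v \<Longrightarrow> (\<And>t. 0 \<le> v t) \<Longrightarrow> (\<integral>t. D t * v t \<partial>riesz_measure q) = p v"
proof -
  let ?M = "riesz_measure q :: 'k measure" and ?N = "riesz_measure p :: 'k measure"
  interpret M: finite_measure ?M by (rule finite_measure_riesz[OF K q])
  interpret N: finite_measure ?N by (rule finite_measure_riesz[OF K p])
  have ac: "absolutely_continuous ?M ?N"
  proof -
    have "emeasure ?N A = 0" if "A \<in> sets borel" "emeasure ?M A = 0" for A
      using emeasure_riesz_measure_mono[OF K p q le that(1)] that(2) by simp
    then show ?thesis by (auto simp: absolutely_continuous_def null_sets_def)
  qed
  obtain D where D: "D \<in> borel_measurable ?M" "AE t in ?M. RN_deriv ?M ?N t = ennreal (D t)" "\<And>t. 0 \<le> D t"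
    using M.real_RN_deriv[OF N.finite_measure_axioms ac] by auto
  have dens: "?N = density ?M (\<lambda>t. ennreal (D t))"
  proof -
    have "density ?M (RN_deriv ?M ?N) = density ?M (\<lambda>t. ennreal (D t))"
      using D by (intro density_cong) auto
    then show ?thesis using M.density_RN_deriv[OF ac] by simp
  qed
  have int: "(\<integral>t. D t * v t \<partial>?M) = p v" if v: "cont v" "\<And>t. 0 \<le> v t" for v
  proof -
    have "p v = (\<integral>t. v t \<partial>density ?M (\<lambda>t. ennreal (D t)))"
      using Riesz_representation[OF K p v] dens by simp
    also have "\<dots> = (\<integral>t. D t *\<^sub>R v t \<partial>?M)"
      using D v borel_measurable_cont[OF sets_riesz_measure v(1)] by (intro integral_density) auto
    finally show ?thesis by simp
  qed
  have "integrable (density ?M (\<lambda>t. ennreal (D t))) (\<lambda>_. 1 :: real)"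
    unfolding dens[symmetric] by simp
  then have "integrable ?M (\<lambda>t. D t *\<^sub>R (1 :: real))"
    using D by (subst (asm) integrable_density) auto
  then have "integrable ?M D" by simp
  then show thesis using that D(3) int by blast
qed

lemma i_power_sum4: "(\<Sum>j<4. \<i> ^ j * X j) = X 0 + \<i> * X 1 - X 2 - \<i> * X 3"
  by (simp add: numeral_eq_Suc lessThan_Suc)

text \<open>
  Each \<open>L k\<close> is the sum over \<open>j < 4\<close> of \<open>\<i>\<^sup>j\<close> times the positive part of
  \<open>Re ((- \<i>)\<^sup>j L k)\<close>. The bounds \<open>c k\<close> are summable, so all these positive parts have a
  common majorant, namely their sum, whose Riesz measure serves as \<open>\<mu>\<close>. The mass of the density of
  a positive part is its value at \<open>1\<close>, which is at most \<open>c k\<close>.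
\<close>
lemma complex_Riesz_family:
  fixes L :: "nat \<Rightarrow> ('k::t2_space \<Rightarrow> complex) \<Rightarrow> complex" and c :: "nat \<Rightarrow> real"
  assumes K: "compact (UNIV :: 'k set)"
    and add: "\<And>k a b. cont a \<Longrightarrow> cont b \<Longrightarrow> L k (\<lambda>t. a t + b t) = L k a + L k b"
    and cmult: "\<And>k e a. cont a \<Longrightarrow> L k (\<lambda>t. e * a t) = e * L k a"
    and bound: "\<And>k v. cont v \<Longrightarrow> (\<And>t. 0 \<le> v t) \<Longrightarrow> (\<And>t. v t \<le> 1) \<Longrightarrow>
      norm (L k (\<lambda>t. complex_of_real (v t))) \<le> c k"
    and c: "summable c"
  obtains \<mu> g where "finite_measure \<mu>" "regular_borel_measure \<mu>" "\<And>k. integrable \<mu> (g k)"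
    "\<And>k. (\<integral>t. norm (g k t) \<partial>\<mu>) \<le> 4 * c k" "\<And>k a. cont a \<Longrightarrow> L k a = (\<integral>t. g k t * a t \<partial>\<mu>)"
proof -
  define q where "q k j w = Re ((- \<i>) ^ j * L k (\<lambda>t. complex_of_real (w t)))" for k and j :: nat and w
  define p where "p k j = positive_part (q k j)" for k j
  have qb: "bounded_functional (c k) (q k j)" for k j
    unfolding bounded_functional_def
  proof (intro conjI allI impI ballI)
    fix v w :: "'k \<Rightarrow> real" assume vw: "cont v" "cont w"
    have "L k (\<lambda>t. complex_of_real (v t) + complex_of_real (w t)) = L k (\<lambda>t. complex_of_real (v t)) + L k (\<lambda>t. complex_of_real (w t))"
      by (intro add continuous_intros vw)
    then show "q k j (\<lambda>t. v t + w t) = q k j v + q k j w" by (simp add: q_def distrib_left)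
  next
    fix a and v :: "'k \<Rightarrow> real" assume v: "cont v"
    have "L k (\<lambda>t. complex_of_real a * complex_of_real (v t)) = a * L k (\<lambda>t. complex_of_real (v t))"
      by (intro cmult continuous_intros v)
    then have "q k j (\<lambda>t. a * v t) = Re (complex_of_real a * ((- \<i>) ^ j * L k (\<lambda>t. complex_of_real (v t))))"
      by (simp add: q_def mult.left_commute)
    then show "q k j (\<lambda>t. a * v t) = a * q k j v" unfolding q_def by simp
  next
    fix v :: "'k \<Rightarrow> real" assume v: "v \<in> below (\<lambda>_. 1)"
    have "\<bar>q k j v\<bar> \<le> norm ((- \<i>) ^ j * L k (\<lambda>t. complex_of_real (v t)))"
      unfolding q_def by (rule abs_Re_le_cmod)
    also have "\<dots> \<le> c k" using v by (simp add: norm_mult norm_power bound below_def)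
    finally show "\<bar>q k j v\<bar> \<le> c k" .
  qed
  have pf: "positive_functional (p k j)" for k j
    unfolding p_def by (rule positive_functional_positive_part[OF K qb])
  have p1: "p k j (\<lambda>_. 1) \<le> c k" for k j
    unfolding p_def by (rule positive_part_one_le[OF K qb])
  define S where "S k v = (\<Sum>j<4. p k j v)" for k v
  have Snn: "0 \<le> S k v" if "cont v" "\<And>t. 0 \<le> v t" for k v
    unfolding S_def using that by (intro sum_nonneg positive_functional_nonneg[OF pf])
  have Ssum: "summable (\<lambda>k. S k v)" if v: "cont v" "\<And>t. 0 \<le> v t" for v
  proof -
    obtain B where B: "B > 0" "\<And>t. norm (v t) \<le> B" using cont_bounded[OF K v(1)] by blast
    have vB: "v t \<le> B" for t using B(2)[of t] by simp
    have "p k j v \<le> B * c k" for k j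
    proof -
      have "p k j v \<le> p k j (\<lambda>_. B)" by (intro positive_functional_mono[OF pf] v vB) simp
      also have "\<dots> = B * p k j (\<lambda>_. 1)" using positive_functional_const[OF pf, of B] B(1) by simp
      also have "\<dots> \<le> B * c k" using p1 B(1) by (intro mult_left_mono) auto
      finally show ?thesis .
    qed
    then have S_le: "S k v \<le> 4 * (B * c k)" for k
      unfolding S_def using sum_bounded_above[of "{..<4}" "\<lambda>j. p k j v" "B * c k"] by simp
    have sm: "summable (\<lambda>k. 4 * (B * c k))" by (intro summable_mult c)
    show ?thesis
    proof (rule summable_comparison_test[OF _ sm], intro exI allI impI)
      show "norm (S k v) \<le> 4 * (B * c k)" for k using S_le[of k] Snn[OF v, of k] by simp
    qed
  qed
  define \<Lambda> where "\<Lambda> v = (\<Sum>k. S k v)" for v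
  have \<Lambda>: "positive_functional \<Lambda>"
    unfolding positive_functional_def
  proof (intro conjI allI impI)
    fix v :: "'k \<Rightarrow> real" assume v: "cont v" "\<forall>t. 0 \<le> v t"
    then show "0 \<le> \<Lambda> v" unfolding \<Lambda>_def by (intro suminf_nonneg Ssum Snn) auto
  next
    fix v w :: "'k \<Rightarrow> real" assume v: "cont v" "cont w" "\<forall>t. 0 \<le> v t" "\<forall>t. 0 \<le> w t"
    then have "S k (\<lambda>t. v t + w t) = S k v + S k w" for k
      unfolding S_def sum.distrib[symmetric] by (intro sum.cong positive_functional_add[OF pf]) auto
    then show "\<Lambda> (\<lambda>t. v t + w t) = \<Lambda> v + \<Lambda> w"
      unfolding \<Lambda>_def using v by (simp add: suminf_add Ssum)
  next
    fix a :: real and v :: "'k \<Rightarrow> real" assume a: "0 \<le> a" and v: "cont v" "\<forall>t. 0 \<le> v t"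
    then have "S k (\<lambda>t. a * v t) = a * S k v" for k
      unfolding S_def sum_distrib_left by (intro sum.cong positive_functional_scale[OF pf]) auto
    then show "\<Lambda> (\<lambda>t. a * v t) = a * \<Lambda> v"
      unfolding \<Lambda>_def using v by (simp add: suminf_mult Ssum)
  qed
  have le: "p k j v \<le> \<Lambda> v" if "j < 4" "cont v" "\<And>t. 0 \<le> v t" for k j v
  proof -
    have "p k j v \<le> S k v"
      unfolding S_def using that by (intro member_le_sum positive_functional_nonneg[OF pf]) auto
    also have "\<dots> = (\<Sum>k\<in>{k}. S k v)" by simp
    also have "\<dots> \<le> \<Lambda> v" unfolding \<Lambda>_def using that by (intro sum_le_suminf Ssum Snn) auto
    finally show ?thesis .
  qed
  let ?M = "riesz_measure \<Lambda> :: 'k measure"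
  have fin: "finite_measure ?M" by (rule finite_measure_riesz[OF K \<Lambda>])
  define dens where "dens k j D \<longleftrightarrow> (\<forall>t. 0 \<le> D t) \<and> integrable ?M D \<and>
      (\<forall>v. cont v \<longrightarrow> (\<forall>t. 0 \<le> v t) \<longrightarrow> (\<integral>t. D t * v t \<partial>?M) = p k j v)" for k j D
  define D where "D k j = (SOME D. dens k j D)" for k j
  have "dens k j (D k j)" if j: "j < 4" for k j
  proof -
    obtain E where "\<And>t. 0 \<le> E t" "integrable ?M E"
      "\<And>v. cont v \<Longrightarrow> (\<And>t. 0 \<le> v t) \<Longrightarrow> (\<integral>t. E t * v t \<partial>?M) = p k j v"
      using riesz_density[OF K pf \<Lambda> le[OF j]] by blast
    then have "dens k j E" by (simp add: dens_def)
    then show ?thesis unfolding D_def by (rule someI[where P = "dens k j"])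
  qed
  then have D: "\<And>k j t. j < 4 \<Longrightarrow> 0 \<le> D k j t" "\<And>k j. j < 4 \<Longrightarrow> integrable ?M (D k j)"
      "\<And>k j v. j < 4 \<Longrightarrow> cont v \<Longrightarrow> (\<And>t. 0 \<le> v t) \<Longrightarrow> (\<integral>t. D k j t * v t \<partial>?M) = p k j v"
    by (simp_all add: dens_def)
  define g where "g k t = (\<Sum>j<4. \<i> ^ j * complex_of_real (D k j t))" for k t
  have intD: "integrable ?M (\<lambda>t. \<i> ^ j * complex_of_real (D k j t))" if "j < 4" for k j
    using D(2)[OF that] by (intro integrable_mult_right integrable_of_real)
  have intg: "integrable ?M (g k)" for k
    unfolding g_def by (intro Bochner_Integration.integrable_sum intD) auto
  have intga: "integrable ?M (\<lambda>t. h t * a t)" if h: "integrable ?M h" and a: "cont a" for h a :: "'k \<Rightarrow> complex"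
  proof -
    obtain B where B: "\<And>t. norm (a t) \<le> B" using cont_bounded[OF K a] by blast
    show ?thesis by (rule integrable_mult_cont(1)[OF sets_riesz_measure h a B])
  qed
  have "(\<integral>t. norm (g k t) \<partial>?M) \<le> 4 * c k" for k
  proof -
    have "(\<integral>t. norm (g k t) \<partial>?M) \<le> (\<integral>t. (\<Sum>j<4. D k j t) \<partial>?M)"
    proof (rule integral_mono)
      show "integrable ?M (\<lambda>t. norm (g k t))" using intg by simp
      show "integrable ?M (\<lambda>t. \<Sum>j<4. D k j t)" using D(2) by (intro Bochner_Integration.integrable_sum) auto
      show "norm (g k t) \<le> (\<Sum>j<4. D k j t)" for t
        unfolding g_def using D(1) by (intro sum_norm_le) (simp add: norm_mult norm_power)
    qed
    also have "\<dots> = (\<Sum>j<4. p k j (\<lambda>_. 1))"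
      using D(2) D(3)[of _ "\<lambda>_. 1"] by (subst Bochner_Integration.integral_sum) auto
    also have "\<dots> \<le> 4 * c k"
      using sum_bounded_above[of "{..<4}" "\<lambda>j. p k j (\<lambda>_. 1)" "c k"] p1 by simp
    finally show ?thesis .
  qed
  moreover have "L k a = (\<integral>t. g k t * a t \<partial>?M)" if a: "cont a" for k a
  proof -
    have base: "L k (\<lambda>t. complex_of_real (v t)) = (\<integral>t. g k t * complex_of_real (v t) \<partial>?M)"
      if v: "cont v" "\<And>t. 0 \<le> v t" for v
    proof -
      let ?a = "L k (\<lambda>t. complex_of_real (v t))"
      have "q k j v = p k j v - positive_part (\<lambda>w. - q k j w) v" for j
        unfolding p_def by (rule Jordan_decomposition_functional[OF K qb v])
      moreover have "(\<lambda>w. - q k 0 w) = q k 2" "(\<lambda>w. - q k 1 w) = q k 3"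
        by (auto simp: q_def fun_eq_iff power2_eq_square power3_eq_cube)
      ultimately have "q k 0 v = p k 0 v - p k 2 v" "q k 1 v = p k 1 v - p k 3 v"
        unfolding p_def by metis+
      then have "?a = (\<Sum>j<4. \<i> ^ j * complex_of_real (p k j v))"
        unfolding i_power_sum4 by (simp add: q_def complex_eq_iff)
      also have "\<dots> = (\<Sum>j<4. (\<integral>t. \<i> ^ j * complex_of_real (D k j t) * complex_of_real (v t) \<partial>?M))"
      proof (rule sum.cong[OF refl])
        fix j assume "j \<in> {..<4::nat}"
        then have "p k j v = (\<integral>t. D k j t * v t \<partial>?M)" using D(3) v by simp
        then have "complex_of_real (p k j v) = (\<integral>t. complex_of_real (D k j t * v t) \<partial>?M)"
          by (simp only: integral_complex_of_real)
        then show "\<i> ^ j * complex_of_real (p k j v) = (\<integral>t. \<i> ^ j * complex_of_real (D k j t) * complex_of_real (v t) \<partial>?M)"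
          by (simp add: mult.assoc)
      qed
      also have "\<dots> = (\<integral>t. (\<Sum>j<4. \<i> ^ j * complex_of_real (D k j t) * complex_of_real (v t)) \<partial>?M)"
        by (rule Bochner_Integration.integral_sum[symmetric]) (intro intga intD continuous_intros v; simp)
      finally show ?thesis by (simp add: g_def sum_distrib_right)
    qed
    define r where "r j t = (if j = 0 then max 0 (Re (a t)) else if j = 1 then max 0 (Im (a t))
        else if j = 2 then max 0 (- Re (a t)) else max 0 (- Im (a t)))" for j :: nat and t
    have r: "cont (r j)" "0 \<le> r j t" for j t
      unfolding r_def by (cases "j = 0"; cases "j = 1"; cases "j = 2"; simp; intro continuous_intros a) auto
    have ra: "a = (\<lambda>t. \<Sum>j<4. \<i> ^ j * complex_of_real (r j t))"
      unfolding i_power_sum4 by (auto simp: r_def complex_eq_iff max_def)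
    have cr: "cont (\<lambda>t. \<i> ^ j * complex_of_real (r j t))" for j by (intro continuous_intros r)
    have L0: "L k (\<lambda>_. 0) = 0" using cmult[of "\<lambda>_. 0" k 0] by simp
    have "L k (\<lambda>t. \<Sum>j\<in>J. \<i> ^ j * complex_of_real (r j t)) = (\<Sum>j\<in>J. L k (\<lambda>t. \<i> ^ j * complex_of_real (r j t)))"
      if "finite J" for J
      using that by (induction J rule: finite_induct) (auto simp: L0 add cr continuous_on_sum)
    then have "L k a = (\<Sum>j<4. L k (\<lambda>t. \<i> ^ j * complex_of_real (r j t)))"
      using ra by simp
    also have "\<dots> = (\<Sum>j<4. (\<integral>t. g k t * (\<i> ^ j * complex_of_real (r j t)) \<partial>?M))"
    proof (rule sum.cong[OF refl])
      fix j
      have "L k (\<lambda>t. \<i> ^ j * complex_of_real (r j t)) = \<i> ^ j * L k (\<lambda>t. complex_of_real (r j t))"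
        by (intro cmult continuous_intros r)
      then show "L k (\<lambda>t. \<i> ^ j * complex_of_real (r j t)) = (\<integral>t. g k t * (\<i> ^ j * complex_of_real (r j t)) \<partial>?M)"
        using base[OF r] by (simp add: mult.left_commute)
    qed
    also have "\<dots> = (\<integral>t. (\<Sum>j<4. g k t * (\<i> ^ j * complex_of_real (r j t))) \<partial>?M)"
      by (rule Bochner_Integration.integral_sum[symmetric]) (intro intga intg cr)
    also have "\<dots> = (\<integral>t. g k t * a t \<partial>?M)"
      by (simp only: sum_distrib_left[symmetric] ra[THEN fun_cong, symmetric])
    finally show ?thesis .
  qed
  ultimately show thesis
    using that[of ?M g] fin regular_borel_measure_riesz[OF K \<Lambda>] intg by blast
qed

section \<open>Power series functions with values in integrable functions\<close>

lemma L1_norm_nonneg: "0 \<le> L1_norm M u"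
  by (simp add: L1_norm_def)

lemma L1_norm_suminf_le:
  fixes u :: "nat \<Rightarrow> 'k \<Rightarrow> complex"
  assumes int: "\<And>k. integrable M (u k)" and sm: "\<And>t. summable (\<lambda>k. norm (u k t))"
    and b: "\<And>k. L1_norm M (u k) \<le> b k" "summable b"
  shows "integrable M (\<lambda>t. \<Sum>k. u k t)" "L1_norm M (\<lambda>t. \<Sum>k. u k t) \<le> (\<Sum>k. b k)"
    "(\<lambda>k. \<integral>t. u k t \<partial>M) sums (\<integral>t. (\<Sum>k. u k t) \<partial>M)"
proof -
  have sn: "summable (\<lambda>k. \<integral>t. norm (u k t) \<partial>M)"
    by (rule summable_comparison_test[OF _ b(2)]) (use b(1) in \<open>auto simp: L1_norm_def\<close>)
  show I: "integrable M (\<lambda>t. \<Sum>k. u k t)"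
    by (rule integrable_suminf) (use int sm sn in auto)
  show "(\<lambda>k. \<integral>t. u k t \<partial>M) sums (\<integral>t. (\<Sum>k. u k t) \<partial>M)"
    by (rule sums_integral) (use int sm sn in auto)
  have In: "integrable M (\<lambda>t. \<Sum>k. norm (u k t))"
    by (rule integrable_suminf) (use int sm sn in auto)
  have "L1_norm M (\<lambda>t. \<Sum>k. u k t) \<le> (\<integral>t. (\<Sum>k. norm (u k t)) \<partial>M)"
    unfolding L1_norm_def by (intro integral_mono In integrable_norm[OF I] summable_norm sm)
  also have "\<dots> = (\<Sum>k. L1_norm M (u k))"
    unfolding L1_norm_def by (rule integral_suminf) (use int sm sn in auto)
  also have "\<dots> \<le> (\<Sum>k. b k)"
    using sn b by (intro suminf_le) (auto simp: L1_norm_def)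
  finally show "L1_norm M (\<lambda>t. \<Sum>k. u k t) \<le> (\<Sum>k. b k)" .
qed

text \<open>
  Polynomial factors in \<open>k\<close> are absorbed by enlarging the radius, as \<open>k + 1 \<le> 2\<^sup>k\<^sup>+\<^sup>1\<close>.
\<close>
lemma summable_with_factor:
  fixes G :: "nat \<Rightarrow> real"
  assumes G: "\<And>r. 0 \<le> r \<Longrightarrow> summable (\<lambda>k. G k * r ^ Suc k)" and nn: "\<And>k. 0 \<le> G k" and r: "0 \<le> r"
  shows "summable (\<lambda>k. G k * (real (Suc k) * r ^ k))"
    and "summable (\<lambda>k. G k * (real (Suc k) * real k * r ^ (k - 1)))"
proof -
  define s where "s = max 1 r"
  have s: "1 \<le> s" "r \<le> s" by (auto simp: s_def)
  have pw: "r ^ i \<le> s ^ Suc k" if "i \<le> k" for i k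
  proof -
    have "r ^ i \<le> s ^ i" using r s by (intro power_mono)
    also have "\<dots> \<le> s ^ Suc k" using s that by (intro power_increasing) auto
    finally show ?thesis .
  qed
  have two: "real (Suc k) \<le> 2 ^ Suc k" "real k \<le> 2 ^ Suc k" for k
    using of_nat_less_two_power[of "Suc k", where 'a = real] by auto
  have main: "summable (\<lambda>k. G k * (4 * s) ^ Suc k)" using s by (intro G) simp
  show "summable (\<lambda>k. G k * (real (Suc k) * r ^ k))"
  proof (rule summable_comparison_test[OF _ main], intro exI allI impI)
    fix k
    have "real (Suc k) * r ^ k \<le> 4 ^ Suc k * s ^ Suc k"
    proof (rule mult_mono)
      have "(2::real) ^ Suc k \<le> 4 ^ Suc k" by (rule power_mono) auto
      then show "real (Suc k) \<le> 4 ^ Suc k" using two(1)[of k] by linarith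
    qed (use pw[of k k] r in auto)
    then show "norm (G k * (real (Suc k) * r ^ k)) \<le> G k * (4 * s) ^ Suc k"
      using nn[of k] r by (simp add: power_mult_distrib mult_left_mono abs_mult del: power_Suc)
  qed
  show "summable (\<lambda>k. G k * (real (Suc k) * real k * r ^ (k - 1)))"
  proof (rule summable_comparison_test[OF _ main], intro exI allI impI)
    fix k
    have "real (Suc k) * real k * r ^ (k - 1) \<le> (2 ^ Suc k * 2 ^ Suc k) * s ^ Suc k"
      using two[of k] pw[of "k - 1" k] r by (intro mult_mono) auto
    also have "(2::real) ^ Suc k * 2 ^ Suc k = 4 ^ Suc k" by (simp flip: power_mult_distrib del: power_Suc)
    finally show "norm (G k * (real (Suc k) * real k * r ^ (k - 1))) \<le> G k * (4 * s) ^ Suc k"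
      using nn[of k] r by (simp add: power_mult_distrib mult_left_mono abs_mult del: power_Suc)
  qed
qed

lemma power_remainder_le:
  fixes z w :: complex
  assumes "norm z \<le> r" "norm w \<le> r"
  shows "norm (w ^ Suc k - z ^ Suc k - of_nat (Suc k) * z ^ k * (w - z))
    \<le> real (Suc k) * real k * r ^ (k - 1) * (norm (w - z))\<^sup>2"
proof (cases "w = z")
  case False
  let ?h = "w - z"
  have h: "?h \<noteq> 0" using False by simp
  have "norm (((z + ?h) ^ Suc k - z ^ Suc k) / ?h - of_nat (Suc k) * z ^ (Suc k - Suc 0))
      \<le> real (Suc k) * real (Suc k - Suc 0) * r ^ (Suc k - 2) * norm ?h"
    by (rule lemma_termdiff3[OF h]) (use assms in simp_all)
  then have 1: "norm ((w ^ Suc k - z ^ Suc k) / ?h - of_nat (Suc k) * z ^ k)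
      \<le> real (Suc k) * real k * r ^ (k - 1) * norm ?h"
    by (simp add: numeral_2_eq_2)
  have "w ^ Suc k - z ^ Suc k - of_nat (Suc k) * z ^ k * ?h
      = ((w ^ Suc k - z ^ Suc k) / ?h - of_nat (Suc k) * z ^ k) * ?h"
  proof -
    have "a / ?h * ?h = a" for a using h by simp
    then show ?thesis by (simp only: left_diff_distrib)
  qed
  then have "norm (w ^ Suc k - z ^ Suc k - of_nat (Suc k) * z ^ k * ?h)
      = norm ((w ^ Suc k - z ^ Suc k) / ?h - of_nat (Suc k) * z ^ k) * norm ?h"
    by (simp only: norm_mult)
  also have "\<dots> \<le> (real (Suc k) * real k * r ^ (k - 1) * norm ?h) * norm ?h"
    by (rule mult_right_mono[OF 1]) simp
  finally show ?thesis by (simp add: power2_eq_square mult.assoc)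
qed simp

lemma norm_apply_bcontfun_le: "norm (apply_bcontfun x t) \<le> norm x"
  by (rule norm_bounded)

text \<open>
  Summability is required pointwise everywhere besides summability of the norms, so that all series
  below converge at every point and their identities hold without exceptional sets. By
  \<open>pointwise_summable_representatives\<close> this can always be arranged by changing the coefficients
  on a null set.
\<close>
context
  fixes \<mu> :: "'k::topological_space measure" and g :: "nat \<Rightarrow> 'k \<Rightarrow> complex"
  assumes M: "sets \<mu> = sets borel"
    and int: "\<And>k. integrable \<mu> (g k)"
    and pt: "\<And>t r. 0 \<le> r \<Longrightarrow> summable (\<lambda>k. norm (g k t) * r ^ Suc k)"
    and G: "\<And>r. 0 \<le> r \<Longrightarrow> summable (\<lambda>k. L1_norm \<mu> (g k) * r ^ Suc k)"
begin

definition coeff_series :: "('k \<Rightarrow>\<^sub>C complex) \<Rightarrow> 'k \<Rightarrow> complex"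
  where "coeff_series x t = (\<Sum>k. g k t * apply_bcontfun x t ^ Suc k)"

definition coeff_series_deriv :: "('k \<Rightarrow>\<^sub>C complex) \<Rightarrow> ('k \<Rightarrow>\<^sub>C complex) \<Rightarrow> 'k \<Rightarrow> complex"
  where "coeff_series_deriv x v t = (\<Sum>k. g k t * (of_nat (Suc k) * apply_bcontfun x t ^ k * apply_bcontfun v t))"

lemma norm_apply_power_le: "norm (apply_bcontfun x t ^ k) \<le> norm x ^ k" for x :: "'k \<Rightarrow>\<^sub>C complex"
  unfolding norm_power by (intro power_mono norm_apply_bcontfun_le) simp

lemma term_summable: "summable (\<lambda>k. norm (g k t * apply_bcontfun x t ^ Suc k))"
  using pt[of "norm (apply_bcontfun x t)" t] by (simp add: norm_mult norm_power)

lemma deriv_term_summable: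
  "summable (\<lambda>k. norm (g k t * (of_nat (Suc k) * apply_bcontfun x t ^ k * apply_bcontfun v t)))"
proof -
  have "summable (\<lambda>k. norm (g k t) * (real (Suc k) * norm (apply_bcontfun x t) ^ k) * norm (apply_bcontfun v t))"
    by (intro summable_mult2 summable_with_factor(1) pt) auto
  then show ?thesis by (simp add: norm_mult norm_power mult.assoc del: of_nat_Suc)
qed

lemma term_integrable:
  "integrable \<mu> (\<lambda>t. g k t * apply_bcontfun x t ^ Suc k)"
  "L1_norm \<mu> (\<lambda>t. g k t * apply_bcontfun x t ^ Suc k) \<le> L1_norm \<mu> (g k) * norm x ^ Suc k"
  by (rule integrable_mult_cont[OF M int _ norm_apply_power_le]; intro continuous_intros continuous_on_apply_bcontfun)+

lemma
  shows coeff_series_integrable: "integrable \<mu> (coeff_series x)"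
    and L1_norm_coeff_series_le: "L1_norm \<mu> (coeff_series x) \<le> (\<Sum>k. L1_norm \<mu> (g k) * norm x ^ Suc k)"
    and coeff_series_sums: "(\<lambda>k. \<integral>t. g k t * apply_bcontfun x t ^ Suc k \<partial>\<mu>) sums (\<integral>t. coeff_series x t \<partial>\<mu>)"
  using L1_norm_suminf_le[OF term_integrable(1) term_summable term_integrable(2) G[OF norm_ge_zero]]
  unfolding coeff_series_def[abs_def] by auto

lemma coeff_series_partial_sums:
  "(\<lambda>n. L1_norm \<mu> (\<lambda>t. coeff_series x t - (\<Sum>k<n. g k t * apply_bcontfun x t ^ Suc k))) \<longlonglongrightarrow> 0"
proof -
  let ?b = "\<lambda>k. L1_norm \<mu> (g k) * norm x ^ Suc k"
  have sb: "summable ?b" by (rule G) simp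
  have le: "L1_norm \<mu> (\<lambda>t. coeff_series x t - (\<Sum>k<n. g k t * apply_bcontfun x t ^ Suc k)) \<le> (\<Sum>k. ?b (k + n))" for n
  proof -
    have "coeff_series x t - (\<Sum>k<n. g k t * apply_bcontfun x t ^ Suc k) = (\<Sum>k. g (k + n) t * apply_bcontfun x t ^ Suc (k + n))" for t
      unfolding coeff_series_def by (rule suminf_minus_initial_segment[symmetric]) (rule summable_norm_cancel[OF term_summable])
    moreover have "L1_norm \<mu> (\<lambda>t. \<Sum>k. g (k + n) t * apply_bcontfun x t ^ Suc (k + n)) \<le> (\<Sum>k. ?b (k + n))"
    proof (rule L1_norm_suminf_le(2)[OF term_integrable(1) _ term_integrable(2)])
      show "summable (\<lambda>k. norm (g (k + n) t * apply_bcontfun x t ^ Suc (k + n)))" for t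
        using term_summable by (subst summable_iff_shift)
      show "summable (\<lambda>k. ?b (k + n))" using sb by (subst summable_iff_shift)
    qed
    ultimately show ?thesis by simp
  qed
  have "(\<lambda>n. suminf ?b - (\<Sum>k<n. ?b k)) \<longlonglongrightarrow> suminf ?b - suminf ?b"
    by (intro tendsto_intros summable_LIMSEQ sb)
  then have "(\<lambda>n. \<Sum>k. ?b (k + n)) \<longlonglongrightarrow> 0"
    using suminf_minus_initial_segment[OF sb] by simp
  from tendsto_sandwich[OF _ _ tendsto_const this] show ?thesis
    using le by (auto simp: L1_norm_def)
qed

lemma
  shows coeff_series_deriv_integrable: "integrable \<mu> (coeff_series_deriv x v)"
    and L1_norm_coeff_series_deriv_le:
      "L1_norm \<mu> (coeff_series_deriv x v) \<le> (\<Sum>k. L1_norm \<mu> (g k) * (real (Suc k) * norm x ^ k)) * norm v"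
proof -
  have sb: "summable (\<lambda>k. L1_norm \<mu> (g k) * (real (Suc k) * norm x ^ k))"
    by (intro summable_with_factor(1) G L1_norm_nonneg norm_ge_zero)
  have le: "norm (of_nat (Suc k) * apply_bcontfun x t ^ k * apply_bcontfun v t) \<le> real (Suc k) * norm x ^ k * norm v" for k t
    unfolding norm_mult norm_of_nat by (intro mult_mono norm_apply_power_le norm_apply_bcontfun_le) auto
  have ti: "integrable \<mu> (\<lambda>t. g k t * (of_nat (Suc k) * apply_bcontfun x t ^ k * apply_bcontfun v t))"
    "L1_norm \<mu> (\<lambda>t. g k t * (of_nat (Suc k) * apply_bcontfun x t ^ k * apply_bcontfun v t))
      \<le> L1_norm \<mu> (g k) * (real (Suc k) * norm x ^ k * norm v)" for k
    by (rule integrable_mult_cont[OF M int _ le]; intro continuous_intros continuous_on_apply_bcontfun)+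
  have sb': "summable (\<lambda>k. L1_norm \<mu> (g k) * (real (Suc k) * norm x ^ k * norm v))"
    using summable_mult2[OF sb, of "norm v"] by (simp add: mult.assoc)
  note * = L1_norm_suminf_le[OF ti(1) deriv_term_summable ti(2) sb']
  show "integrable \<mu> (coeff_series_deriv x v)" using *(1) unfolding coeff_series_deriv_def[abs_def] .
  have "(\<Sum>k. L1_norm \<mu> (g k) * (real (Suc k) * norm x ^ k * norm v))
      = (\<Sum>k. L1_norm \<mu> (g k) * (real (Suc k) * norm x ^ k)) * norm v"
    using suminf_mult2[OF sb, of "norm v"] by (simp add: mult.assoc)
  then show "L1_norm \<mu> (coeff_series_deriv x v) \<le> (\<Sum>k. L1_norm \<mu> (g k) * (real (Suc k) * norm x ^ k)) * norm v"
    using *(2) unfolding coeff_series_deriv_def[abs_def] by simp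
qed

text \<open>
  The remainder of the \<open>k\<close>-th term is of second order in \<open>y - x\<close>, uniformly on balls, with a
  constant that is still summable against the norms of the coefficients.
\<close>
lemma coeff_series_remainder:
  assumes r: "norm x \<le> r" "norm y \<le> r"
  shows "L1_norm \<mu> (\<lambda>t. coeff_series y t - coeff_series x t - coeff_series_deriv x (y - x) t)
    \<le> (\<Sum>k. L1_norm \<mu> (g k) * (real (Suc k) * real k * r ^ (k - 1))) * (norm (y - x))\<^sup>2"
proof -
  have r0: "0 \<le> r" using r(1) norm_ge_zero order_trans by blast
  define R where "R k t = apply_bcontfun y t ^ Suc k - apply_bcontfun x t ^ Suc k
    - of_nat (Suc k) * apply_bcontfun x t ^ k * (apply_bcontfun y t - apply_bcontfun x t)" for k t
  have sb: "summable (\<lambda>k. L1_norm \<mu> (g k) * (real (Suc k) * real k * r ^ (k - 1)))"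
    by (intro summable_with_factor(2) G L1_norm_nonneg r0)
  have le: "norm (R k t) \<le> real (Suc k) * real k * r ^ (k - 1) * (norm (y - x))\<^sup>2" for k t
  proof -
    have "norm (R k t) \<le> real (Suc k) * real k * r ^ (k - 1) * (norm (apply_bcontfun y t - apply_bcontfun x t))\<^sup>2"
      unfolding R_def using r norm_apply_bcontfun_le order_trans by (intro power_remainder_le) blast+
    also have "\<dots> \<le> real (Suc k) * real k * r ^ (k - 1) * (norm (y - x))\<^sup>2"
      using norm_apply_bcontfun_le[of "y - x" t] r0 by (intro mult_left_mono power_mono) auto
    finally show ?thesis .
  qed
  have cR: "cont (R k)" for k unfolding R_def by (intro continuous_intros continuous_on_apply_bcontfun)
  note ti = integrable_mult_cont[OF M int cR le]
  have sb': "summable (\<lambda>k. L1_norm \<mu> (g k) * (real (Suc k) * real k * r ^ (k - 1) * (norm (y - x))\<^sup>2))"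
    using summable_mult2[OF sb, of "(norm (y - x))\<^sup>2"] by (simp add: mult.assoc)
  note s1 = summable_norm_cancel[OF term_summable]
  note s2 = summable_norm_cancel[OF deriv_term_summable]
  have eq: "g k t * R k t = g k t * apply_bcontfun y t ^ Suc k - g k t * apply_bcontfun x t ^ Suc k
      - g k t * (of_nat (Suc k) * apply_bcontfun x t ^ k * apply_bcontfun (y - x) t)" for k t
    unfolding R_def by (simp only: right_diff_distrib minus_bcontfun.rep_eq)
  have sn: "summable (\<lambda>k. norm (g k t * R k t))" for t
  proof (rule summable_comparison_test)
    show "\<exists>N. \<forall>k\<ge>N. norm (norm (g k t * R k t)) \<le> norm (g k t * apply_bcontfun y t ^ Suc k)
        + norm (g k t * apply_bcontfun x t ^ Suc k)
        + norm (g k t * (of_nat (Suc k) * apply_bcontfun x t ^ k * apply_bcontfun (y - x) t))"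
      unfolding eq real_norm_def abs_norm_cancel by (intro exI allI impI order_trans[OF norm_triangle_ineq4] add_mono order_refl norm_triangle_ineq4)
  qed (intro summable_add term_summable deriv_term_summable)
  have "coeff_series y t - coeff_series x t - coeff_series_deriv x (y - x) t = (\<Sum>k. g k t * R k t)" for t
    unfolding eq coeff_series_def coeff_series_deriv_def
    by (simp only: suminf_diff[OF s1 s1] suminf_diff[OF summable_diff[OF s1 s1] s2])
  then have "L1_norm \<mu> (\<lambda>t. coeff_series y t - coeff_series x t - coeff_series_deriv x (y - x) t)
      \<le> (\<Sum>k. L1_norm \<mu> (g k) * (real (Suc k) * real k * r ^ (k - 1) * (norm (y - x))\<^sup>2))"
    using L1_norm_suminf_le(2)[OF ti(1) sn ti(2) sb'] by simp
  also have "\<dots> = (\<Sum>k. L1_norm \<mu> (g k) * (real (Suc k) * real k * r ^ (k - 1))) * (norm (y - x))\<^sup>2"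
    using suminf_mult2[OF sb, of "(norm (y - x))\<^sup>2"] by (simp add: mult.assoc)
  finally show ?thesis .
qed

lemma has_L1_derivative_coeff_series: "has_L1_derivative \<mu> coeff_series (coeff_series_deriv x) x"
  unfolding has_L1_derivative_def
proof (intro conjI allI)
  show "coeff_series_deriv x v \<in> L1 \<mu>" for v by (simp add: L1_def coeff_series_deriv_integrable)
  note s2 = summable_norm_cancel[OF deriv_term_summable]
  show "AE t in \<mu>. coeff_series_deriv x (v + w) t = coeff_series_deriv x v t + coeff_series_deriv x w t" for v w
    unfolding coeff_series_deriv_def by (simp only: suminf_add[OF s2 s2] plus_bcontfun.rep_eq distrib_left) simp
  show "AE t in \<mu>. coeff_series_deriv x (cscale c v) t = c * coeff_series_deriv x v t" for c v
    unfolding coeff_series_deriv_def by (simp only: suminf_mult[OF s2, symmetric] apply_cscale mult.left_commute[of c]) simp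
  show "\<exists>B. \<forall>v. L1_norm \<mu> (coeff_series_deriv x v) \<le> B * norm v"
    using L1_norm_coeff_series_deriv_le by blast
  define C where "C = (\<Sum>k. L1_norm \<mu> (g k) * (real (Suc k) * real k * (norm x + 1) ^ (k - 1)))"
  have "\<forall>\<^sub>F y in at x. L1_norm \<mu> (\<lambda>t. coeff_series y t - coeff_series x t - coeff_series_deriv x (y - x) t) / norm (y - x) \<le> C * norm (y - x)"
  proof -
    have "\<forall>\<^sub>F y in at x. dist y x < 1 \<and> y \<noteq> x" unfolding eventually_at by (intro exI[of _ 1]) auto
    then show ?thesis
    proof eventually_elim
      case (elim y)
      then have "norm y \<le> norm x + 1" using norm_triangle_ineq2[of y x] by (simp add: dist_norm)
      then have "L1_norm \<mu> (\<lambda>t. coeff_series y t - coeff_series x t - coeff_series_deriv x (y - x) t) \<le> C * (norm (y - x))\<^sup>2"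
        unfolding C_def by (intro coeff_series_remainder) auto
      then show ?case using elim by (simp add: divide_le_eq power2_eq_square mult.assoc)
    qed
  qed
  note upper = this
  have "((\<lambda>y. C * norm (y - x)) \<longlongrightarrow> C * norm (x - x)) (at x)"
    by (intro tendsto_intros)
  then have lim: "((\<lambda>y. C * norm (y - x)) \<longlongrightarrow> 0) (at x)" by simp
  show "((\<lambda>y. L1_norm \<mu> (\<lambda>t. coeff_series y t - coeff_series x t - coeff_series_deriv x (y - x) t) / norm (y - x)) \<longlongrightarrow> 0) (at x)"
    by (rule tendsto_sandwich[OF _ upper tendsto_const lim]) (simp add: L1_norm_def)
qed

lemma coeff_series_in_Hb_L1: "coeff_series \<in> Hb_L1 \<mu>"
  unfolding Hb_L1_def
proof (intro CollectI conjI allI impI)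
  show "coeff_series x \<in> L1 \<mu>" for x by (simp add: L1_def coeff_series_integrable)
  show "\<exists>D. has_L1_derivative \<mu> coeff_series D x" for x using has_L1_derivative_coeff_series by blast
  fix S :: "('k \<Rightarrow>\<^sub>C complex) set" assume "bounded S"
  then obtain r where r: "\<And>x. x \<in> S \<Longrightarrow> norm x \<le> r" by (auto simp: bounded_iff)
  have "L1_norm \<mu> (coeff_series x) \<le> (\<Sum>k. L1_norm \<mu> (g k) * r ^ Suc k)" if "x \<in> S" for x
  proof -
    have "0 \<le> r" using r[OF that] norm_ge_zero order_trans by blast
    then have "(\<Sum>k. L1_norm \<mu> (g k) * norm x ^ Suc k) \<le> (\<Sum>k. L1_norm \<mu> (g k) * r ^ Suc k)"
      using r[OF that] by (intro suminf_le G mult_left_mono power_mono L1_norm_nonneg) auto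
    then show ?thesis using L1_norm_coeff_series_le[of x] by linarith
  qed
  then show "\<exists>B. \<forall>x\<in>S. L1_norm \<mu> (coeff_series x) \<le> B" by blast
qed

lemma power_series_function_coeff_series: "power_series_function \<mu> coeff_series"
  unfolding power_series_function_def
proof (intro conjI allI exI[of _ "\<lambda>k. g (k - 1)"])
  show "coeff_series x \<in> L1 \<mu>" for x by (simp add: L1_def coeff_series_integrable)
  show "1 \<le> k \<longrightarrow> g (k - 1) \<in> L1 \<mu>" for k by (simp add: L1_def int)
  show "(\<lambda>n. L1_norm \<mu> (\<lambda>t. coeff_series x t - (\<Sum>k = 1..n. g (k - 1) t * apply_bcontfun x t ^ k))) \<longlonglongrightarrow> 0" for x
    using coeff_series_partial_sums[of x] by (simp add: sum.atLeast1_atMost_eq)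
qed

end

text \<open>
  By monotone convergence the sum of the norms has a finite integral, hence is finite almost
  everywhere.
\<close>
lemma AE_summable_norm:
  fixes u :: "nat \<Rightarrow> 'k \<Rightarrow> 'b::{banach, second_countable_topology}"
  assumes int: "\<And>k. integrable M (u k)" and sm: "summable (\<lambda>k. \<integral>t. norm (u k t) \<partial>M)"
  shows "AE t in M. summable (\<lambda>k. norm (u k t))"
proof -
  have [measurable]: "u k \<in> borel_measurable M" for k using int[of k] by auto
  have "(\<integral>\<^sup>+t. (\<Sum>k. ennreal (norm (u k t))) \<partial>M) = (\<Sum>k. \<integral>\<^sup>+t. ennreal (norm (u k t)) \<partial>M)"
    by (rule nn_integral_suminf) simp
  also have "\<dots> = (\<Sum>k. ennreal (\<integral>t. norm (u k t) \<partial>M))"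
    using int by (intro suminf_cong nn_integral_eq_integral) auto
  also have "\<dots> = ennreal (\<Sum>k. \<integral>t. norm (u k t) \<partial>M)"
    by (rule suminf_ennreal2) (use sm in auto)
  finally have "(\<integral>\<^sup>+t. (\<Sum>k. ennreal (norm (u k t))) \<partial>M) \<noteq> \<infinity>" by simp
  then have "AE t in M. (\<Sum>k. ennreal (norm (u k t))) \<noteq> \<infinity>"
    by (intro nn_integral_PInf_AE) auto
  then show ?thesis
    by eventually_elim (rule summable_suminf_not_top, auto)
qed

text \<open>
  It suffices to treat the countably many integer radii, each of which contributes a null set; the
  coefficients are set to zero on the union of these.
\<close>
lemma pointwise_summable_representatives:
  fixes g :: "nat \<Rightarrow> 'k \<Rightarrow> complex"
  assumes int: "\<And>k. integrable M (g k)"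
    and G: "\<And>r. 0 \<le> r \<Longrightarrow> summable (\<lambda>k. L1_norm M (g k) * r ^ Suc k)"
  obtains g' where "\<And>k. integrable M (g' k)" "\<And>k. AE t in M. g' k t = g k t"
    "\<And>t r. 0 \<le> r \<Longrightarrow> summable (\<lambda>k. norm (g' k t) * r ^ Suc k)"
proof -
  have "AE t in M. \<forall>m::nat. summable (\<lambda>k. norm (g k t) * real m ^ Suc k)"
    unfolding AE_all_countable
  proof
    fix m :: nat
    have "AE t in M. summable (\<lambda>k. norm (g k t * of_nat m ^ Suc k))"
      using G[of "real m"] int by (intro AE_summable_norm) (auto simp: L1_norm_def norm_mult norm_power)
    then show "AE t in M. summable (\<lambda>k. norm (g k t) * real m ^ Suc k)"
      by (simp add: norm_mult norm_power)
  qed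
  then obtain N where N: "N \<in> null_sets M"
      "{t \<in> space M. \<not> (\<forall>m::nat. summable (\<lambda>k. norm (g k t) * real m ^ Suc k))} \<subseteq> N"
    unfolding eventually_ae_filter by blast
  define g' where "g' k t = indicator (space M - N) t *\<^sub>R g k t" for k t
  have "integrable M (g' k)" for k
    unfolding g'_def using N by (intro integrable_mult_indicator int) auto
  moreover have "AE t in M. g' k t = g k t" for k
    using AE_not_in[OF N(1)] AE_space by eventually_elim (simp add: g'_def)
  moreover have "summable (\<lambda>k. norm (g' k t) * r ^ Suc k)" if r: "0 \<le> r" for t r
  proof (cases "t \<in> space M - N")
    case True
    obtain m :: nat where m: "r \<le> real m" using real_arch_simple by blast
    have s: "summable (\<lambda>k. norm (g k t) * real m ^ Suc k)" using True N(2) by blast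
    have "norm (norm (g' k t) * r ^ Suc k) \<le> norm (g k t) * real m ^ Suc k" for k
      using True r m by (auto simp: g'_def abs_mult power_mono simp del: power_Suc intro!: mult_left_mono)
    then show ?thesis using s by (intro summable_comparison_test[OF _ s]) auto
  qed (simp add: g'_def)
  ultimately show thesis using that by blast
qed

text \<open>
  The bounds on the moments are needed for all radii simultaneously, so \<open>complex_Riesz_family\<close> is
  applied with the optimal bounds, that is, with the suprema of their moduli over functions with
  values in \<open>[0, 1]\<close>.
\<close>
lemma orthogonally_additive_imp_integral:
  fixes f :: "('k::t2_space \<Rightarrow>\<^sub>C complex) \<Rightarrow> complex"
  assumes K: "compact (UNIV :: 'k set)" and f: "f \<in> Hb" and oa: "orthogonally_additive f"
  obtains \<mu> :: "'k measure" and h where "finite_measure \<mu>" "regular_borel_measure \<mu>" "h \<in> Hb_L1 \<mu>"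
    "power_series_function \<mu> h" "\<And>x. f x = (\<integral>t. h x t \<partial>\<mu>)"
proof -
  note hs = Hb_imp_entire_bounded_type[OF f]
  define P where "P = below (\<lambda>_::'k. 1)"
  define c where "c k = (SUP v\<in>P. norm (moment f k (\<lambda>t. complex_of_real (v t))))" for k
  have bd: "\<exists>M. \<forall>k. \<forall>v\<in>P. norm (moment f k (\<lambda>t. complex_of_real (v t))) \<le> M / R ^ Suc k" if R: "R > 0" for R
  proof -
    obtain M where "\<And>z. norm z \<le> R \<Longrightarrow> norm (f z) \<le> M"
      using gateaux_entire_bounded[OF entire_bounded_type_imp_gateaux[OF hs]] by blast
    then show ?thesis
      using moment_bound[OF K hs oa R] by (intro exI[of _ M]) (auto simp: P_def below_def)
  qed
  have ne: "P \<noteq> {}" using zero_in_below[of "\<lambda>_::'k. 1"] by (auto simp: P_def)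
  have c_le: "\<exists>M. \<forall>k. c k \<le> M / R ^ Suc k" if R: "R > 0" for R
    using bd[OF R] unfolding c_def by (meson cSUP_least ne)
  have le_c: "norm (moment f k (\<lambda>t. complex_of_real (v t))) \<le> c k" if v: "v \<in> P" for k v
  proof -
    obtain M where "\<forall>v\<in>P. norm (moment f k (\<lambda>t. complex_of_real (v t))) \<le> M / 1 ^ Suc k"
      using bd[OF zero_less_one] by blast
    then show ?thesis unfolding c_def using v by (intro cSUP_upper bdd_aboveI2) auto
  qed
  have c0: "0 \<le> c k" for k
  proof -
    have "(\<lambda>_. 0) \<in> P" unfolding P_def by (rule zero_in_below) simp
    from order_trans[OF norm_ge_zero le_c[OF this]] show ?thesis .
  qed
  have csum: "summable (\<lambda>k. c k * r ^ Suc k)" if r: "0 \<le> r" for r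
  proof -
    define s where "s = r + 1"
    have s: "0 < s" "r \<le> s" using r by (auto simp: s_def)
    obtain M where M: "\<And>k. c k \<le> M / (2 * s) ^ Suc k" using c_le[of "2 * s"] s by auto
    have M0: "0 \<le> M" using order_trans[OF c0[of 0] M[of 0]] s by (simp add: zero_le_divide_iff)
    have le: "norm (c k * r ^ Suc k) \<le> M * (1 / 2) ^ Suc k" for k
    proof -
      have "c k * r ^ Suc k \<le> M / (2 * s) ^ Suc k * s ^ Suc k"
        using M[of k] M0 r s by (intro mult_mono power_mono) auto
      also have "\<dots> = M * (1 / 2) ^ Suc k"
        using s by (simp add: power_mult_distrib power_divide del: power_Suc)
      finally show ?thesis using c0[of k] r by (simp add: abs_mult del: power_Suc)
    qed
    have "summable (\<lambda>k. M * (1 / 2 :: real) ^ Suc k)"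
      by (intro summable_mult, subst summable_Suc_iff) (simp add: summable_geometric)
    then show ?thesis by (rule summable_comparison_test[rotated]) (use le in blast)
  qed
  have cs: "summable c" using csum[of 1] by simp
  obtain \<mu> g0 where \<mu>: "finite_measure \<mu>" "regular_borel_measure \<mu>"
    and g0: "\<And>k. integrable \<mu> (g0 k)" "\<And>k. (\<integral>t. norm (g0 k t) \<partial>\<mu>) \<le> 4 * c k"
      "\<And>k a. cont a \<Longrightarrow> moment f k a = (\<integral>t. g0 k t * a t \<partial>\<mu>)"
  proof (rule complex_Riesz_family[OF K, where L = "moment f" and c = c])
    show "norm (moment f k (\<lambda>t. complex_of_real (v t))) \<le> c k"
      if "cont v" "\<And>t. 0 \<le> v t" "\<And>t. v t \<le> 1" for k v
      using that by (intro le_c) (auto simp: P_def below_def)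
  qed (use moment_add[OF K hs] moment_cmult[OF K hs] cs in auto)
  have M: "sets \<mu> = sets borel" using \<mu>(2) by (simp add: regular_borel_measure_def)
  have G0: "summable (\<lambda>k. L1_norm \<mu> (g0 k) * r ^ Suc k)" if r: "0 \<le> r" for r
  proof (rule summable_comparison_test[OF _ summable_mult[OF csum[OF r], of 4]], intro exI allI impI)
    fix k
    have "L1_norm \<mu> (g0 k) * r ^ Suc k \<le> 4 * c k * r ^ Suc k"
      using g0(2)[of k] r by (intro mult_right_mono) (auto simp: L1_norm_def)
    then show "norm (L1_norm \<mu> (g0 k) * r ^ Suc k) \<le> 4 * (c k * r ^ Suc k)"
      using r by (simp add: abs_mult L1_norm_def del: power_Suc)
  qed
  obtain g where g: "\<And>k. integrable \<mu> (g k)" "\<And>k. AE t in \<mu>. g k t = g0 k t"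
      "\<And>t r. 0 \<le> r \<Longrightarrow> summable (\<lambda>k. norm (g k t) * r ^ Suc k)"
    using pointwise_summable_representatives[OF g0(1) G0] by blast
  have "L1_norm \<mu> (g k) = L1_norm \<mu> (g0 k)" for k
    unfolding L1_norm_def
  proof (rule integral_cong_AE)
    show "AE t in \<mu>. norm (g k t) = norm (g0 k t)" using g(2)[of k] by eventually_elim simp
  qed (use g(1)[of k] g0(1)[of k] in auto)
  then have G: "summable (\<lambda>k. L1_norm \<mu> (g k) * r ^ Suc k)" if "0 \<le> r" for r
    using G0[OF that] by simp
  have "f x = (\<integral>t. coeff_series g x t \<partial>\<mu>)" for x
  proof -
    have cx: "cont (\<lambda>t. apply_bcontfun x t ^ Suc k)" for k
      by (intro continuous_intros continuous_on_apply_bcontfun)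
    have "moment f k (\<lambda>t. apply_bcontfun x t ^ Suc k) = (\<integral>t. g k t * apply_bcontfun x t ^ Suc k \<partial>\<mu>)" for k
      unfolding g0(3)[OF cx]
    proof (rule integral_cong_AE)
      show "AE t in \<mu>. g0 k t * apply_bcontfun x t ^ Suc k = g k t * apply_bcontfun x t ^ Suc k"
        using g(2)[of k] by eventually_elim simp
    qed (use g(1) g0(1) borel_measurable_cont[OF M cx] in \<open>auto intro!: borel_measurable_times\<close>)
    then have "(\<lambda>k. \<integral>t. g k t * apply_bcontfun x t ^ Suc k \<partial>\<mu>) sums f x"
      using moment_expansion[OF K hs oa, of x] by simp
    then show ?thesis
      using coeff_series_sums[OF M g(1) g(3) G] sums_unique2 by blast
  qed
  then show thesis
    using that[OF \<mu> coeff_series_in_Hb_L1[OF M g(1) g(3) G] power_series_function_coeff_series[OF M g(1) g(3) G]] by blast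
qed

text \<open>
  The integrals of the partial sums converge to \<open>f\<close>, and they are orthogonally additive because
  in every power of \<open>x + y\<close> one summand vanishes at each point.
\<close>
lemma integral_of_power_series_orthogonally_additive:
  fixes f :: "('k::topological_space \<Rightarrow>\<^sub>C complex) \<Rightarrow> complex"
  assumes M: "sets \<mu> = sets borel"
    and h: "power_series_function \<mu> h" and f: "\<And>x. f x = (\<integral>t. h x t \<partial>\<mu>)"
  shows "orthogonally_additive f"
proof -
  obtain g where hi: "\<And>x. integrable \<mu> (h x)" and g: "\<And>k. 1 \<le> k \<Longrightarrow> integrable \<mu> (g k)"
    and lim: "\<And>x. (\<lambda>n. L1_norm \<mu> (\<lambda>t. h x t - (\<Sum>k=1..n. g k t * apply_bcontfun x t ^ k))) \<longlonglongrightarrow> 0"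
    using h by (auto simp: power_series_function_def L1_def)
  have gi: "integrable \<mu> (\<lambda>t. g k t * apply_bcontfun x t ^ k)" if "1 \<le> k" for k x
  proof (rule integrable_mult_cont(1)[OF M g[OF that]])
    show "norm (apply_bcontfun x t ^ k) \<le> norm x ^ k" for t
      unfolding norm_power by (intro power_mono norm_apply_bcontfun_le) simp
  qed (intro continuous_intros continuous_on_apply_bcontfun)
  have conv: "(\<lambda>n. \<Sum>k=1..n. \<integral>t. g k t * apply_bcontfun x t ^ k \<partial>\<mu>) \<longlonglongrightarrow> f x" for x
  proof -
    have "norm ((\<Sum>k=1..n. \<integral>t. g k t * apply_bcontfun x t ^ k \<partial>\<mu>) - f x)
        \<le> L1_norm \<mu> (\<lambda>t. h x t - (\<Sum>k=1..n. g k t * apply_bcontfun x t ^ k))" for n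
    proof -
      have s: "integrable \<mu> (\<lambda>t. \<Sum>k=1..n. g k t * apply_bcontfun x t ^ k)"
        by (intro Bochner_Integration.integrable_sum gi) auto
      have "f x - (\<Sum>k=1..n. \<integral>t. g k t * apply_bcontfun x t ^ k \<partial>\<mu>)
          = (\<integral>t. h x t - (\<Sum>k=1..n. g k t * apply_bcontfun x t ^ k) \<partial>\<mu>)"
        using hi s gi by (simp add: f Bochner_Integration.integral_sum)
      then show ?thesis
        unfolding L1_norm_def by (simp add: norm_minus_commute[of _ "f x"])
    qed
    then have "(\<lambda>n. (\<Sum>k=1..n. \<integral>t. g k t * apply_bcontfun x t ^ k \<partial>\<mu>) - f x) \<longlonglongrightarrow> 0"
      by (intro Lim_null_comparison[OF _ lim[of x]]) auto
    then show ?thesis by (simp add: LIM_zero_iff)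
  qed
  show ?thesis
    unfolding orthogonally_additive_def
  proof (intro allI impI)
    fix x y :: "'k \<Rightarrow>\<^sub>C complex"
    assume xy: "\<forall>t. apply_bcontfun x t * apply_bcontfun y t = 0"
    have pw: "apply_bcontfun (x + y) t ^ k = apply_bcontfun x t ^ k + apply_bcontfun y t ^ k" if "1 \<le> k" for k t
    proof -
      have "apply_bcontfun x t = 0 \<or> apply_bcontfun y t = 0" using xy by simp
      then show ?thesis using that by (auto simp: power_0_left)
    qed
    have "(\<integral>t. g k t * apply_bcontfun (x + y) t ^ k \<partial>\<mu>)
        = (\<integral>t. g k t * apply_bcontfun x t ^ k \<partial>\<mu>) + (\<integral>t. g k t * apply_bcontfun y t ^ k \<partial>\<mu>)" if "1 \<le> k" for k
      unfolding pw[OF that] distrib_left by (intro Bochner_Integration.integral_add gi that)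
    then have "(\<Sum>k=1..n. \<integral>t. g k t * apply_bcontfun (x + y) t ^ k \<partial>\<mu>)
        = (\<Sum>k=1..n. \<integral>t. g k t * apply_bcontfun x t ^ k \<partial>\<mu>) + (\<Sum>k=1..n. \<integral>t. g k t * apply_bcontfun y t ^ k \<partial>\<mu>)" for n
      by (simp add: sum.distrib[symmetric])
    then have "(\<lambda>n. \<Sum>k=1..n. \<integral>t. g k t * apply_bcontfun (x + y) t ^ k \<partial>\<mu>) \<longlonglongrightarrow> f x + f y"
      using tendsto_add[OF conv[of x] conv[of y]] by simp
    then show "f (x + y) = f x + f y" using conv[of "x + y"] LIMSEQ_unique by blast
  qed
qed

theorem theorem2p3:
  fixes f :: "('k::t2_space \<Rightarrow>\<^sub>C complex) \<Rightarrow> complex"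
  assumes "compact (UNIV :: 'k set)"
    and "f \<in> Hb"
  shows "orthogonally_additive f \<longleftrightarrow>
    (\<exists>(\<mu> :: 'k measure) h.
       finite_measure \<mu> \<and> regular_borel_measure \<mu> \<and>
       h \<in> Hb_L1 \<mu> \<and> power_series_function \<mu> h \<and>
       (\<forall>x. f x = (\<integral>t. h x t \<partial>\<mu>)))"
proof
  assume oa: "orthogonally_additive f"
  obtain \<mu> :: "'k measure" and h where "finite_measure \<mu>" "regular_borel_measure \<mu>" "h \<in> Hb_L1 \<mu>"
    "power_series_function \<mu> h" "\<And>x. f x = (\<integral>t. h x t \<partial>\<mu>)"
    by (rule orthogonally_additive_imp_integral[OF assms oa]) (rule that)
  then show "\<exists>(\<mu> :: 'k measure) h. finite_measure \<mu> \<and> regular_borel_measure \<mu> \<and>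
      h \<in> Hb_L1 \<mu> \<and> power_series_function \<mu> h \<and> (\<forall>x. f x = (\<integral>t. h x t \<partial>\<mu>))"
    by (intro exI[of _ \<mu>] exI[of _ h]) simp
next
  assume "\<exists>(\<mu> :: 'k measure) h. finite_measure \<mu> \<and> regular_borel_measure \<mu> \<and>
      h \<in> Hb_L1 \<mu> \<and> power_series_function \<mu> h \<and> (\<forall>x. f x = (\<integral>t. h x t \<partial>\<mu>))"
  then show "orthogonally_additive f"
    using integral_of_power_series_orthogonally_additive
    by (auto simp: regular_borel_measure_def)
qed

end
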